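(* Let $1<p<2$, $q=p/(p-1)$, and let $\beta>0$ be such that $\beta q<1$. Let $f\in\mathrm{Lip}_\delta(\mathbb{T})$, where $\delta>\beta+\frac1p-\frac12$. Suppose that the zero set $\mathcal{Z}(f)$ has Lebesgue measure zero. If $$\int_{\mathbb{T}}\log d(\zeta,\mathcal{Z}(f))\,|d\zeta|=-\infty,$$ then $$[f]_{\mathbb{Z}}^{A^p_\beta(\mathbb{T})}=[f]_{\mathbb{N}_0}^{A^p_\beta(\mathbb{T})}.$$ Furthermore, if in addition $f\in A^1_\beta(\mathbb{T})$ and $\dim(\mathcal{Z}(f))<\frac{2}{q}(1-\beta q)$, then $f$ is cyclic in $A^p_\beta(\mathbb{T})$.
   Context: $\mathbb{T}$ is the unit circle of $\mathbb{C}$; $\mathbb{N}_0$ is the set of non-negative integers. $\mathrm{Lip}_\delta(\mathbb{T})$ is the set of functions $f:\mathbb{T}\to\mathbb{C}$ for which there is $C>0$ with $|f(\zeta)-f(\zeta')|\le C|\zeta-\zeta'|^\delta$ for all $\zeta,\zeta'\in\mathbb{T}$. $\mathcal{Z}(f)=\{\zeta\in\mathbb{T}: f(\zeta)=0\}$, $d(\cdot,E)$ is the Euclidean distance to $E$, and $\dim$ is Hausdorff dimension. For $r\ge1$ and $\beta\in\mathbb{R}$, $A^r_\beta(\mathbb{T})$ is the Banach space of distributions $S$ on $\mathbb{T}$ with Fourier coefficients $\widehat{S}(n)=\langle S,z^{-n}\rangle$ (equal to $\int_{\mathbb{T}} S(\zeta)\zeta^{-n}\frac{|d\zeta|}{2\pi}$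 when $S\in L^1(\mathbb{T})$) satisfying $\|S\|_{A^r_\beta}^r=\sum_{n\in\mathbb{Z}}|\widehat{S}(n)|^r(1+|n|)^{r\beta}<\infty$. Under the hypothesis $\delta>\beta+\frac1p-\frac12$ one has $\mathrm{Lip}_\delta(\mathbb{T})\subset A^p_\beta(\mathbb{T})$. For $X=A^p_\beta(\mathbb{T})$, $f\in X$ and $\Lambda\subset\mathbb{Z}$, $[f]_\Lambda^X$ denotes the closed linear span in $X$ of $\{z^nf: n\in\Lambda\}$ (multiplication by $z^n$ shifts Fourier coefficients: $\widehat{z^nf}(m)=\widehat{f}(m-n)$), and $f$ is cyclic in $X$ if $[f]_{\mathbb{N}_0}^X=X$. *)

theory Defs
  imports "HOL-Analysis.Analysis"
begin

section \<open>The unit circle\<close>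

abbreviation unit_circle :: "complex set" where
  "unit_circle \<equiv> sphere 0 1"

text \<open>The measure \<open>|d\<zeta>|\<close>, of total mass \<open>2\<pi>\<close>. Its underlying space is the circle itself, so values
  of functions off the circle play no role in measurability or integration.\<close>

definition arc_length :: "complex measure" where
  "arc_length = distr (restrict_space lborel {0..<2 * pi}) (restrict_space borel unit_circle) cis"

definition Lip :: "real \<Rightarrow> (complex \<Rightarrow> complex) set" where
  "Lip \<delta> = {f. \<exists>C>0. \<forall>z\<in>unit_circle. \<forall>w\<in>unit_circle.
     norm (f z - f w) \<le> C * norm (z - w) powr \<delta>}"

definition zero_set :: "(complex \<Rightarrow> complex) \<Rightarrow> complex set" where
  "zero_set f = {z \<in> unit_circle. f z = 0}"

section \<open>Logarithmic integrals\<close>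

text \<open>\<^const>\<open>infdist\<close> to the empty set is \<open>0\<close> and \<open>ln 0 = 0\<close> in the library. The extended-real
  versions below have the usual values \<open>d(z,{}) = \<infinity>\<close> and \<open>log 0 = -\<infinity>\<close>.\<close>

definition ext_dist :: "'a::metric_space \<Rightarrow> 'a set \<Rightarrow> ereal" where
  "ext_dist z E = (INF w\<in>E. ereal (dist z w))"

definition ext_ln :: "ereal \<Rightarrow> ereal" where
  "ext_ln x = (if x \<le> 0 then -\<infinity> else if x = \<infinity> then \<infinity> else ereal (ln (real_of_ereal x)))"

text \<open>Integral of the positive part minus integral of the negative part: \<^const>\<open>e2ennreal\<close> sends
  negative arguments to \<open>0\<close>. The undefined case \<open>\<infinity> - \<infinity>\<close> evaluates to \<open>\<infinity>\<close>, never to \<open>-\<infinity>\<close>.\<close>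

definition ext_integral :: "'a measure \<Rightarrow> ('a \<Rightarrow> ereal) \<Rightarrow> ereal" where
  "ext_integral M g =
     enn2ereal (\<integral>\<^sup>+x. e2ennreal (g x) \<partial>M) - enn2ereal (\<integral>\<^sup>+x. e2ennreal (- g x) \<partial>M)"

section \<open>Hausdorff dimension\<close>

definition hausdorff_premeasure :: "real \<Rightarrow> real \<Rightarrow> 'a::metric_space set \<Rightarrow> ennreal" where
  "hausdorff_premeasure s \<epsilon> E =
     (INF U\<in>{U :: nat \<Rightarrow> 'a set. E \<subseteq> (\<Union>i. U i) \<and> (\<forall>i. bounded (U i) \<and> diameter (U i) \<le> \<epsilon>)}.
        \<Sum>i. ennreal (diameter (U i) powr s))"

definition hausdorff_measure :: "real \<Rightarrow> 'a::metric_space set \<Rightarrow> ennreal" where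
  "hausdorff_measure s E = (SUP \<epsilon>\<in>{0<..}. hausdorff_premeasure s \<epsilon> E)"

text \<open>Only \<open>s > 0\<close> is used, since \<open>0 powr 0 = 0\<close> makes \<open>s = 0\<close> exceptional; the infimum is
  unaffected.\<close>

definition hausdorff_dim :: "'a::metric_space set \<Rightarrow> ereal" where
  "hausdorff_dim E = (INF s\<in>{s. 0 < s \<and> hausdorff_measure s E = 0}. ereal s)"

section \<open>Distributions on the circle\<close>

text \<open>Derivatives of functions on the circle are taken in the angle \<open>t\<close>, with \<open>z = cis t\<close>.\<close>

definition angular_deriv :: "nat \<Rightarrow> (complex \<Rightarrow> complex) \<Rightarrow> real \<Rightarrow> complex" where
  "angular_deriv k \<phi> = ((\<lambda>g t. vector_derivative g (at t)) ^^ k) (\<lambda>t. \<phi> (cis t))"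

definition smooth_on_circle :: "(complex \<Rightarrow> complex) \<Rightarrow> bool" where
  "smooth_on_circle \<phi> \<longleftrightarrow> (\<forall>k t. angular_deriv k \<phi> differentiable at t)"

text \<open>A distribution is a linear functional on smooth functions on the circle which is continuous
  for the Frechet topology given by the norms \<open>\<phi> \<mapsto> (\<Sum>k\<le>N. sup |\<phi>\<^sup>(\<^sup>k\<^sup>)|)\<close>. Test functions are
  represented by arbitrary extensions to \<open>\<complex>\<close>; independence of the extension together with the value
  \<open>0\<close> off the test functions makes this representation of distributions unique.\<close>

definition circle_distribution :: "((complex \<Rightarrow> complex) \<Rightarrow> complex) \<Rightarrow> bool" where
  "circle_distribution S \<longleftrightarrow>
     (\<forall>\<phi>. \<not> smooth_on_circle \<phi> \<longrightarrow> S \<phi> = 0) \<and>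
     (\<forall>\<phi> \<psi>. (\<forall>z\<in>unit_circle. \<phi> z = \<psi> z) \<longrightarrow> S \<phi> = S \<psi>) \<and>
     (\<forall>\<phi> \<psi> a b. smooth_on_circle \<phi> \<longrightarrow> smooth_on_circle \<psi> \<longrightarrow>
        S (\<lambda>z. a * \<phi> z + b * \<psi> z) = a * S \<phi> + b * S \<psi>) \<and>
     (\<exists>C N. \<forall>\<phi>. smooth_on_circle \<phi> \<longrightarrow>
        norm (S \<phi>) \<le> C * (\<Sum>k\<le>N. SUP t. norm (angular_deriv k \<phi> t)))"

definition fourier_coeff :: "((complex \<Rightarrow> complex) \<Rightarrow> complex) \<Rightarrow> int \<Rightarrow> complex" where
  "fourier_coeff S n = S (\<lambda>z. z powi (- n))"

definition distr_of_fun :: "(complex \<Rightarrow> complex) \<Rightarrow> (complex \<Rightarrow> complex) \<Rightarrow> complex" where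
  "distr_of_fun f \<phi> =
     (if smooth_on_circle \<phi> then (\<integral>z. f z * \<phi> z \<partial>arc_length) / (2 * pi) else 0)"

definition mult_power :: "int \<Rightarrow> ((complex \<Rightarrow> complex) \<Rightarrow> complex) \<Rightarrow> (complex \<Rightarrow> complex) \<Rightarrow> complex" where
  "mult_power n S \<phi> = S (\<lambda>z. z powi n * \<phi> z)"

section \<open>The spaces $A^r_\beta$ and cyclicity\<close>

definition A_space :: "real \<Rightarrow> real \<Rightarrow> ((complex \<Rightarrow> complex) \<Rightarrow> complex) set" where
  "A_space r \<beta> = {S. circle_distribution S \<and>
     (\<lambda>n. norm (fourier_coeff S n) powr r * (1 + \<bar>real_of_int n\<bar>) powr (r * \<beta>)) summable_on UNIV}"

text \<open>Meaningful only on \<^const>\<open>A_space\<close>.\<close>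

definition A_norm :: "real \<Rightarrow> real \<Rightarrow> ((complex \<Rightarrow> complex) \<Rightarrow> complex) \<Rightarrow> real" where
  "A_norm r \<beta> S =
     (\<Sum>\<^sub>\<infinity>n\<in>UNIV. norm (fourier_coeff S n) powr r * (1 + \<bar>real_of_int n\<bar>) powr (r * \<beta>)) powr (1 / r)"

definition shift_span ::
  "((complex \<Rightarrow> complex) \<Rightarrow> complex) \<Rightarrow> int set \<Rightarrow> ((complex \<Rightarrow> complex) \<Rightarrow> complex) set" where
  "shift_span S \<Lambda> = {(\<lambda>\<phi>. \<Sum>n\<in>F. c n * mult_power n S \<phi>) |F c. finite F \<and> F \<subseteq> \<Lambda>}"

text \<open>The closed linear span \<open>[S]\<^sub>\<Lambda>\<close>, for \<open>S \<in> A_space r \<beta>\<close>: the norm closure of the span.\<close>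

definition closed_shift_span ::
  "real \<Rightarrow> real \<Rightarrow> ((complex \<Rightarrow> complex) \<Rightarrow> complex) \<Rightarrow> int set \<Rightarrow> ((complex \<Rightarrow> complex) \<Rightarrow> complex) set" where
  "closed_shift_span r \<beta> S \<Lambda> = {T \<in> A_space r \<beta>.
     \<forall>\<epsilon>>0. \<exists>P\<in>shift_span S \<Lambda>. A_norm r \<beta> (\<lambda>\<phi>. T \<phi> - P \<phi>) < \<epsilon>}"

definition cyclic :: "real \<Rightarrow> real \<Rightarrow> ((complex \<Rightarrow> complex) \<Rightarrow> complex) \<Rightarrow> bool" where
  "cyclic r \<beta> S \<longleftrightarrow> S \<in> A_space r \<beta> \<and> closed_shift_span r \<beta> S {0..} = A_space r \<beta>"

end

theory Submission
  imports Defs "HOL-Complex_Analysis.Complex_Analysis"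
begin

text \<open>By Hoelder's inequality on dyadic blocks of frequencies, \<open>A\<^sup>p\<^sub>\<beta>\<close> is controlled by any \<open>L\<^sup>2\<close> modulus of
  continuity of order \<open>s > \<beta> + 1/p - 1/2\<close>, and \<open>f\<close> is Hoelder of some order \<open>\<delta>\<close> with \<open>s < \<delta> \<le> 1/2\<close>.
  Both parts are therefore constructive approximations in this Hilbert scale, without duality.

  For the equality of spans, let \<open>E\<close> be the zero set and \<open>U\<close> the holomorphic function whose real part
  regularizes \<open>log (1/d(\<cdot>, E))\<close> at finitely many dyadic scales, so that \<open>U(0) = M\<close> tends to infinity with
  the number of scales. The functions \<open>g = exp (c (U - M))\<close> satisfy \<open>g(0) = 1\<close>, while for small \<open>c\<close> the
  squared norm of \<open>g f\<close> is of order \<open>exp (- 2 c M) (1 + M)\<close>. Replacing \<open>g\<close> by a Taylor polynomial \<open>P\<close>,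
  \<open>z\<^sup>-\<^sup>1 f\<close> is close to \<open>z\<^sup>-\<^sup>1 (1 - P) f\<close>, a polynomial times \<open>f\<close>.

  For cyclicity, the dimension bound gives a cutoff \<open>\<phi>\<close> of small norm with \<open>\<phi> = 1\<close> near \<open>E\<close>. A trigonometric
  polynomial \<open>g\<close> is close to \<open>g (1 - \<phi>) = u f\<close>, where \<open>u = g (1 - \<phi>) / f\<close> is again Hoelder of order \<open>\<delta>\<close>
  and so is approximated by trigonometric polynomials.\<close>

section \<open>Arc length\<close>

text \<open>The critical order is \<open>\<sigma> = \<beta> + 1/p - 1/2\<close>. The hypothesis
  \<open>\<beta> q < 1\<close> says that \<open>\<sigma> < 1/2\<close>, and
  \<open>2/q (1 - \<beta> q)\<close> equals \<open>1 - 2 \<sigma>\<close>. A bump of width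
  \<open>l\<close> has squared norm of order \<open>l^(1 - 2 s)\<close>, so sets of Hausdorff
  measure zero in that exponent have cheap cutoffs. For the first part, \<open>|g|\<close> is at
  most a constant times \<open>exp (- c M) d^(-\<eta>)\<close> on the circle and \<open>|f|\<close>
  at most a constant times \<open>d^\<delta>\<close>, so \<open>g f\<close> is uniformly small. The
  obstacle is its smoothness: the imaginary part of \<open>U\<close> is a conjugate function without
  pointwise control. Away from \<open>E\<close> its increments are controlled only in the mean, by a
  Riesz potential whose integral is at most a constant times \<open>M\<close>; this is the origin of
  the factor \<open>1 + M\<close>. The gaps in \<open>\<sigma> < s < \<delta>\<close> are both
  spent: the first sums the dyadic blocks, the second pays for the growth of \<open>g\<close> near
  \<open>E\<close> and for passing from uniform to Hoelder approximation.\<close>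

lemma space_arc_length [simp]: "space arc_length = unit_circle"
  by (simp add: arc_length_def space_restrict_space)

lemma sets_arc_length [measurable_cong]:
  "sets arc_length = sets (restrict_space borel unit_circle)"
  by (simp add: arc_length_def)

lemma cis_measurable [measurable]:
  "cis \<in> measurable (restrict_space lborel {0..<2 * pi}) (restrict_space borel unit_circle)"
proof (intro measurable_restrict_space2 measurable_restrict_space1)
  show "cis \<in> borel_measurable lborel"
    by (simp, rule borel_measurable_continuous_onI) (auto intro!: continuous_intros simp: cis_conv_exp)
qed auto

lemma borel_measurable_arc_length:
  "f \<in> borel_measurable borel \<Longrightarrow> f \<in> borel_measurable arc_length"
  unfolding measurable_cong_sets[OF sets_arc_length refl] by (rule measurable_restrict_space1)

lemma continuous_measurable_arc_length:
  fixes f :: "complex \<Rightarrow> 'b::topological_space"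
  assumes "continuous_on unit_circle f"
  shows "f \<in> borel_measurable arc_length"
  unfolding measurable_cong_sets[OF sets_arc_length refl]
  by (rule borel_measurable_continuous_on_restrict[OF assms])

lemma nn_integral_arc_length:
  assumes "f \<in> borel_measurable arc_length"
  shows "(\<integral>\<^sup>+z. f z \<partial>arc_length) = (\<integral>\<^sup>+x. f (cis x) * indicator {0..<2 * pi} x \<partial>lborel)"
  using assms unfolding arc_length_def
  by (subst nn_integral_distr) (auto simp: nn_integral_restrict_space)

lemma emeasure_arc_length_circle: "emeasure arc_length unit_circle = ennreal (2 * pi)"
proof -
  have "emeasure arc_length unit_circle = (\<integral>\<^sup>+z. 1 \<partial>arc_length)"
    by simp
  also have "\<dots> = (\<integral>\<^sup>+x. indicator {0..<2 * pi} x \<partial>lborel)"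
    by (subst nn_integral_arc_length) auto
  also have "\<dots> = ennreal (2 * pi)" by simp
  finally show ?thesis .
qed

interpretation arc_length: finite_measure arc_length
  by (rule finite_measureI) (simp add: emeasure_arc_length_circle)

section \<open>Rotation invariance\<close>

lemma borel_measurable_arc_length_cis:
  assumes "f \<in> borel_measurable arc_length"
  shows "(\<lambda>x. f (cis x)) \<in> borel_measurable borel"
proof -
  have "cis \<in> measurable borel (restrict_space borel unit_circle)"
    by (intro measurable_restrict_space2 borel_measurable_continuous_onI)
       (auto intro!: continuous_intros simp: cis_conv_exp)
  then show ?thesis
    using assms unfolding measurable_cong_sets[OF sets_arc_length refl] by (rule measurable_compose)
qed

text \<open>The window \<open>[t, T + t)\<close> is cut at \<open>T\<close>, and the piece beyond
  \<open>T\<close> is moved back by one period, where it fills \<open>[0, t)\<close>.\<close>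

lemma nn_integral_periodic_shift:
  fixes g :: "real \<Rightarrow> ennreal"
  assumes g: "g \<in> borel_measurable borel" and per: "\<And>x. g (x + T) = g x" and t: "0 \<le> t" "t \<le> T"
  shows "(\<integral>\<^sup>+x. g (x + t) * indicator {0..<T} x \<partial>lborel) = (\<integral>\<^sup>+x. g x * indicator {0..<T} x \<partial>lborel)"
proof -
  have shift: "(\<integral>\<^sup>+x. h x \<partial>lborel) = (\<integral>\<^sup>+x. h (x + a) \<partial>lborel)" if "h \<in> borel_measurable borel"
    for h :: "real \<Rightarrow> ennreal" and a
    using nn_integral_real_affine[of h 1 a] that by (simp add: add.commute)
  have "(\<integral>\<^sup>+x. g (x + t) * indicator {0..<T} x \<partial>lborel)
      = (\<integral>\<^sup>+x. g (x + t) * indicator {t..<T + t} (x + t) \<partial>lborel)"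
    by (intro nn_integral_cong) (auto simp: indicator_def)
  also have "\<dots> = (\<integral>\<^sup>+x. g x * indicator {t..<T + t} x \<partial>lborel)"
    by (rule shift[symmetric]) (use g in measurable)
  also have "\<dots> = (\<integral>\<^sup>+x. g x * indicator {t..<T} x + g x * indicator {T..<T + t} x \<partial>lborel)"
    by (intro nn_integral_cong) (use t in \<open>auto simp: indicator_def\<close>)
  also have "\<dots> = (\<integral>\<^sup>+x. g x * indicator {t..<T} x \<partial>lborel) + (\<integral>\<^sup>+x. g x * indicator {T..<T + t} x \<partial>lborel)"
    using g by (intro nn_integral_add) auto
  also have "(\<integral>\<^sup>+x. g x * indicator {T..<T + t} x \<partial>lborel) = (\<integral>\<^sup>+x. g (x + T) * indicator {T..<T + t} (x + T) \<partial>lborel)"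
    by (rule shift) (use g in measurable)
  also have "\<dots> = (\<integral>\<^sup>+x. g x * indicator {0..<t} x \<partial>lborel)"
    by (intro nn_integral_cong) (auto simp: per indicator_def)
  also have "(\<integral>\<^sup>+x. g x * indicator {t..<T} x \<partial>lborel) + \<dots>
      = (\<integral>\<^sup>+x. g x * indicator {t..<T} x + g x * indicator {0..<t} x \<partial>lborel)"
    using g by (intro nn_integral_add[symmetric]) auto
  also have "\<dots> = (\<integral>\<^sup>+x. g x * indicator {0..<T} x \<partial>lborel)"
    by (intro nn_integral_cong) (use t in \<open>auto simp: indicator_def\<close>)
  finally show ?thesis .
qed

lemma measurable_rotate [measurable]: "(\<lambda>z. z * cis t) \<in> measurable arc_length arc_length"
  unfolding measurable_cong_sets[OF sets_arc_length sets_arc_length]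
  by (intro measurable_restrict_space2 measurable_restrict_space1 borel_measurable_continuous_onI)
     (auto intro!: continuous_intros simp: space_restrict_space norm_mult)

lemma nn_integral_rotate:
  assumes f: "f \<in> borel_measurable arc_length"
  shows "(\<integral>\<^sup>+z. f (z * cis t) \<partial>arc_length) = (\<integral>\<^sup>+z. f z \<partial>arc_length)"
proof -
  \<comment> \<open>Reduction of the angle modulo \<open>2 * pi\<close>, since the shift lemma
    accepts shifts within one period only.\<close>
  define s where "s = t - 2 * pi * \<lfloor>t / (2 * pi)\<rfloor>"
  have "cis t = cis s"
    using cis_multiple_2pi[of "\<lfloor>t / (2 * pi)\<rfloor>"]
    by (simp add: s_def cis_divide[symmetric] mult.commute)
  have s: "0 \<le> s" "s \<le> 2 * pi"
  proof -
    show "0 \<le> s" "s \<le> 2 * pi"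
      using floor_divide_lower[of "2 * pi" t] floor_divide_upper[of "2 * pi" t]
      by (simp_all add: s_def algebra_simps)
  qed
  have "(\<integral>\<^sup>+z. f (z * cis t) \<partial>arc_length) = (\<integral>\<^sup>+x. f (cis (x + s)) * indicator {0..<2 * pi} x \<partial>lborel)"
    using f by (subst nn_integral_arc_length) (auto simp: \<open>cis t = cis s\<close> cis_mult)
  also have "\<dots> = (\<integral>\<^sup>+x. f (cis x) * indicator {0..<2 * pi} x \<partial>lborel)"
    by (rule nn_integral_periodic_shift)
       (use s borel_measurable_arc_length_cis[OF f] in \<open>auto simp: cis_mult[symmetric]\<close>)
  also have "\<dots> = (\<integral>\<^sup>+z. f z \<partial>arc_length)"
    using f by (simp add: nn_integral_arc_length)
  finally show ?thesis .
qed

lemma nn_integral_rotate':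
  assumes f: "f \<in> borel_measurable arc_length" and "w \<in> unit_circle"
  shows "(\<integral>\<^sup>+z. f (z * w) \<partial>arc_length) = (\<integral>\<^sup>+z. f z \<partial>arc_length)"
proof -
  have "w \<noteq> 0" using assms by auto
  then have "w = cis (Arg w)" using assms by (simp add: cis_Arg sgn_eq)
  then show ?thesis using nn_integral_rotate[OF f, of "Arg w"] by simp
qed

text \<open>Invariance at the level of the measure carries over from non-negative integrals to
  Bochner integrals of complex functions.\<close>

lemma distr_rotate: "distr arc_length arc_length (\<lambda>z. z * cis t) = arc_length"
proof (rule measure_eqI)
  fix A assume "A \<in> sets (distr arc_length arc_length (\<lambda>z. z * cis t))"
  then have A: "A \<in> sets arc_length" by simp
  have "emeasure (distr arc_length arc_length (\<lambda>z. z * cis t)) A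
      = (\<integral>\<^sup>+z. indicator A z \<partial>distr arc_length arc_length (\<lambda>z. z * cis t))"
    using A by simp
  also have "\<dots> = (\<integral>\<^sup>+z. indicator A (z * cis t) \<partial>arc_length)"
    using A by (subst nn_integral_distr) auto
  also have "\<dots> = emeasure arc_length A"
    using A by (subst nn_integral_rotate) auto
  finally show "emeasure (distr arc_length arc_length (\<lambda>z. z * cis t)) A = emeasure arc_length A" .
qed simp

lemma integral_rotate:
  fixes f :: "complex \<Rightarrow> complex"
  assumes "f \<in> borel_measurable arc_length"
  shows "(\<integral>z. f (z * cis t) \<partial>arc_length) = (\<integral>z. f z \<partial>arc_length)"
  using integral_distr[OF measurable_rotate assms, of t] by (simp add: distr_rotate)

lemma integrable_arc_length:
  fixes f :: "complex \<Rightarrow> 'b::{banach,second_countable_topology}"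
  assumes "continuous_on unit_circle f"
  shows "integrable arc_length f"
proof -
  have "bounded (f ` unit_circle)"
    by (intro compact_imp_bounded compact_continuous_image assms compact_sphere)
  then obtain B where "\<And>z. z \<in> unit_circle \<Longrightarrow> norm (f z) \<le> B"
    unfolding bounded_iff by blast
  then show ?thesis
    by (intro arc_length.integrable_const_bound[where B = B])
       (auto intro: continuous_measurable_arc_length assms)
qed

section \<open>Measure of arcs and integration over dyadic shells\<close>

lemma sin_ge_half: 
  fixes y :: real
  assumes "0 \<le> y" "y \<le> pi / 2"
  shows "y / 2 \<le> sin y"
proof -
  have "\<bar>sin y - (\<Sum>i<3. sin_coeff i * y ^ i)\<bar> \<le> inverse (fact 3) * \<bar>y\<bar> ^ 3"
    by (rule Maclaurin_sin_bound)
  moreover have "(\<Sum>i<3. sin_coeff i * y ^ i) = y" by (simp add: eval_nat_numeral sin_coeff_def)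
  moreover have "fact 3 = (6 :: real)" by (simp add: eval_nat_numeral)
  ultimately have "\<bar>sin y - y\<bar> \<le> y ^ 3 / 6" using assms by simp
  then have "y - y ^ 3 / 6 \<le> sin y" by linarith
  \<comment> \<open>The cubic Taylor term costs at most half of \<open>y\<close> because
    \<open>y^2 \<le> 3\<close> on \<open>[0, pi / 2]\<close>.\<close>
  moreover have "y ^ 3 / 6 \<le> y / 2"
  proof -
    have "y \<le> 1.6" using assms pi_approx by simp
    then have "y^2 \<le> 1.6^2" using assms by (intro power_mono)
    also have "\<dots> \<le> (3::real)" by (simp add: power2_eq_square)
    finally have "y * y^2 \<le> y * 3" using assms by (intro mult_left_mono) auto
    then show ?thesis by (simp add: power_numeral_reduce)
  qed
  ultimately show ?thesis by linarith
qed

text \<open>After a rotation \<open>w = 1\<close>. The point at angle \<open>x\<close> is at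
  distance \<open>2 |sin (x / 2)|\<close> from 1, so a distance of at most \<rho> leaves
  \<open>x\<close> within \<open>2 * \<rho>\<close> of 0 or of \<open>2 * pi\<close>. The two arcs
  have total length \<open>4 * \<rho>\<close>; the constant 8 is generous.\<close>

lemma arc_length_cball:
  assumes w: "w \<in> unit_circle" and "0 \<le> \<rho>"
  shows "emeasure arc_length {z \<in> unit_circle. norm (z - w) \<le> \<rho>} \<le> ennreal (8 * \<rho>)"
proof -
  have m: "{z \<in> unit_circle. norm (z - v) \<le> \<rho>} \<in> sets arc_length" for v
  proof -
    have "{z \<in> space arc_length. norm (z - v) \<le> \<rho>} \<in> sets arc_length"
      by (intro measurable_sets borel_measurable_le borel_measurable_arc_length) auto
    then show ?thesis by simp
  qed
  have "emeasure arc_length {z \<in> unit_circle. norm (z - w) \<le> \<rho>}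
      = (\<integral>\<^sup>+z. indicator {z \<in> unit_circle. norm (z - w) \<le> \<rho>} z \<partial>arc_length)"
    using m by simp
  also have "\<dots> = (\<integral>\<^sup>+z. indicator {z \<in> unit_circle. norm (z - w) \<le> \<rho>} (z * w) \<partial>arc_length)"
    using m w by (subst nn_integral_rotate') auto
  also have "\<dots> = (\<integral>\<^sup>+z. indicator {z \<in> unit_circle. norm (z - 1) \<le> \<rho>} z \<partial>arc_length)"
  proof (intro nn_integral_cong)
    fix z assume "z \<in> space arc_length"
    have "norm (z * w - w) = norm (z - 1)"
      using w by (metis left_diff_distrib mult_1 mult.right_neutral norm_mult mem_sphere_0)
    then show "indicator {z \<in> unit_circle. norm (z - w) \<le> \<rho>} (z * w)
       = (indicator {z \<in> unit_circle. norm (z - 1) \<le> \<rho>} z :: ennreal)"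
      using w \<open>z \<in> space arc_length\<close> by (simp add: indicator_def norm_mult)
  qed
  also have "\<dots> = (\<integral>\<^sup>+x. indicator {z \<in> unit_circle. norm (z - 1) \<le> \<rho>} (cis x) * indicator {0..<2 * pi} x \<partial>lborel)"
    using m by (subst nn_integral_arc_length) auto
  also have "\<dots> \<le> (\<integral>\<^sup>+x. indicator ({0..2 * \<rho>} \<union> {2 * pi - 2 * \<rho>..2 * pi}) x \<partial>lborel)"
  proof (intro nn_integral_mono)
    fix x :: real
    show "indicator {z \<in> unit_circle. norm (z - 1) \<le> \<rho>} (cis x) * indicator {0..<2 * pi} x
      \<le> (indicator ({0..2 * \<rho>} \<union> {2 * pi - 2 * \<rho>..2 * pi}) x :: ennreal)"
    proof (cases "0 \<le> x \<and> x < 2 * pi \<and> norm (cis x - 1) \<le> \<rho>")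
      case True
      have "norm (cis x - 1) = 2 * \<bar>sin (x / 2)\<bar>"
        using dist_exp_i_1[of x] by (simp add: cis_conv_exp)
      with True have s: "2 * sin (x / 2) \<le> \<rho>" by linarith
      have "x \<le> 2 * \<rho> \<or> 2 * pi - x \<le> 2 * \<rho>"
      proof (cases "x \<le> pi")
        case le: True
        then show ?thesis using sin_ge_half[of "x / 2"] True s by simp
      next
        case False
        then show ?thesis using sin_ge_half[of "pi - x / 2"] True s by simp
      qed
      then show ?thesis using True by (auto simp: indicator_def)
    next
      case False
      then show ?thesis by (auto simp: indicator_def)
    qed
  qed
  also have "\<dots> \<le> emeasure lborel {0..2 * \<rho>} + emeasure lborel {2 * pi - 2 * \<rho>..2 * pi}"
    by (subst nn_integral_indicator) (auto intro: emeasure_subadditive)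
  also have "\<dots> \<le> ennreal (8 * \<rho>)"
    using assms by (simp flip: ennreal_plus)
  finally show ?thesis .
qed

lemma borel_set_arc_length [measurable]:
  assumes "Measurable.pred borel P"
  shows "{z \<in> unit_circle. P z} \<in> sets arc_length"
  unfolding sets_arc_length using assms
  by (auto simp: sets_restrict_space pred_def intro!: image_eqI[where x = "{z. P z}"])

lemma cball_sets_arc_length [measurable]: "{z \<in> unit_circle. norm (z - w) \<le> \<rho>} \<in> sets arc_length"
  by (rule borel_set_arc_length) measurable

lemma ennreal_le_suminf: "f i \<le> (\<Sum>i. f i)" for f :: "nat \<Rightarrow> ennreal"
  using sum_le_suminf[of f "{i}"] by simp

text \<open>The function is dominated by the series of heights \<open>a i\<close> on arcs of radius
  \<open>\<rho> i\<close>, each of measure at most \<open>8 * \<rho> i\<close>. Since one suitable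
  \<open>i\<close> at each point is enough, the arcs may overlap, and the same bound serves for
  shrinking and for growing shells.\<close>

lemma nn_integral_dyadic_bound:
  assumes w: "w \<in> unit_circle" and k: "k \<in> borel_measurable arc_length"
    and \<rho>: "\<And>i. 0 \<le> \<rho> i" and a: "\<And>i. 0 \<le> a i"
    and le: "\<And>z. z \<in> unit_circle \<Longrightarrow> \<exists>i. k z \<le> ennreal (a i) \<and> norm (z - w) \<le> \<rho> i"
    and sums: "(\<lambda>i. a i * \<rho> i) sums S"
  shows "(\<integral>\<^sup>+z. k z \<partial>arc_length) \<le> ennreal (8 * S)"
proof -
  let ?B = "\<lambda>i. {z \<in> unit_circle. norm (z - w) \<le> \<rho> i}"
  have "(\<integral>\<^sup>+z. k z \<partial>arc_length) \<le> (\<integral>\<^sup>+z. (\<Sum>i. ennreal (a i) * indicator (?B i) z) \<partial>arc_length)"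
  proof (intro nn_integral_mono)
    fix z assume "z \<in> space arc_length"
    then have z: "z \<in> unit_circle" by simp
    then obtain i where i: "k z \<le> ennreal (a i)" "norm (z - w) \<le> \<rho> i" using le by blast
    then have "k z \<le> ennreal (a i) * indicator (?B i) z" using z by simp
    also have "\<dots> \<le> (\<Sum>i. ennreal (a i) * indicator (?B i) z)"
      by (rule ennreal_le_suminf)
    finally show "k z \<le> (\<Sum>i. ennreal (a i) * indicator (?B i) z)" .
  qed
  also have "\<dots> = (\<Sum>i. \<integral>\<^sup>+z. ennreal (a i) * indicator (?B i) z \<partial>arc_length)"
    by (intro nn_integral_suminf) measurable
  also have "\<dots> = (\<Sum>i. ennreal (a i) * emeasure arc_length (?B i))"
    by (intro suminf_cong nn_integral_cmult_indicator cball_sets_arc_length)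
  also have "\<dots> \<le> (\<Sum>i. ennreal (8 * (a i * \<rho> i)))"
  proof (intro suminf_le)
    fix i
    have "ennreal (a i) * emeasure arc_length (?B i) \<le> ennreal (a i) * ennreal (8 * \<rho> i)"
      by (intro mult_left_mono arc_length_cball w \<rho>) auto
    also have "\<dots> = ennreal (8 * (a i * \<rho> i))"
      using a \<rho> by (simp add: ennreal_mult'[symmetric] mult_ac)
    finally show "ennreal (a i) * emeasure arc_length (?B i) \<le> ennreal (8 * (a i * \<rho> i))" .
  qed auto
  also have "\<dots> = ennreal (8 * S)"
    using sums_mult[OF sums, of 8] a \<rho> by (intro suminf_ennreal_eq) auto
  finally show ?thesis .
qed

lemma dyadic_bracket:
  fixes x D :: real
  assumes "0 < x" "x \<le> D"
  obtains i :: nat where "D / 2 ^ Suc i < x" "x \<le> D / 2 ^ i"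
proof -
  have "\<exists>n. D / x < 2 ^ n" using real_arch_pow[of 2 "D / x"] by auto
  then have ex: "\<exists>n. D / 2 ^ n < x" using assms by (auto simp: field_simps)
  define n where "n = (LEAST n. D / 2 ^ n < x)"
  have n: "D / 2 ^ n < x" unfolding n_def by (rule LeastI_ex[OF ex])
  then have "n \<noteq> 0" using assms by (intro notI) simp
  then obtain i where i: "n = Suc i" by (cases n) auto
  have "\<not> D / 2 ^ i < x" using not_less_Least[of i "\<lambda>n. D / 2 ^ n < x"] i by (simp add: n_def)
  with n i show ?thesis by (intro that[of i]) auto
qed

text \<open>On the shell of radius \<open>2 / 2 ^ i\<close> the integrand is at most
  \<open>(2 ^ i) powr (1 - \<epsilon>)\<close>, so the shells contribute a geometric series of ratio
  \<open>2 powr (-\<epsilon>)\<close>.\<close>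

lemma nn_integral_dist_powr:
  assumes "0 < \<epsilon>" "\<epsilon> < 1"
  obtains C where "C > 0"
    "\<And>w. w \<in> unit_circle \<Longrightarrow> (\<integral>\<^sup>+z. ennreal (norm (z - w) powr (\<epsilon> - 1)) \<partial>arc_length) \<le> ennreal C"
proof -
  define a where "a i = (2 ^ i) powr (1 - \<epsilon>)" for i :: nat
  have eq: "a i * (2 / 2 ^ i) = 2 * (2 powr (-\<epsilon>)) ^ i" for i
  proof -
    have "a i / 2 ^ i = 2 powr (real i * (1 - \<epsilon>)) / 2 powr real i"
      by (simp add: a_def powr_powr flip: powr_realpow)
    also have "\<dots> = 2 powr (real i * (-\<epsilon>))"
      by (simp add: powr_diff[symmetric] algebra_simps)
    also have "\<dots> = (2 powr (-\<epsilon>)) ^ i"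
      by (metis powr_powr powr_realpow mult.commute powr_gt_zero zero_neq_numeral)
    finally have "a i / 2 ^ i = (2 powr (-\<epsilon>)) ^ i" .
    then show ?thesis by (metis mult.commute times_divide_eq_left times_divide_eq_right)
  qed
  have lt: "2 powr (-\<epsilon>) < 1" using powr_less_mono[of "-\<epsilon>" 0 "2::real"] assms by simp
  have "(\<lambda>i. 2 * (2 powr (-\<epsilon>)) ^ i) sums (2 * (1 / (1 - 2 powr (-\<epsilon>))))"
    by (intro sums_mult geometric_sums) (use lt in auto)
  then have S: "(\<lambda>i. a i * (2 / 2 ^ i)) sums (2 / (1 - 2 powr (-\<epsilon>)))"
    unfolding eq by simp
  show ?thesis
  proof (rule that)
    show "8 * (2 / (1 - 2 powr (-\<epsilon>))) > 0" using lt by simp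
    fix w assume w: "w \<in> unit_circle"
    show "(\<integral>\<^sup>+z. ennreal (norm (z - w) powr (\<epsilon> - 1)) \<partial>arc_length) \<le> ennreal (8 * (2 / (1 - 2 powr (-\<epsilon>))))"
    proof (rule nn_integral_dyadic_bound[OF w _ _ _ _ S])
      show "(\<lambda>z. ennreal (norm (z - w) powr (\<epsilon> - 1))) \<in> borel_measurable arc_length"
        by (rule borel_measurable_arc_length) measurable
      fix z assume z: "z \<in> unit_circle"
      show "\<exists>i. ennreal (norm (z - w) powr (\<epsilon> - 1)) \<le> ennreal (a i) \<and> norm (z - w) \<le> 2 / 2 ^ i"
      proof (cases "z = w")
        case True
        \<comment> \<open>At the centre the library value \<open>0 powr (\<epsilon> - 1) = 0\<close>
          makes every index admissible.\<close>
        then show ?thesis by (auto simp: a_def)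
      next
        case False
        have "norm (z - w) \<le> 2" using norm_triangle_ineq4[of z w] z w by simp
        then obtain i where i: "2 / 2 ^ Suc i < norm (z - w)" "norm (z - w) \<le> 2 / 2 ^ i"
          using dyadic_bracket[of "norm (z - w)" 2] False by auto
        have "norm (z - w) powr (\<epsilon> - 1) \<le> (1 / 2 ^ i) powr (\<epsilon> - 1)"
          using i assms by (intro powr_mono2') auto
        also have "\<dots> = a i"
          using powr_minus[of "2 ^ i" "\<epsilon> - 1"] by (simp add: a_def powr_divide inverse_eq_divide)
        finally show ?thesis using i by (auto intro: ennreal_leI)
      qed
    qed (auto simp: a_def)
  qed
qed

text \<open>Up to a factor \<open>D\<close> the integrand is of the size of a Poisson kernel of
  width \<open>D\<close>. The shells grow outward: the radii \<open>2 ^ i * D\<close> double while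
  the values drop by a factor 4.\<close>

lemma nn_integral_truncated_square:
  assumes w: "w \<in> unit_circle" and "0 < D"
  shows "(\<integral>\<^sup>+z. ennreal (1 / (max D (norm (z - w)))\<^sup>2) \<partial>arc_length) \<le> ennreal (64 / D)"
proof -
  have "(\<lambda>i. (4 / D) * (1 / 2) ^ i) sums ((4 / D) * (1 / (1 - 1 / 2)))"
    by (intro sums_mult geometric_sums) auto
  moreover have "4 / (2 ^ i * D)\<^sup>2 * (2 ^ i * D) = (4 / D) * (1 / 2) ^ i" for i
    using assms by (simp add: field_simps power2_eq_square)
  ultimately have S: "(\<lambda>i. 4 / (2 ^ i * D)\<^sup>2 * (2 ^ i * D)) sums (8 / D)"
    by simp
  have "(\<integral>\<^sup>+z. ennreal (1 / (max D (norm (z - w)))\<^sup>2) \<partial>arc_length) \<le> ennreal (8 * (8 / D))"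
  proof (rule nn_integral_dyadic_bound[OF w _ _ _ _ S])
    show "(\<lambda>z. ennreal (1 / (max D (norm (z - w)))\<^sup>2)) \<in> borel_measurable arc_length"
      by (rule borel_measurable_arc_length) measurable
    fix z assume z: "z \<in> unit_circle"
    show "\<exists>i. ennreal (1 / (max D (norm (z - w)))\<^sup>2) \<le> ennreal (4 / (2 ^ i * D)\<^sup>2) \<and> norm (z - w) \<le> 2 ^ i * D"
    proof (cases "norm (z - w) \<le> D")
      case True
      then have "1 / (max D (norm (z - w)))\<^sup>2 \<le> 4 / (2 ^ 0 * D)\<^sup>2"
        using assms by (simp add: max_def divide_right_mono)
      then show ?thesis using True by (intro exI[of _ 0]) (auto intro: ennreal_leI)
    next
      case False
      have "\<exists>n. norm (z - w) / D < 2 ^ n" using real_arch_pow[of 2] by auto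
      then have ex: "\<exists>n. norm (z - w) \<le> 2 ^ n * D" using assms by (auto simp: field_simps intro: less_imp_le)
      define n where "n = (LEAST n. norm (z - w) \<le> 2 ^ n * D)"
      have n: "norm (z - w) \<le> 2 ^ n * D" unfolding n_def by (rule LeastI_ex[OF ex])
      then have "n \<noteq> 0" using False by (intro notI) simp
      then obtain i where i: "n = Suc i" by (cases n) auto
      have "\<not> norm (z - w) \<le> 2 ^ i * D"
        using not_less_Least[of i "\<lambda>n. norm (z - w) \<le> 2 ^ n * D"] i by (simp add: n_def)
      then have "2 ^ n * D / 2 \<le> max D (norm (z - w))" using i False by simp
      then have "(2 ^ n * D / 2)\<^sup>2 \<le> (max D (norm (z - w)))\<^sup>2" using assms by (intro power_mono) auto
      then have "1 / (max D (norm (z - w)))\<^sup>2 \<le> 1 / (2 ^ n * D / 2)\<^sup>2"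
        using assms by (intro divide_left_mono mult_pos_pos) auto
      also have "\<dots> = 4 / (2 ^ n * D)\<^sup>2" by (simp add: power_divide)
      finally show ?thesis using n by (intro exI[of _ n]) (auto intro: ennreal_leI)
    qed
  qed (use assms in auto)
  then show ?thesis by simp
qed

section \<open>Herglotz integrals over neighbourhoods of a closed set\<close>

text \<open>The Schwarz-Herglotz integral of the indicator of \<open>A\<close>, dilated by
  \<open>r\<close> and without the factor \<open>1 / (2 * pi)\<close>: its value at 0 is the arc
  length of \<open>A\<close>, and for \<open>0 \<le> r < 1\<close> the integrand stays regular for
  \<open>z\<close> on the circle.\<close>

definition herglotz :: "complex set \<Rightarrow> real \<Rightarrow> complex \<Rightarrow> complex" where
  "herglotz A r z = (\<integral>\<xi>. indicator A \<xi> *\<^sub>R ((\<xi> + of_real r * z) / (\<xi> - of_real r * z)) \<partial>arc_length)"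

definition circle_nbhd :: "complex set \<Rightarrow> real \<Rightarrow> complex set" where
  "circle_nbhd E h = {\<xi> \<in> unit_circle. infdist \<xi> E \<le> h}"

lemma sets_circle_nbhd [measurable]: "circle_nbhd E h \<in> sets arc_length"
proof -
  have "(\<lambda>x. infdist x E) \<in> borel_measurable borel"
    by (intro borel_measurable_continuous_onI continuous_intros)
  then show ?thesis unfolding circle_nbhd_def by (intro borel_set_arc_length) measurable
qed

lemma norm_circle_minus_ge:
  assumes "\<xi> \<in> unit_circle" "norm z \<le> \<rho>" "0 \<le> r"
  shows "1 - r * \<rho> \<le> norm (\<xi> - of_real r * z)"
proof -
  have "norm (of_real r * z) \<le> r * \<rho>" using assms by (simp add: norm_mult mult_left_mono)
  then show ?thesis using norm_triangle_ineq2[of \<xi> "of_real r * z"] assms by simp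
qed

lemma integrable_indicator_circle:
  fixes F :: "complex \<Rightarrow> complex"
  assumes "A \<in> sets arc_length" "continuous_on unit_circle F"
  shows "integrable arc_length (\<lambda>\<xi>. indicator A \<xi> *\<^sub>R F \<xi>)"
  using integrable_arc_length[OF assms(2)] assms(1) by (rule integrable_mult_indicator[rotated])

lemma continuous_on_herglotz_kernel:
  assumes "0 \<le> r" "r * norm z < 1"
  shows "continuous_on unit_circle (\<lambda>\<xi>. (\<xi> + of_real r * z) / (\<xi> - of_real r * z))"
proof (intro continuous_intros ballI)
  fix \<xi> assume "\<xi> \<in> unit_circle"
  then have "norm (\<xi> - of_real r * z) > 0"
    using norm_circle_minus_ge[of \<xi> z "norm z" r] assms by linarith
  then show "\<xi> - of_real r * z \<noteq> 0" by simp
qed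

lemma herglotz_0:
  assumes "A \<in> sets arc_length"
  shows "herglotz A r 0 = of_real (measure arc_length A)"
proof -
  have "herglotz A r 0 = (\<integral>\<xi>. of_real (indicator A \<xi>) \<partial>arc_length)"
    unfolding herglotz_def
  proof (intro Bochner_Integration.integral_cong refl)
    fix \<xi> assume "\<xi> \<in> space arc_length"
    then have "\<xi> \<noteq> 0" by auto
    then show "indicator A \<xi> *\<^sub>R ((\<xi> + of_real r * 0) / (\<xi> - of_real r * 0)) = of_real (indicator A \<xi>)"
      by (simp add: scaleR_conv_of_real)
  qed
  also have "\<dots> = of_real (measure arc_length A)"
    using sets.sets_into_space[OF assms] by (simp add: Int_absorb2)
  finally show ?thesis .
qed

text \<open>This is the Poisson kernel. Its sign turns the real part of the integral into the
  integral of a non-negative function, to which the shell estimates apply.\<close>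

lemma Re_herglotz_kernel:
  assumes "\<xi> \<in> unit_circle" "z \<in> unit_circle" "0 \<le> r" "r < 1"
  shows "Re ((\<xi> + of_real r * z) / (\<xi> - of_real r * z)) = (1 - r\<^sup>2) / (norm (\<xi> - of_real r * z))\<^sup>2"
proof -
  have 1: "(Re \<xi>)\<^sup>2 + (Im \<xi>)\<^sup>2 = 1" "(Re z)\<^sup>2 + (Im z)\<^sup>2 = 1"
    using assms by (simp_all add: cmod_power2[symmetric])
  have "Re ((\<xi> + of_real r * z) / (\<xi> - of_real r * z))
      = ((Re \<xi>)\<^sup>2 + (Im \<xi>)\<^sup>2 - r\<^sup>2 * ((Re z)\<^sup>2 + (Im z)\<^sup>2)) / (norm (\<xi> - of_real r * z))\<^sup>2"
    unfolding Re_divide cmod_power2 by (simp add: algebra_simps power2_eq_square diff_divide_distrib add_divide_distrib)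
  then show ?thesis by (simp add: 1)
qed

text \<open>Since \<open>|z - r z| = 1 - r\<close> is at most \<open>|\<xi> - r z|\<close>, one has
  \<open>|\<xi> - z| \<le> 2 |\<xi> - r z|\<close>. Hence on \<open>A\<close> the Poisson kernel is
  at most \<open>8 (1 - r)\<close> over the square of \<open>max D |\<xi> - z|\<close>, and
  \<open>512 = 8 * 64\<close>. Up to constants the gain over the total mass of the kernel is
  \<open>(1 - r) / D\<close>.\<close>

lemma Re_herglotz_le:
  assumes A: "A \<in> sets arc_length" and z: "z \<in> unit_circle" and r: "0 \<le> r" "r < 1"
    and D: "0 < D" and far: "\<And>\<xi>. \<xi> \<in> A \<Longrightarrow> \<xi> \<in> unit_circle \<Longrightarrow> D \<le> norm (\<xi> - of_real r * z)"
  shows "Re (herglotz A r z) \<le> 512 * (1 - r) / D"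
proof -
  let ?k = "\<lambda>\<xi>. (\<xi> + of_real r * z) / (\<xi> - of_real r * z)"
  have int: "integrable arc_length (\<lambda>\<xi>. indicator A \<xi> *\<^sub>R ?k \<xi>)"
    by (rule integrable_indicator_circle[OF A]) (use r z in \<open>auto intro!: continuous_on_herglotz_kernel\<close>)
  have "Re (herglotz A r z) = (\<integral>\<xi>. Re (indicator A \<xi> *\<^sub>R ?k \<xi>) \<partial>arc_length)"
    unfolding herglotz_def using int by (rule integral_Re[symmetric])
  moreover have "ennreal (\<integral>\<xi>. Re (indicator A \<xi> *\<^sub>R ?k \<xi>) \<partial>arc_length) \<le> ennreal (512 * (1 - r) / D)"
  proof -
    have nn: "Re (indicator A \<xi> *\<^sub>R ?k \<xi>) \<ge> 0" if "\<xi> \<in> space arc_length" for \<xi>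
    proof -
      have "0 \<le> (1 - r\<^sup>2) / (norm (\<xi> - of_real r * z))\<^sup>2"
        using r by (intro divide_nonneg_nonneg) (auto simp: power_le_one)
      then show ?thesis using Re_herglotz_kernel[of \<xi> z r] that z r by (simp add: indicator_def)
    qed
    have "ennreal (\<integral>\<xi>. Re (indicator A \<xi> *\<^sub>R ?k \<xi>) \<partial>arc_length)
        = (\<integral>\<^sup>+\<xi>. ennreal (Re (indicator A \<xi> *\<^sub>R ?k \<xi>)) \<partial>arc_length)"
      using int nn by (intro nn_integral_eq_integral[symmetric] integrable_Re) (auto intro!: AE_I2)
    also have "\<dots> \<le> (\<integral>\<^sup>+\<xi>. ennreal (8 * (1 - r)) * ennreal (1 / (max D (norm (\<xi> - z)))\<^sup>2) \<partial>arc_length)"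
    proof (intro nn_integral_mono)
      fix \<xi> assume "\<xi> \<in> space arc_length"
      then have \<xi>: "\<xi> \<in> unit_circle" by simp
      show "ennreal (Re (indicator A \<xi> *\<^sub>R ?k \<xi>)) \<le> ennreal (8 * (1 - r)) * ennreal (1 / (max D (norm (\<xi> - z)))\<^sup>2)"
      proof (cases "\<xi> \<in> A")
        case True
        let ?n = "norm (\<xi> - of_real r * z)"
        have "norm (z - of_real r * z) = 1 - r"
        proof -
          have "z - of_real r * z = of_real (1 - r) * z" by (simp add: algebra_simps)
          then show ?thesis using z r by (simp only: norm_mult norm_of_real) simp
        qed
        moreover have "1 - r \<le> ?n" using norm_circle_minus_ge[of \<xi> z 1 r] z r \<xi> by simp
        ultimately have "norm (\<xi> - z) \<le> 2 * ?n"
          using norm_triangle_ineq4[of "\<xi> - of_real r * z" "z - of_real r * z"] by simp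
        then have "max D (norm (\<xi> - z)) / 2 \<le> ?n" using far[OF True \<xi>] D by simp
        then have "(max D (norm (\<xi> - z)) / 2)\<^sup>2 \<le> ?n\<^sup>2" using D by (intro power_mono) auto
        moreover have "1 - r\<^sup>2 \<le> 2 * (1 - r)"
          using zero_le_power2[of "1 - r"] by (simp add: power2_eq_square algebra_simps)
        ultimately have "(1 - r\<^sup>2) / ?n\<^sup>2 \<le> 2 * (1 - r) / (max D (norm (\<xi> - z)) / 2)\<^sup>2"
          using D r by (intro frac_le) (auto simp: max_def)
        also have "\<dots> = 8 * (1 - r) * (1 / (max D (norm (\<xi> - z)))\<^sup>2)" by (simp add: power_divide)
        finally have "Re (?k \<xi>) \<le> 8 * (1 - r) * (1 / (max D (norm (\<xi> - z)))\<^sup>2)"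
          using Re_herglotz_kernel[of \<xi> z r] \<xi> z r by simp
        then show ?thesis using True r by (subst ennreal_mult''[symmetric]) (simp_all add: ennreal_leI)
      qed simp
    qed
    also have "\<dots> = ennreal (8 * (1 - r)) * (\<integral>\<^sup>+\<xi>. ennreal (1 / (max D (norm (\<xi> - z)))\<^sup>2) \<partial>arc_length)"
      by (rule nn_integral_cmult, rule borel_measurable_arc_length) measurable
    also have "\<dots> \<le> ennreal (8 * (1 - r)) * ennreal (64 / D)"
      by (intro mult_left_mono nn_integral_truncated_square z D) auto
    also have "\<dots> = ennreal (512 * (1 - r) / D)"
      using r D by (subst ennreal_mult'[symmetric]) auto
    finally show ?thesis .
  qed
  ultimately show ?thesis using r D by (simp add: ennreal_le_iff)
qed

text \<open>The dilation \<open>1 - h\<close> is matched to the width \<open>h\<close> of the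
  neighbourhood. With \<open>n\<close> for the distance from \<xi> to \<open>(1 - h) z\<close>, the
  third bound is \<open>d(z, E) \<le> d(\<xi>, E) + |\<xi> - z| \<le> h + (n + h)\<close> together
  with \<open>h \<le> n\<close>.\<close>

lemma infdist_le_kernel:
  assumes \<xi>: "\<xi> \<in> circle_nbhd E h" and z: "z \<in> unit_circle" and h: "0 < h" "h \<le> 1"
  shows "h \<le> norm (\<xi> - of_real (1 - h) * z)" "norm (\<xi> - z) \<le> 2 * norm (\<xi> - of_real (1 - h) * z)"
    "infdist z E \<le> 3 * norm (\<xi> - of_real (1 - h) * z)"
proof -
  let ?n = "norm (\<xi> - of_real (1 - h) * z)"
  show 1: "h \<le> ?n" using norm_circle_minus_ge[of \<xi> z 1 "1 - h"] assms by (simp add: circle_nbhd_def)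
  have "norm (z - of_real (1 - h) * z) = h"
  proof -
    have "z - of_real (1 - h) * z = of_real h * z" by (simp add: algebra_simps)
    then show ?thesis using z h by (simp only: norm_mult norm_of_real) simp
  qed
  then show 2: "norm (\<xi> - z) \<le> 2 * ?n"
    using norm_triangle_ineq4[of "\<xi> - of_real (1 - h) * z" "z - of_real (1 - h) * z"] 1 by simp
  have "norm (\<xi> - z) \<le> ?n + h"
    using norm_triangle_ineq4[of "\<xi> - of_real (1 - h) * z" "z - of_real (1 - h) * z"] 
      \<open>norm (z - of_real (1 - h) * z) = h\<close> by simp
  moreover have "infdist z E \<le> infdist \<xi> E + norm (\<xi> - z)"
    using infdist_triangle[of z E \<xi>] by (simp add: dist_norm norm_minus_commute)
  ultimately show "infdist z E \<le> 3 * ?n" using \<xi> 1 by (simp add: circle_nbhd_def)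
qed

text \<open>On the circle the real part is at most a multiple of \<open>ln (1 / d(z, E))\<close> plus a constant: each
  dyadic scale above \<open>d(z, E)\<close> contributes a bounded amount, and the smaller scales a geometric series. The pole for \<open>\<xi>\<close> at scale \<open>h = 1 / 2 ^ j\<close> is at \<open>\<xi> / (1 - h)\<close>, so that
  \<open>d(z, E) \<le> 3 |\<xi> - (1 - h) z|\<close>, and no singular integral occurs.\<close>

definition herglotz_sum :: "complex set \<Rightarrow> nat \<Rightarrow> complex \<Rightarrow> complex" where
  "herglotz_sum E J z = (\<Sum>j<J. herglotz (circle_nbhd E (1 / 2 ^ j)) (1 - 1 / 2 ^ j) z)"

text \<open>A layer-cake form of the integral of the binary logarithm of \<open>1 / d(z, E)\<close>,
  up to bounded terms and stopped at the scale \<open>1 / 2 ^ J\<close>: a point at distance about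
  \<open>1 / 2 ^ i\<close> is counted about \<open>min i J\<close> times.\<close>

definition nbhd_mass :: "complex set \<Rightarrow> nat \<Rightarrow> real" where
  "nbhd_mass E J = (\<Sum>j<J. measure arc_length (circle_nbhd E (1 / 2 ^ j)))"

lemma herglotz_sum_0: "herglotz_sum E J 0 = of_real (nbhd_mass E J)"
  by (simp add: herglotz_sum_def nbhd_mass_def herglotz_0)

lemma nbhd_mass_nonneg: "0 \<le> nbhd_mass E J"
  by (simp add: nbhd_mass_def sum_nonneg)

text \<open>With \<open>d\<close> of size \<open>1 / 2 ^ i\<close>, the scales \<open>j < i\<close>
  contribute at most 1 each and the later ones a geometric series bounded by 2.\<close>

lemma sum_min_dyadic_le:
  fixes d :: real
  assumes "0 < d" "d \<le> 2"
  shows "(\<Sum>j<J. min 1 (1 / 2 ^ j / d)) \<le> ln (1 / d) / ln 2 + 4"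
proof -
  obtain i where i: "2 / 2 ^ Suc i < d" "d \<le> 2 / 2 ^ i" using dyadic_bracket assms by metis
  \<comment> \<open>Lengthening the sum to \<open>i + J\<close> terms allows the split at
    \<open>i\<close> whatever the order of \<open>i\<close> and \<open>J\<close>.\<close>
  have "(\<Sum>j<J. min 1 (1 / 2 ^ j / d)) \<le> (\<Sum>j<i + J. min 1 (1 / 2 ^ j / d))"
    using assms by (intro sum_mono2) auto
  also have "\<dots> = (\<Sum>j<i. min 1 (1 / 2 ^ j / d)) + (\<Sum>j<J. min 1 (1 / 2 ^ (i + j) / d))"
    by (induction J) (simp_all add: add.assoc)
  also have "\<dots> \<le> (\<Sum>j<i. 1) + (\<Sum>j<J. (1 / 2) ^ j)"
  proof (intro add_mono sum_mono)
    fix j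
    have "1 / 2 ^ (i + j) / d \<le> 1 / 2 ^ (i + j) / (1 / 2 ^ i)"
      using i assms by (intro divide_left_mono) auto
    also have "\<dots> = (1 / 2) ^ j" by (simp add: power_add power_divide)
    finally show "min 1 (1 / 2 ^ (i + j) / d) \<le> (1 / 2) ^ j" by simp
  qed auto
  also have "\<dots> \<le> real i + 2"
  proof -
    have "(\<Sum>j<J. (1 / 2) ^ j) \<le> (\<Sum>j. (1 / 2 :: real) ^ j)"
      by (intro sum_le_suminf summable_geometric) auto
    also have "\<dots> = 2" by (subst suminf_geometric) auto
    finally show ?thesis by simp
  qed
  also have "real i \<le> ln (1 / d) / ln 2 + 1"
  proof -
    have "ln (2 ^ i) \<le> ln (2 / d)" using i assms by (simp add: field_simps)
    also have "\<dots> = ln 2 + ln (1 / d)" using assms by (simp add: ln_div)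
    finally show ?thesis by (simp add: ln_realpow field_simps)
  qed
  finally show ?thesis by simp
qed

lemma Re_herglotz_sum_le:
  assumes z: "z \<in> unit_circle" and d: "0 < infdist z E" "infdist z E \<le> 2"
  shows "Re (herglotz_sum E J z) \<le> 2048 / ln 2 * ln (1 / infdist z E) + 8192"
proof -
  let ?d = "infdist z E"
  have "Re (herglotz_sum E J z) = (\<Sum>j<J. Re (herglotz (circle_nbhd E (1 / 2 ^ j)) (1 - 1 / 2 ^ j) z))"
    by (simp add: herglotz_sum_def)
  also have "\<dots> \<le> (\<Sum>j<J. 2048 * min 1 (1 / 2 ^ j / ?d))"
  proof (intro sum_mono)
    fix j
    \<comment> \<open>Both \<open>h\<close> and \<open>d / 3\<close> bound
      \<open>|\<xi> - (1 - h) z|\<close> from below; \<open>d / 4\<close> is used. This gives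
      \<open>512 * 4 = 2048\<close>, and the 4 of the dyadic sum then gives 8192.\<close>
    let ?h = "1 / 2 ^ j :: real" let ?D = "max ?h (?d / 4)"
    have h: "0 < ?h" "?h \<le> 1" by auto
    have "Re (herglotz (circle_nbhd E ?h) (1 - ?h) z) \<le> 512 * (1 - (1 - ?h)) / ?D"
    proof (rule Re_herglotz_le)
      fix \<xi> assume "\<xi> \<in> circle_nbhd E ?h"
      note k = infdist_le_kernel[OF this z h]
      have "?d / 4 \<le> norm (\<xi> - of_real (1 - ?h) * z)"
        using k(3) norm_ge_zero[of "\<xi> - of_real (1 - ?h) * z"] by linarith
      then show "?D \<le> norm (\<xi> - of_real (1 - ?h) * z)"
        using k(1) by (intro max.boundedI)
    qed (use z h d in \<open>auto simp: less_max_iff_disj\<close>)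
    also have "\<dots> = 512 * (?h / ?D)" by simp
    also have "?h / ?D \<le> min 1 (4 * (?h / ?d))"
    proof -
      have "?h / ?D \<le> ?h / (?d / 4)" using d h by (intro divide_left_mono) auto
      moreover have "?h / ?D \<le> 1" 
      proof -
        have "0 < ?D" using h(1) by (rule less_le_trans) (rule max.cobounded1)
        then show ?thesis by (subst divide_le_eq_1_pos) auto
      qed
      ultimately show ?thesis by simp
    qed
    also have "\<dots> \<le> 4 * min 1 (?h / ?d)" by auto
    finally show "Re (herglotz (circle_nbhd E ?h) (1 - ?h) z) \<le> 2048 * min 1 (1 / 2 ^ j / ?d)" by simp
  qed
  also have "\<dots> \<le> 2048 * (ln (1 / ?d) / ln 2 + 4)"
    unfolding sum_distrib_left[symmetric] using sum_min_dyadic_le[OF d, of J] by simp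
  finally show ?thesis by simp
qed

text \<open>The difference of two kernels is \<open>2 \<xi> r (z' - z)\<close> over the product of
  the denominators. The bound stays an \<open>ennreal\<close> integral, so that it can be weighted
  and integrated by Tonelli later.\<close>

lemma norm_herglotz_diff_le:
  assumes A: "A \<in> sets arc_length" and z: "z \<in> unit_circle" "z' \<in> unit_circle" and r: "0 \<le> r" "r < 1"
  shows "ennreal (norm (herglotz A r z' - herglotz A r z))
    \<le> (\<integral>\<^sup>+\<xi>. ennreal (2 * norm (z' - z) / (norm (\<xi> - of_real r * z') * norm (\<xi> - of_real r * z))) * indicator A \<xi> \<partial>arc_length)"
proof -
  let ?k = "\<lambda>z \<xi>. (\<xi> + of_real r * z) / (\<xi> - of_real r * z)"
  have int: "integrable arc_length (\<lambda>\<xi>. indicator A \<xi> *\<^sub>R ?k z \<xi>)" if "z \<in> unit_circle" for z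
    by (rule integrable_indicator_circle[OF A]) (use r that in \<open>auto intro!: continuous_on_herglotz_kernel\<close>)
  have "herglotz A r z' - herglotz A r z = (\<integral>\<xi>. indicator A \<xi> *\<^sub>R ?k z' \<xi> - indicator A \<xi> *\<^sub>R ?k z \<xi> \<partial>arc_length)"
    unfolding herglotz_def using int z by (intro Bochner_Integration.integral_diff[symmetric]) auto
  then have "ennreal (norm (herglotz A r z' - herglotz A r z))
      \<le> (\<integral>\<^sup>+\<xi>. ennreal (norm (indicator A \<xi> *\<^sub>R ?k z' \<xi> - indicator A \<xi> *\<^sub>R ?k z \<xi>)) \<partial>arc_length)"
    using int z by (simp only:) (intro integral_norm_bound_ennreal Bochner_Integration.integrable_diff; blast)
  also have "\<dots> \<le> (\<integral>\<^sup>+\<xi>. ennreal (2 * norm (z' - z) / (norm (\<xi> - of_real r * z') * norm (\<xi> - of_real r * z))) * indicator A \<xi> \<partial>arc_length)"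
  proof (intro nn_integral_mono)
    fix \<xi> assume "\<xi> \<in> space arc_length"
    then have \<xi>: "\<xi> \<in> unit_circle" by simp
    have nz: "\<xi> - of_real r * w \<noteq> 0" if "w \<in> unit_circle" for w
      using norm_circle_minus_ge[of \<xi> w 1 r] \<xi> that r by auto
    have "?k z' \<xi> - ?k z \<xi> = 2 * \<xi> * of_real r * (z' - z) / ((\<xi> - of_real r * z') * (\<xi> - of_real r * z))"
      using nz[OF z(1)] nz[OF z(2)] by (simp add: divide_simps) (simp add: algebra_simps)
    then have "norm (?k z' \<xi> - ?k z \<xi>) = 2 * r * norm (z' - z) / (norm (\<xi> - of_real r * z') * norm (\<xi> - of_real r * z))"
      using \<xi> r by (simp add: norm_mult norm_divide)
    also have "\<dots> \<le> 2 * norm (z' - z) / (norm (\<xi> - of_real r * z') * norm (\<xi> - of_real r * z))"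
      using r by (intro divide_right_mono) (auto intro: mult_left_le_one_le)
    finally show "ennreal (norm (indicator A \<xi> *\<^sub>R ?k z' \<xi> - indicator A \<xi> *\<^sub>R ?k z \<xi>))
      \<le> ennreal (2 * norm (z' - z) / (norm (\<xi> - of_real r * z') * norm (\<xi> - of_real r * z))) * indicator A \<xi>"
      by (simp add: indicator_def ennreal_leI)
  qed
  finally show ?thesis .
qed

section \<open>Holomorphy beyond the closed disc and Taylor approximation\<close>

lemma sums_herglotz_kernel:
  fixes x :: complex
  assumes "norm x < 1"
  shows "(\<lambda>n. (if n = 0 then 1 else 2) * x ^ n) sums ((1 + x) / (1 - x))"
proof -
  have "(\<lambda>n. 2 * x ^ n - (if n = 0 then 1 else 0)) sums (2 * (1 / (1 - x)) - 1)"
    using assms sums_single[of 0 "\<lambda>_. 1 :: complex"] by (intro sums_diff sums_mult geometric_sums) simp_all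
  moreover have "2 * (1 / (1 - x)) - 1 = (1 + x) / (1 - x)"
  proof -
    have "1 - x \<noteq> 0" using assms by auto
    then show ?thesis by (simp add: divide_simps)
  qed
  moreover have "(\<lambda>n. 2 * x ^ n - (if n = 0 then 1 else 0)) = (\<lambda>n. (if n = 0 then 1 else 2) * x ^ n)"
    by (auto simp: fun_eq_iff)
  ultimately show ?thesis by simp
qed

text \<open>The kernel is expanded in powers of \<open>r w / \<xi>\<close> and integrated term by
  term, which exhibits a power series; \<open>r |w| < 1\<close> on the ball provides the geometric
  majorant \<open>2 * \<theta> ^ n\<close>.\<close>

lemma holomorphic_herglotz:
  assumes A: "A \<in> sets arc_length" and r: "0 \<le> r" "r * R \<le> 1" "0 < R"
  shows "herglotz A r holomorphic_on ball 0 R"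
proof -
  define e where "e n = (if n = 0 then 1 else 2 :: real)" for n :: nat
  define b where "b n = (\<integral>\<xi>. indicator A \<xi> *\<^sub>R (1 / \<xi>) ^ n \<partial>arc_length) * of_real (e n * r ^ n)" for n
  have "(\<lambda>n. b n * (w - 0) ^ n) sums herglotz A r w" if w: "w \<in> ball 0 R" for w
  proof -
    let ?f = "\<lambda>n \<xi>. indicator A \<xi> *\<^sub>R (of_real (e n) * (of_real r * w / \<xi>) ^ n)"
    define \<theta> where "\<theta> = r * norm w"
    have \<theta>: "0 \<le> \<theta>" "\<theta> < 1"
    proof -
      show "0 \<le> \<theta>" using r by (simp add: \<theta>_def)
      have "r * norm w < 1" if "r \<noteq> 0"
      proof -
        have "r * norm w < r * R" using that r w by (intro mult_strict_left_mono) auto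
        with r show ?thesis by simp
      qed
      then show "\<theta> < 1" by (cases "r = 0") (auto simp: \<theta>_def)
    qed
    have int: "integrable arc_length (?f n)" for n
      by (rule integrable_indicator_circle[OF A]) (auto intro!: continuous_intros)
    have norm_f: "norm (?f n \<xi>) \<le> 2 * \<theta> ^ n" if "\<xi> \<in> unit_circle" for n \<xi>
    proof -
      have "norm (of_real (e n) * (of_real r * w / \<xi>) ^ n) \<le> 2 * \<theta> ^ n"
        using that r by (simp add: norm_mult norm_power norm_divide \<theta>_def e_def)
      then show ?thesis using \<theta> by (simp add: indicator_def)
    qed
    have summ: "summable (\<lambda>n. 2 * \<theta> ^ n)" using \<theta> by (intro summable_mult summable_geometric) auto
    have "(\<lambda>n. integral\<^sup>L arc_length (?f n)) sums (\<integral>\<xi>. (\<Sum>n. ?f n \<xi>) \<partial>arc_length)"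
    proof (rule sums_integral[OF int])
      show "AE \<xi> in arc_length. summable (\<lambda>n. norm (?f n \<xi>))"
        by (intro AE_I2 summable_comparison_test'[OF summ]) (use norm_f in auto)
      show "summable (\<lambda>n. \<integral>\<xi>. norm (?f n \<xi>) \<partial>arc_length)"
      proof (rule summable_comparison_test'[of "\<lambda>n. 2 * pi * (2 * \<theta> ^ n)"])
        fix n
        have "(\<integral>\<xi>. norm (?f n \<xi>) \<partial>arc_length) \<le> (\<integral>\<xi>. 2 * \<theta> ^ n \<partial>arc_length)"
          using int norm_f by (intro integral_mono integrable_norm) auto
        also have "\<dots> = 2 * pi * (2 * \<theta> ^ n)"
          by (simp add: measure_def emeasure_arc_length_circle)
        finally show "norm (\<integral>\<xi>. norm (?f n \<xi>) \<partial>arc_length) \<le> 2 * pi * (2 * \<theta> ^ n)" by simp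
      qed (use summable_mult[OF summ] in auto)
    qed
    moreover have "(\<integral>\<xi>. (\<Sum>n. ?f n \<xi>) \<partial>arc_length) = herglotz A r w"
      unfolding herglotz_def
    proof (intro Bochner_Integration.integral_cong refl)
      fix \<xi> assume "\<xi> \<in> space arc_length"
      then have \<xi>: "\<xi> \<in> unit_circle" "\<xi> \<noteq> 0" by auto
      have "norm (of_real r * w / \<xi>) < 1" using \<xi> \<theta> r by (simp add: norm_mult norm_divide \<theta>_def)
      from sums_herglotz_kernel[OF this]
      have "(\<lambda>n. of_real (e n) * (of_real r * w / \<xi>) ^ n) sums ((1 + of_real r * w / \<xi>) / (1 - of_real r * w / \<xi>))"
        by (rule sums_cong[THEN iffD1, rotated]) (auto simp: e_def)
      also have "(1 + of_real r * w / \<xi>) / (1 - of_real r * w / \<xi>) = (\<xi> + of_real r * w) / (\<xi> - of_real r * w)"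
        using \<xi> by (simp add: divide_simps)
      finally show "(\<Sum>n. ?f n \<xi>) = indicator A \<xi> *\<^sub>R ((\<xi> + of_real r * w) / (\<xi> - of_real r * w))"
        by (cases "\<xi> \<in> A") (auto simp: sums_iff)
    qed
    moreover have "integral\<^sup>L arc_length (?f n) = b n * (w - 0) ^ n" for n
    proof -
      have "?f n = (\<lambda>\<xi>. (indicator A \<xi> *\<^sub>R (1 / \<xi>) ^ n) * (of_real (e n * r ^ n) * w ^ n))"
        by (simp add: fun_eq_iff power_divide power_mult_distrib scaleR_conv_of_real field_simps)
      then show ?thesis by (simp only: integral_mult_left_zero b_def mult.assoc diff_zero)
    qed
    ultimately show ?thesis by simp
  qed
  then show ?thesis by (rule power_series_holomorphic)
qed

lemma holomorphic_herglotz_sum: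
  obtains R where "1 < R" "herglotz_sum E J holomorphic_on ball 0 R"
proof -
  \<comment> \<open>All dilations with \<open>j < J\<close> are at most \<open>1 / R\<close>. The
    exponent \<open>Suc J\<close> in place of \<open>J\<close> keeps the denominator positive for
    \<open>J = 0\<close>.\<close>
  define R where "R = 1 / (1 - 1 / 2 ^ Suc J :: real)"
  have pos: "(1 / 2 ^ Suc J :: real) < 1" 
    using one_less_power[of "2 :: real" "Suc J"] by (subst divide_less_eq_1_pos) auto
  have R: "1 < R" using pos by (simp add: R_def)
  have "herglotz (circle_nbhd E (1 / 2 ^ j)) (1 - 1 / 2 ^ j) holomorphic_on ball 0 R" if "j < J" for j
  proof (rule holomorphic_herglotz)
    have "(1 / 2 ^ Suc J :: real) \<le> 1 / 2 ^ j"
      using that by (intro divide_left_mono power_increasing) auto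
    then show "(1 - 1 / 2 ^ j) * R \<le> 1" using pos by (simp add: R_def)
  qed (use R in auto)
  then have "herglotz_sum E J holomorphic_on ball 0 R"
    unfolding herglotz_sum_def by (intro holomorphic_intros) auto
  with R that show ?thesis by blast
qed

text \<open>As \<open>R > 1\<close>, the series of \<open>n |a n|\<close> converges, and its tail
  bounds the Taylor remainder on the circle both in the sup norm and in its Lipschitz constant.
  Lipschitz closeness is what survives multiplication by a Hoelder function.\<close>

lemma holomorphic_approx_polynomial:
  assumes g: "g holomorphic_on ball 0 R" and R: "1 < R" and \<epsilon>: "0 < \<epsilon>"
  obtains P :: "complex poly" where "poly P 0 = g 0"
    "\<And>z. z \<in> unit_circle \<Longrightarrow> norm (g z - poly P z) \<le> \<epsilon>"
    "\<And>z w. z \<in> unit_circle \<Longrightarrow> w \<in> unit_circle \<Longrightarrow>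
       norm ((g z - poly P z) - (g w - poly P w)) \<le> \<epsilon> * norm (z - w)"
proof -
  define a where "a n = (deriv ^^ n) g 0 / fact n" for n
  have sums: "(\<lambda>n. a n * z ^ n) sums g z" if "norm z < R" for z
    using holomorphic_power_series[OF g, of z] that by (simp add: a_def)
  have "summable (\<lambda>n. norm (a n) * x ^ n)" if x: "norm x < R" for x :: real
  proof -
    obtain y where y: "norm x < y" "y < R" using dense[OF x] by auto
    have "summable (\<lambda>n. a n * (of_real y) ^ n)"
      using sums[of "of_real y"] y x by (auto simp: sums_iff)
    then have "summable (\<lambda>n. norm (a n * (of_real x) ^ n))"
      by (rule powser_insidea) (use y in auto)
    then have "summable (\<lambda>n. norm (norm (a n) * x ^ n))" by (simp add: norm_mult norm_power abs_mult power_abs)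
    then show ?thesis by (rule summable_norm_cancel)
  qed
  then have "summable (\<lambda>n. diffs (\<lambda>n. norm (a n)) n * 1 ^ n)"
    using R by (intro termdiff_converges[of 1 R]) auto
  then have "summable (\<lambda>n. real (Suc n) * norm (a (Suc n)))" by (simp add: diffs_def)
  then have summ: "summable (\<lambda>n. real n * norm (a n))" by (subst summable_Suc_iff[symmetric])
  obtain M where M: "\<And>n. n \<ge> M \<Longrightarrow> norm (\<Sum>i. real (i + n) * norm (a (i + n))) < \<epsilon>"
    using suminf_exist_split[OF \<epsilon> summ] by blast
  \<comment> \<open>\<open>N \<ge> 1\<close> keeps the constant term in the polynomial, so that the
    value at 0 is unchanged, and makes \<open>n |a n|\<close> dominate \<open>|a n|\<close> in the
    tail.\<close>
  define N where "N = max 1 M"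
  have N: "norm (\<Sum>i. real (i + N) * norm (a (i + N))) < \<epsilon>" "N \<ge> 1"
    by (rule M, simp_all add: N_def)
  have summN: "summable (\<lambda>i. real (i + N) * norm (a (i + N)))" using summable_ignore_initial_segment[OF summ] .
  have tail: "(\<lambda>i. a (i + N) * z ^ (i + N)) sums (g z - (\<Sum>n<N. a n * z ^ n))" if "norm z < R" for z
    using sums_split_initial_segment[OF sums[OF that]] .
  define P where "P = (\<Sum>n<N. monom (a n) n)"
  have P: "poly P z = (\<Sum>n<N. a n * z ^ n)" for z by (simp add: P_def poly_sum poly_monom)
  show ?thesis
  proof (rule that[of P])
    have "poly P 0 = (\<Sum>n<N. if n = 0 then a 0 else 0)" unfolding P by (intro sum.cong) auto
    also have "\<dots> = a 0" using N by (subst sum.delta) auto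
    finally show "poly P 0 = g 0" by (simp add: a_def)
  next
    fix z :: complex assume z: "z \<in> unit_circle"
    have "norm (\<Sum>i. a (i + N) * z ^ (i + N)) \<le> (\<Sum>i. real (i + N) * norm (a (i + N)))"
    proof (rule norm_suminf_le[OF _ summN])
      fix n
      have "1 * norm (a (n + N)) \<le> real (n + N) * norm (a (n + N))"
        using N(2) by (intro mult_right_mono) auto
      then show "norm (a (n + N) * z ^ (n + N)) \<le> real (n + N) * norm (a (n + N))"
        using z by (simp add: norm_mult norm_power)
    qed
    then show "norm (g z - poly P z) \<le> \<epsilon>" using N(1) tail[of z] z R unfolding P by (simp add: sums_iff)
  next
    fix z w :: complex assume zw: "z \<in> unit_circle" "w \<in> unit_circle"
    have "(\<lambda>i. a (i + N) * z ^ (i + N) - a (i + N) * w ^ (i + N)) sums ((g z - poly P z) - (g w - poly P w))"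
      unfolding P by (intro sums_diff tail) (use zw R in auto)
    moreover have "norm (\<Sum>i. a (i + N) * z ^ (i + N) - a (i + N) * w ^ (i + N))
        \<le> (\<Sum>i. real (i + N) * norm (a (i + N)) * norm (z - w))"
    proof (rule norm_suminf_le)
      fix n
      have "norm (z ^ (n + N) - w ^ (n + N)) \<le> real (n + N) * norm (z - w)"
        using zw by (intro norm_power_diff) auto
      then have "norm (a (n + N)) * norm (z ^ (n + N) - w ^ (n + N)) \<le> norm (a (n + N)) * (real (n + N) * norm (z - w))"
        by (intro mult_left_mono) auto
      then show "norm (a (n + N) * z ^ (n + N) - a (n + N) * w ^ (n + N)) \<le> real (n + N) * norm (a (n + N)) * norm (z - w)"
        by (simp add: right_diff_distrib[symmetric] norm_mult mult_ac)
    qed (rule summable_mult2[OF summN])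
    ultimately have "norm ((g z - poly P z) - (g w - poly P w)) \<le> (\<Sum>i. real (i + N) * norm (a (i + N))) * norm (z - w)"
      using suminf_mult2[OF summN, of "norm (z - w)"] by (simp add: sums_iff)
    also have "\<dots> \<le> \<epsilon> * norm (z - w)" using N(1) by (intro mult_right_mono) auto
    finally show "norm ((g z - poly P z) - (g w - poly P w)) \<le> \<epsilon> * norm (z - w)" .
  qed
qed

section \<open>Moduli of continuity in the mean\<close>

text \<open>Product of two bounds for the same difference: the mean value bound on a half-plane and
  the trivial bound \<open>2 e\<close>. The first power of \<open>|a - b|\<close> is kept because
  the increments of \<open>herglotz_sum\<close> are controlled in the mean of order one
  only.\<close>

lemma norm_exp_diff_sq_le:
  fixes a b :: complex
  assumes "exp (Re a) \<le> e" "exp (Re b) \<le> e"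
  shows "(norm (exp a - exp b))\<^sup>2 \<le> 2 * e\<^sup>2 * norm (a - b)"
proof -
  define m where "m = ln e"
  have e: "e > 0" using assms(1) exp_gt_zero[of "Re a"] by linarith
  have m: "exp m = e" using e by (simp add: m_def)
  have "Re a \<le> m" "Re b \<le> m" using assms m by (metis exp_le_cancel_iff)+
  then have "norm (exp a - exp b) \<le> e * norm (a - b)"
  proof (intro field_differentiable_bound[of "{z. Re z \<le> m}" exp exp e a b])
    show "convex {z. Re z \<le> m}" by (rule convex_halfspace_Re_le)
    show "\<And>z. z \<in> {z. Re z \<le> m} \<Longrightarrow> norm (exp z) \<le> e" using m by auto
  qed (auto intro!: derivative_eq_intros)
  moreover have "norm (exp a - exp b) \<le> 2 * e"
    using norm_triangle_ineq4[of "exp a" "exp b"] assms by simp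
  ultimately have "norm (exp a - exp b) * norm (exp a - exp b) \<le> (2 * e) * (e * norm (a - b))"
    using e by (intro mult_mono) auto
  then show ?thesis by (simp add: power2_eq_square mult_ac)
qed

lemma norm_sum_sq_le: "(norm (x + y))\<^sup>2 \<le> 2 * (norm x)\<^sup>2 + 2 * (norm y)\<^sup>2"
  for x y :: "'a::real_normed_vector"
proof -
  have "(norm (x + y))\<^sup>2 \<le> (norm x + norm y)\<^sup>2" by (intro power_mono norm_triangle_ineq) auto
  also have "\<dots> \<le> 2 * (norm x)\<^sup>2 + 2 * (norm y)\<^sup>2"
    using zero_le_power2[of "norm x - norm y"] by (simp add: power2_sum power2_diff)
  finally show ?thesis .
qed

lemma norm_mult_cis_diff_le:
  assumes "z \<in> unit_circle" "0 \<le> t"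
  shows "norm (z * cis t - z) \<le> t"
proof -
  have "norm (z * cis t - z) = norm (cis t - 1)"
    using assms by (metis mem_sphere_0 mult.right_neutral mult_1 norm_mult right_diff_distrib)
  also have "\<dots> = 2 * \<bar>sin (t / 2)\<bar>"
    using dist_exp_i_1[of t] by (simp add: cis_conv_exp)
  also have "\<dots> \<le> t" using abs_sin_x_le_abs_x[of "t / 2"] assms by simp
  finally show ?thesis .
qed

abbreviation energy :: "(complex \<Rightarrow> complex) \<Rightarrow> ennreal" where
  "energy F \<equiv> \<integral>\<^sup>+z. ennreal ((norm (F z))\<^sup>2) \<partial>arc_length"

text \<open>\<open>K\<close> bounds the square of a norm; Fourier coefficients at frequencies \<open>2\<^sup>i \<le> |n| < 2\<^sup>i\<^sup>+\<^sup>1\<close> are read off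
  at \<open>t = \<pi> / 2\<^sup>i\<^sup>+\<^sup>1\<close>, where \<open>|e\<^sup>i\<^sup>n\<^sup>t - 1|\<close> is bounded below.\<close>

definition besov_le :: "real \<Rightarrow> real \<Rightarrow> (complex \<Rightarrow> complex) \<Rightarrow> bool" where
  "besov_le s K F \<longleftrightarrow> 0 \<le> K \<and> continuous_on unit_circle F \<and>
     energy F \<le> ennreal K \<and>
     (\<forall>t. 0 < t \<longrightarrow> t \<le> 2 \<longrightarrow>
       energy (\<lambda>z. F (z * cis t) - F z) \<le> ennreal (K * t powr (2 * s)))"

lemma continuous_on_rotate:
  assumes "continuous_on unit_circle F"
  shows "continuous_on unit_circle (\<lambda>z. F (z * cis t))"
  by (rule continuous_on_compose2[OF assms]) (auto intro!: continuous_intros simp: norm_mult)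

lemma ident_borel_measurable_arc_length: "(\<lambda>x. x) \<in> borel_measurable arc_length"
  by (rule borel_measurable_arc_length) simp

text \<open>The constants bound squares, hence the factors 2. For the same reason a target
  \<epsilon> is later split into two pieces of size \<open>\<epsilon> / 4\<close>.\<close>

lemma besov_le_add:
  assumes "besov_le s K1 F" "besov_le s K2 G"
  shows "besov_le s (2 * K1 + 2 * K2) (\<lambda>z. F z + G z)"
proof -
  have K: "0 \<le> K1" "0 \<le> K2" using assms by (auto simp: besov_le_def)
  have cF: "continuous_on unit_circle F" and cG: "continuous_on unit_circle G"
    using assms by (auto simp: besov_le_def)
  have gen: "energy (\<lambda>z. a z + b z) \<le> ennreal (2 * A + 2 * B)"
    if "continuous_on unit_circle a" "continuous_on unit_circle b" "0 \<le> A" "0 \<le> B"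
      "energy a \<le> ennreal A"
      "energy b \<le> ennreal B" for a b :: "complex \<Rightarrow> complex" and A B
  proof -
    have [measurable]: "a \<in> borel_measurable arc_length" "b \<in> borel_measurable arc_length"
      using that by (auto intro: continuous_measurable_arc_length)
    have "energy (\<lambda>z. a z + b z)
        \<le> (\<integral>\<^sup>+z. ennreal 2 * ennreal ((norm (a z))\<^sup>2) + ennreal 2 * ennreal ((norm (b z))\<^sup>2) \<partial>arc_length)"
    proof (intro nn_integral_mono)
      fix z
      have "ennreal ((norm (a z + b z))\<^sup>2) \<le> ennreal (2 * (norm (a z))\<^sup>2 + 2 * (norm (b z))\<^sup>2)"
        by (intro ennreal_leI norm_sum_sq_le)
      also have "\<dots> = ennreal 2 * ennreal ((norm (a z))\<^sup>2) + ennreal 2 * ennreal ((norm (b z))\<^sup>2)"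
        by (simp add: ennreal_plus ennreal_mult)
      finally show "ennreal ((norm (a z + b z))\<^sup>2) \<le> \<dots>" .
    qed
    also have "\<dots> = ennreal 2 * energy a + ennreal 2 * energy b"
      by (subst nn_integral_add) (auto simp: nn_integral_cmult)
    also have "\<dots> \<le> ennreal 2 * ennreal A + ennreal 2 * ennreal B"
      using that by (intro add_mono mult_left_mono) auto
    also have "\<dots> = ennreal (2 * A + 2 * B)" using that by (simp add: ennreal_mult ennreal_plus)
    finally show ?thesis .
  qed
  show ?thesis
    unfolding besov_le_def
  proof (intro conjI allI impI)
    show "energy (\<lambda>z. F z + G z) \<le> ennreal (2 * K1 + 2 * K2)"
      using assms by (intro gen) (auto simp: besov_le_def)
    fix t :: real assume t: "0 < t" "t \<le> 2"
    have "energy (\<lambda>z. (F (z * cis t) - F z) + (G (z * cis t) - G z))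
      \<le> ennreal (2 * (K1 * t powr (2 * s)) + 2 * (K2 * t powr (2 * s)))"
      using assms t by (intro gen continuous_on_diff continuous_on_rotate cF cG) (auto simp: besov_le_def)
    moreover have "(F (z * cis t) - F z) + (G (z * cis t) - G z) = F (z * cis t) + G (z * cis t) - (F z + G z)" for z
      by simp
    ultimately show "energy (\<lambda>z. F (z * cis t) + G (z * cis t) - (F z + G z))
      \<le> ennreal ((2 * K1 + 2 * K2) * t powr (2 * s))"
      by (simp add: algebra_simps)
  qed (use K cF cG in \<open>auto intro!: continuous_intros\<close>)
qed

lemma besov_le_mono:
  assumes "besov_le s K F" "K \<le> K'"
  shows "besov_le s K' F"
proof -
  have "ennreal K \<le> ennreal K'" using assms by (intro ennreal_leI)
  moreover have "ennreal (K * t powr (2 * s)) \<le> ennreal (K' * t powr (2 * s))" for t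
    using assms by (intro ennreal_leI mult_right_mono) auto
  ultimately show ?thesis using assms unfolding besov_le_def by (meson order_trans)
qed

lemma nn_integral_le_const_circle:
  assumes "\<And>z. z \<in> unit_circle \<Longrightarrow> f z \<le> B" "0 \<le> B"
  shows "(\<integral>\<^sup>+z. ennreal (f z) \<partial>arc_length) \<le> ennreal (8 * B)"
proof -
  have "(\<integral>\<^sup>+z. ennreal (f z) \<partial>arc_length) \<le> (\<integral>\<^sup>+z. ennreal B \<partial>arc_length)"
    using assms by (intro nn_integral_mono ennreal_leI) auto
  also have "\<dots> = ennreal (B * (2 * pi))" using assms by (simp add: emeasure_arc_length_circle ennreal_mult')
  also have "\<dots> \<le> ennreal (8 * B)"
  proof (rule ennreal_leI)
    have "B * (2 * pi) \<le> B * 8" using assms pi_less_4 by (intro mult_left_mono) auto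
    then show "B * (2 * pi) \<le> 8 * B" by simp
  qed
  finally show ?thesis .
qed

lemma holder_continuous_on:
  fixes F :: "complex \<Rightarrow> complex"
  assumes s: "0 < s" and h: "\<And>z w. z \<in> S \<Longrightarrow> w \<in> S \<Longrightarrow> norm (F z - F w) \<le> \<kappa> * norm (z - w) powr s"
  shows "continuous_on S F"
proof (unfold continuous_on_def, intro ballI)
  fix x assume x: "x \<in> S"
  have "((\<lambda>z. norm (z - x)) \<longlongrightarrow> 0) (at x within S)"
    by (intro tendsto_norm_zero LIM_zero) simp
  then have "((\<lambda>z. norm (z - x) powr s) \<longlongrightarrow> 0) (at x within S)"
    using s by (intro tendsto_zero_powrI[where b = s]) (auto intro!: always_eventually)
  then have "((\<lambda>z. \<kappa> * norm (z - x) powr s) \<longlongrightarrow> 0) (at x within S)"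
    by (rule tendsto_mult_right_zero)
  moreover have "eventually (\<lambda>z. norm (F z - F x) \<le> \<kappa> * norm (z - x) powr s) (at x within S)"
    using h[OF _ x] by (simp add: eventually_at_filter)
  ultimately have "((\<lambda>z. F z - F x) \<longlongrightarrow> 0) (at x within S)"
    by (rule Lim_null_comparison[rotated])
  then show "(F \<longlongrightarrow> F x) (at x within S)" by (rule LIM_zero_cancel)
qed

lemma besov_le_holder:
  assumes s: "0 < s" and \<kappa>: "0 \<le> \<kappa>" and b: "\<And>z. z \<in> unit_circle \<Longrightarrow> norm (F z) \<le> \<kappa>"
    and h: "\<And>z w. z \<in> unit_circle \<Longrightarrow> w \<in> unit_circle \<Longrightarrow> norm (F z - F w) \<le> \<kappa> * norm (z - w) powr s"
  shows "besov_le s (8 * \<kappa>\<^sup>2) F"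
  unfolding besov_le_def
proof (intro conjI allI impI)
  show "continuous_on unit_circle F" using holder_continuous_on[OF s h] .
  show "energy F \<le> ennreal (8 * \<kappa>\<^sup>2)"
    using b by (intro nn_integral_le_const_circle power_mono) auto
  fix t :: real assume t: "0 < t" "t \<le> 2"
  have "energy (\<lambda>z. F (z * cis t) - F z) \<le> ennreal (8 * (\<kappa> * t powr s)\<^sup>2)"
  proof (intro nn_integral_le_const_circle power_mono)
    fix z :: complex assume z: "z \<in> unit_circle"
    have "norm (F (z * cis t) - F z) \<le> \<kappa> * norm (z * cis t - z) powr s"
      using z by (intro h) (auto simp: norm_mult)
    also have "\<dots> \<le> \<kappa> * t powr s"
      using norm_mult_cis_diff_le[OF z, of t] t s \<kappa> by (intro mult_left_mono powr_mono2) auto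
    finally show "norm (F (z * cis t) - F z) \<le> \<kappa> * t powr s" .
  qed auto
  also have "8 * (\<kappa> * t powr s)\<^sup>2 = 8 * \<kappa>\<^sup>2 * t powr (2 * s)"
    using t by (simp add: power_mult_distrib powr_power mult.commute)
  finally show "energy (\<lambda>z. F (z * cis t) - F z) \<le> ennreal (8 * \<kappa>\<^sup>2 * t powr (2 * s))" .
qed auto

section \<open>The outer multipliers\<close>

text \<open>A sum of Riesz potentials of order \<epsilon> of the neighbourhoods. It is the pointwise
  majorant for the weighted increments of \<open>herglotz_sum\<close>, with values in
  \<open>ennreal\<close> so that Tonelli applies directly.\<close>

definition kernel_mass :: "real \<Rightarrow> complex set \<Rightarrow> nat \<Rightarrow> complex \<Rightarrow> ennreal" where
  "kernel_mass \<epsilon> E J z =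
     (\<Sum>j<J. \<integral>\<^sup>+\<xi>. ennreal (norm (\<xi> - z) powr (\<epsilon> - 1)) * indicator (circle_nbhd E (1 / 2 ^ j)) \<xi> \<partial>arc_length)"

lemma pair_measurable_kernel:
  assumes "A \<in> sets arc_length"
  shows "(\<lambda>(z, \<xi>). ennreal (norm (\<xi> - z) powr (\<epsilon> - 1)) * indicator A \<xi>)
    \<in> borel_measurable (arc_length \<Otimes>\<^sub>M arc_length)"
proof -
  note [measurable] = ident_borel_measurable_arc_length assms
  have [measurable]: "fst \<in> borel_measurable (arc_length \<Otimes>\<^sub>M arc_length)" "snd \<in> borel_measurable (arc_length \<Otimes>\<^sub>M arc_length)"
    using measurable_compose[OF measurable_fst ident_borel_measurable_arc_length]
      measurable_compose[OF measurable_snd ident_borel_measurable_arc_length] by simp_all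
  show ?thesis unfolding case_prod_beta by measurable
qed

lemma kernel_mass_measurable [measurable]: "kernel_mass \<epsilon> E J \<in> borel_measurable arc_length"
  unfolding kernel_mass_def[abs_def]
  by (intro borel_measurable_sum arc_length.borel_measurable_nn_integral pair_measurable_kernel sets_circle_nbhd)

text \<open>By Tonelli the integral over \<open>z\<close> comes first and is at most
  \<open>C\<close> for each fixed \<xi>; what remains is the arc length of the
  neighbourhoods.\<close>

lemma nn_integral_kernel_mass:
  assumes C: "\<And>w. w \<in> unit_circle \<Longrightarrow> (\<integral>\<^sup>+z. ennreal (norm (z - w) powr (\<epsilon> - 1)) \<partial>arc_length) \<le> ennreal C" and "0 \<le> C"
  shows "(\<integral>\<^sup>+z. kernel_mass \<epsilon> E J z \<partial>arc_length) \<le> ennreal (C * nbhd_mass E J)"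
proof -
  interpret pair_sigma_finite arc_length arc_length ..
  let ?k = "\<lambda>j z \<xi>. ennreal (norm (\<xi> - z) powr (\<epsilon> - 1)) * indicator (circle_nbhd E (1 / 2 ^ j)) \<xi>"
  have "(\<integral>\<^sup>+z. kernel_mass \<epsilon> E J z \<partial>arc_length) = (\<Sum>j<J. \<integral>\<^sup>+z. \<integral>\<^sup>+\<xi>. ?k j z \<xi> \<partial>arc_length \<partial>arc_length)"
    unfolding kernel_mass_def
    by (intro nn_integral_sum arc_length.borel_measurable_nn_integral pair_measurable_kernel sets_circle_nbhd)
  also have "\<dots> = (\<Sum>j<J. \<integral>\<^sup>+\<xi>. \<integral>\<^sup>+z. ?k j z \<xi> \<partial>arc_length \<partial>arc_length)"
    by (intro sum.cong refl Fubini'[symmetric] pair_measurable_kernel sets_circle_nbhd)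
  also have "\<dots> \<le> (\<Sum>j<J. \<integral>\<^sup>+\<xi>. ennreal C * indicator (circle_nbhd E (1 / 2 ^ j)) \<xi> \<partial>arc_length)"
  proof (intro sum_mono nn_integral_mono)
    fix j \<xi> assume "\<xi> \<in> space arc_length"
    then have "(\<integral>\<^sup>+z. ennreal (norm (\<xi> - z) powr (\<epsilon> - 1)) \<partial>arc_length) \<le> ennreal C"
      using C[of \<xi>] by (simp add: norm_minus_commute)
    then show "(\<integral>\<^sup>+z. ?k j z \<xi> \<partial>arc_length) \<le> ennreal C * indicator (circle_nbhd E (1 / 2 ^ j)) \<xi>"
      by (cases "\<xi> \<in> circle_nbhd E (1 / 2 ^ j)") auto
  qed
  also have "\<dots> = (\<Sum>j<J. ennreal (C * measure arc_length (circle_nbhd E (1 / 2 ^ j))))"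
  proof (intro sum.cong refl)
    fix j
    have "(\<integral>\<^sup>+\<xi>. ennreal C * indicator (circle_nbhd E (1 / 2 ^ j)) \<xi> \<partial>arc_length) = ennreal C * emeasure arc_length (circle_nbhd E (1 / 2 ^ j))"
      by (intro nn_integral_cmult_indicator sets_circle_nbhd)
    then show "(\<integral>\<^sup>+\<xi>. ennreal C * indicator (circle_nbhd E (1 / 2 ^ j)) \<xi> \<partial>arc_length)
        = ennreal (C * measure arc_length (circle_nbhd E (1 / 2 ^ j)))"
      using assms(2) by (simp add: arc_length.emeasure_eq_measure ennreal_mult)
  qed
  also have "\<dots> = ennreal (C * nbhd_mass E J)"
    using assms(2) by (subst sum_ennreal) (auto simp: nbhd_mass_def sum_distrib_left)
  finally show ?thesis .
qed

text \<open>Excludes the point where \<open>powr\<close> with base 0 returns 0 instead of a large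
  value, which would spoil the pointwise comparison of kernels.\<close>

lemma AE_arc_length_neq:
  assumes "w \<in> unit_circle"
  shows "AE z in arc_length. z \<noteq> w"
proof -
  have "{z \<in> unit_circle. norm (z - w) \<le> 0} = {w}" using assms by auto
  moreover have "{z \<in> unit_circle. norm (z - w) \<le> 0} \<in> null_sets arc_length"
    using arc_length_cball[OF assms, of 0] cball_sets_arc_length[of w 0] by (intro null_setsI) auto
  ultimately have "{w} \<in> null_sets arc_length" by simp
  then show ?thesis by (rule AE_not_in[THEN AE_mp]) auto
qed

text \<open>Write \<open>n\<close> for \<open>|\<xi> - r z|\<close>. As
  \<open>6 t \<le> d \<le> 3 n\<close>, moving \<open>z\<close> by \<open>t\<close> at most halves
  \<open>n\<close>, so the kernel difference is at most \<open>4 t / n^2\<close>. Multiplying by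
  \<open>d^(1 + \<epsilon>) \<le> 9 n^(1 + \<epsilon>)\<close> and using
  \<open>|\<xi> - z| \<le> 2 n\<close> leaves \<open>72 t |\<xi> - z|^(\<epsilon> - 1)\<close>: the
  weight turns a singularity of order 2 into an integrable one.\<close>

lemma herglotz_sum_diff_le:
  assumes z: "z \<in> unit_circle" "z' \<in> unit_circle" and t: "0 < t" "norm (z' - z) \<le> t" "6 * t \<le> infdist z E"
    and \<epsilon>: "0 < \<epsilon>" "\<epsilon> < 1"
  shows "ennreal (infdist z E powr (1 + \<epsilon>) * norm (herglotz_sum E J z' - herglotz_sum E J z))
    \<le> ennreal (72 * t) * kernel_mass \<epsilon> E J z"
proof -
  let ?d = "infdist z E" and ?A = "\<lambda>j. circle_nbhd E (1 / 2 ^ j)" and ?r = "\<lambda>j. 1 - 1 / 2 ^ j :: real"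
  let ?H = "\<lambda>j. herglotz (?A j) (?r j)"
  have "ennreal (?d powr (1 + \<epsilon>) * norm (herglotz_sum E J z' - herglotz_sum E J z))
      \<le> ennreal (?d powr (1 + \<epsilon>) * (\<Sum>j<J. norm (?H j z' - ?H j z)))"
    unfolding herglotz_sum_def sum_subtractf[symmetric]
    by (intro ennreal_leI mult_left_mono norm_sum) auto
  also have "\<dots> = (\<Sum>j<J. ennreal (?d powr (1 + \<epsilon>)) * ennreal (norm (?H j z' - ?H j z)))"
    by (simp add: sum_distrib_left ennreal_mult[symmetric] sum_nonneg flip: sum_ennreal)
  also have "\<dots> \<le> (\<Sum>j<J. ennreal (72 * t) * (\<integral>\<^sup>+\<xi>. ennreal (norm (\<xi> - z) powr (\<epsilon> - 1)) * indicator (?A j) \<xi> \<partial>arc_length))"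
  proof (intro sum_mono)
    fix j
    let ?k = "\<lambda>\<xi>. 2 * norm (z' - z) / (norm (\<xi> - of_real (?r j) * z') * norm (\<xi> - of_real (?r j) * z))"
    have m: "(\<lambda>\<xi>. ennreal (?k \<xi>) * indicator (?A j) \<xi>) \<in> borel_measurable arc_length"
      by (intro borel_measurable_times_ennreal borel_measurable_indicator sets_circle_nbhd borel_measurable_arc_length) measurable
    have "ennreal (?d powr (1 + \<epsilon>)) * ennreal (norm (?H j z' - ?H j z))
        \<le> ennreal (?d powr (1 + \<epsilon>)) * (\<integral>\<^sup>+\<xi>. ennreal (?k \<xi>) * indicator (?A j) \<xi> \<partial>arc_length)"
      by (intro mult_left_mono norm_herglotz_diff_le z sets_circle_nbhd) auto
    also have "\<dots> = (\<integral>\<^sup>+\<xi>. ennreal (?d powr (1 + \<epsilon>)) * (ennreal (?k \<xi>) * indicator (?A j) \<xi>) \<partial>arc_length)"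
      by (rule nn_integral_cmult[OF m, symmetric])
    also have "\<dots> \<le> (\<integral>\<^sup>+\<xi>. ennreal (72 * t) * (ennreal (norm (\<xi> - z) powr (\<epsilon> - 1)) * indicator (?A j) \<xi>) \<partial>arc_length)"
    proof (rule nn_integral_mono_AE)
      show "AE \<xi> in arc_length. ennreal (?d powr (1 + \<epsilon>)) * (ennreal (?k \<xi>) * indicator (?A j) \<xi>)
          \<le> ennreal (72 * t) * (ennreal (norm (\<xi> - z) powr (\<epsilon> - 1)) * indicator (?A j) \<xi>)"
        using AE_arc_length_neq[OF z(1)]
      proof eventually_elim
        case (elim \<xi>)
        show ?case
        proof (cases "\<xi> \<in> ?A j")
          case True
          let ?n = "norm (\<xi> - of_real (?r j) * z)" and ?n' = "norm (\<xi> - of_real (?r j) * z')"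
          have h: "0 < (1 / 2 ^ j :: real)" "(1 / 2 ^ j :: real) \<le> 1" by auto
          note k = infdist_le_kernel[OF True z(1) h]
          have n: "0 < ?n" "?d \<le> 3 * ?n" "norm (\<xi> - z) \<le> 2 * ?n"
            using k h(1) by linarith+
          have "c * (z' - z) = (\<xi> - c * z) - (\<xi> - c * z')" for c by (simp add: algebra_simps)
          then have "of_real (?r j) * (z' - z) = (\<xi> - of_real (?r j) * z) - (\<xi> - of_real (?r j) * z')" .
          moreover have "norm (of_real (?r j) * (z' - z)) \<le> 1 * norm (z' - z)"
            unfolding norm_mult norm_of_real by (intro mult_right_mono) auto
          ultimately have "?n - ?n' \<le> t"
            using norm_triangle_ineq2[of "\<xi> - of_real (?r j) * z" "\<xi> - of_real (?r j) * z'"] t by simp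
          then have n': "?n / 2 \<le> ?n'" using n t by linarith
          have "?k \<xi> \<le> 2 * t / (?n / 2 * ?n)"
            using t n n' by (intro frac_le mult_mono mult_pos_pos) auto
          also have "\<dots> = 4 * t / (?n * ?n)" by simp
          finally have 1: "?k \<xi> \<le> 4 * t / (?n * ?n)" .
          have "?d powr (1 + \<epsilon>) \<le> (3 * ?n) powr (1 + \<epsilon>)"
            using n \<epsilon> infdist_nonneg[of z E] by (intro powr_mono2) auto
          also have "\<dots> = 3 powr (1 + \<epsilon>) * ?n powr (1 + \<epsilon>)" by (rule powr_mult)
          also have "\<dots> \<le> 9 * ?n powr (1 + \<epsilon>)"
          proof (intro mult_right_mono)
            have "(3::real) powr (1 + \<epsilon>) \<le> 3 powr 2" using \<epsilon> by (intro powr_mono) auto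
            then show "(3::real) powr (1 + \<epsilon>) \<le> 9" by (simp add: powr_numeral)
          qed auto
          finally have "?d powr (1 + \<epsilon>) * ?k \<xi> \<le> (9 * ?n powr (1 + \<epsilon>)) * (4 * t / (?n * ?n))"
            using 1 t n by (intro mult_mono) auto
          also have "\<dots> = 36 * t * (?n powr (1 + \<epsilon>) / ?n powr 2)" using n by (simp add: powr_numeral power2_eq_square)
          also have "?n powr (1 + \<epsilon>) / ?n powr 2 = ?n powr (\<epsilon> - 1)"
            by (simp only: powr_diff[symmetric]) simp
          also have "?n powr (\<epsilon> - 1) \<le> (norm (\<xi> - z) / 2) powr (\<epsilon> - 1)"
            using n elim \<epsilon> by (intro powr_mono2') auto
          also have "\<dots> = norm (\<xi> - z) powr (\<epsilon> - 1) * 2 powr (1 - \<epsilon>)"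
          proof -
            have "(2::real) powr (1 - \<epsilon>) = inverse (2 powr (\<epsilon> - 1))" using powr_minus[of 2 "\<epsilon> - 1"] by simp
            then show ?thesis by (subst powr_divide) (simp only: divide_inverse)
          qed
          also have "\<dots> \<le> norm (\<xi> - z) powr (\<epsilon> - 1) * 2"
          proof (intro mult_left_mono)
            show "(2::real) powr (1 - \<epsilon>) \<le> 2" using powr_mono[of "1 - \<epsilon>" 1 "2::real"] \<epsilon> by simp
          qed auto
          finally have "?d powr (1 + \<epsilon>) * ?k \<xi> \<le> 72 * t * norm (\<xi> - z) powr (\<epsilon> - 1)"
            using t by (simp add: mult_left_mono)
          then have "ennreal (?d powr (1 + \<epsilon>) * ?k \<xi>) \<le> ennreal (72 * t * norm (\<xi> - z) powr (\<epsilon> - 1))"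
            by (rule ennreal_leI)
          then show ?thesis using True t by (simp add: ennreal_mult[symmetric])
        qed simp
      qed
    qed
    also have "\<dots> = ennreal (72 * t) * (\<integral>\<^sup>+\<xi>. ennreal (norm (\<xi> - z) powr (\<epsilon> - 1)) * indicator (?A j) \<xi> \<partial>arc_length)"
      by (intro nn_integral_cmult borel_measurable_times_ennreal borel_measurable_indicator sets_circle_nbhd borel_measurable_arc_length) measurable
    finally show "ennreal (?d powr (1 + \<epsilon>)) * ennreal (norm (?H j z' - ?H j z))
      \<le> ennreal (72 * t) * (\<integral>\<^sup>+\<xi>. ennreal (norm (\<xi> - z) powr (\<epsilon> - 1)) * indicator (?A j) \<xi> \<partial>arc_length)" .
  qed
  also have "\<dots> = ennreal (72 * t) * kernel_mass \<epsilon> E J z"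
    by (simp add: kernel_mass_def sum_distrib_left)
  finally show ?thesis .
qed

lemma infdist_circle_le_2:
  assumes "z \<in> unit_circle" "E \<subseteq> unit_circle" "E \<noteq> {}"
  shows "infdist z E \<le> 2"
proof -
  obtain w where w: "w \<in> E" using assms by auto
  have "infdist z E \<le> dist z w" using w by (rule infdist_le)
  also have "\<dots> \<le> norm z + norm w" unfolding dist_norm by (rule norm_triangle_ineq4)
  also have "\<dots> = 2" using w assms by auto
  finally show ?thesis .
qed

text \<open>Where \<open>d(z, E) < 6 t\<close> the increment over an arc of length \<open>t\<close> is bounded by the sizes of the two values.
  Elsewhere the phase of the exponential could oscillate, and only the first power of the increment of
  \<open>herglotz_sum\<close> is used: weighted by \<open>d(z, E)\<^sup>1\<^sup>+\<^sup>\<epsilon>\<close> it has integral at most a constant times \<open>t\<close> times the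
  mass \<open>M\<close>, which the normalization \<open>exp (- 2 c M)\<close> absorbs.\<close>

lemma outer_besov:
  fixes f :: "complex \<Rightarrow> complex"
  assumes s: "0 < s" "s < \<delta>" "\<delta> \<le> 1 / 2"
    and E: "closed E" "E \<noteq> {}" "E \<subseteq> unit_circle"
    and L: "0 < L" and f: "\<And>z w. z \<in> unit_circle \<Longrightarrow> w \<in> unit_circle \<Longrightarrow> norm (f z - f w) \<le> L * norm (z - w) powr \<delta>"
    and f0: "\<And>z. z \<in> E \<Longrightarrow> f z = 0"
  shows "\<exists>c \<alpha> \<gamma>. 0 < c \<and> 0 \<le> \<alpha> \<and> 0 \<le> \<gamma> \<and>
    (\<forall>J. besov_le s (exp (- 2 * c * nbhd_mass E J) * (\<alpha> + \<gamma> * nbhd_mass E J))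
       (\<lambda>z. exp (of_real c * (herglotz_sum E J z - of_real (nbhd_mass E J))) * f z))"
proof -
  \<comment> \<open>\<eta> is the blow-up granted to the multiplier, whose modulus is at most
    \<open>A d^(-\<eta>)\<close>, and \<open>c\<close> is chosen so that
    \<open>c * 2048 / ln 2 = \<eta>\<close>. Taking half of the gap leaves
    \<open>2 (\<delta> - \<eta>) = 2 s + \<epsilon>\<close>.\<close>
  define \<eta> where "\<eta> = (\<delta> - s) / 2"
  define \<epsilon> where "\<epsilon> = \<delta> - s"
  define c where "c = \<eta> * ln 2 / 2048"
  have \<eta>: "0 < \<eta>" "\<eta> < 1" "\<eta> < \<delta>" and \<epsilon>: "0 < \<epsilon>" "\<epsilon> < 1" using s by (auto simp: \<eta>_def \<epsilon>_def)
  have c: "0 < c" using \<eta> by (simp add: c_def)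
  obtain C where C: "C > 0"
    "\<And>w. w \<in> unit_circle \<Longrightarrow> (\<integral>\<^sup>+z. ennreal (norm (z - w) powr (\<epsilon> - 1)) \<partial>arc_length) \<le> ennreal C"
    using nn_integral_dist_powr[OF \<epsilon>] by blast
  \<comment> \<open>Chosen to have \<open>A^2 L^2 = exp (- 2 c M) B\<close>, where \<open>A\<close>
    absorbs the additive constant 8192 of the bound for the real part.\<close>
  define B where "B = exp (2 * 8192 * c) * L\<^sup>2"
  have B: "B > 0" using L by (simp add: B_def)
  \<comment> \<open>\<open>448 = 8 * 56\<close>, with 8 for the length of the circle and 56 from the
    zone near \<open>E\<close>; \<open>4608 = 64 * 72\<close> comes from the far zone.\<close>
  show ?thesis
  proof (rule exI[of _ c], rule exI[of _ "448 * B"], rule exI[of _ "4608 * c * C * B"], intro conjI allI)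
    show "0 < c" "0 \<le> 448 * B" "0 \<le> 4608 * c * C * B" using c B C by auto
    fix J
    define M where "M = nbhd_mass E J"
    have M: "0 \<le> M" by (simp add: M_def nbhd_mass_nonneg)
    let ?d = "\<lambda>z. infdist z E" and ?U = "herglotz_sum E J"
    define V where "V z = of_real c * (?U z - of_real M)" for z
    define g where "g z = exp (V z)" for z
    define F where "F z = g z * f z" for z
    define A where "A = exp (c * 8192 - c * M)"
    have A: "A > 0" by (simp add: A_def)
    have A2: "A\<^sup>2 * L\<^sup>2 = exp (- 2 * c * M) * B"
      by (simp add: A_def B_def power2_eq_square exp_add[symmetric] algebra_simps)
    have d2: "?d z \<le> 2" if "z \<in> unit_circle" for z using infdist_circle_le_2[OF that E(3,2)] .
    have ReV: "exp (Re (V z)) \<le> A * ?d z powr (-\<eta>)" if "z \<in> unit_circle" "?d z > 0" for z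
    proof -
      have "c * Re (?U z) \<le> c * (2048 / ln 2 * ln (1 / ?d z) + 8192)"
        using c Re_herglotz_sum_le[OF that d2[OF that(1)], of J] by (intro mult_left_mono) auto
      also have "\<dots> = \<eta> * ln (1 / ?d z) + c * 8192" by (simp add: c_def algebra_simps)
      finally have "Re (V z) \<le> (c * 8192 - c * M) + (-\<eta>) * ln (?d z)"
        using that by (simp add: V_def algebra_simps ln_div)
      then have "exp (Re (V z)) \<le> exp ((c * 8192 - c * M) + (-\<eta>) * ln (?d z))" by simp
      also have "\<dots> = A * ?d z powr (-\<eta>)" using that by (simp add: A_def powr_def exp_add[symmetric])
      finally show ?thesis .
    qed
    have fb: "norm (f z) \<le> L * ?d z powr \<delta>" if "z \<in> unit_circle" for z
    proof -
      obtain w where w: "w \<in> E" "?d z = dist z w" using infdist_attains_inf[OF E(1,2)] by metis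
      have "norm (f z - f w) \<le> L * norm (z - w) powr \<delta>" using w E that by (intro f) auto
      with w show ?thesis by (simp add: f0 dist_norm)
    qed
    have Fb: "norm (F z) \<le> A * L * ?d z powr (\<delta> - \<eta>)" if z: "z \<in> unit_circle" for z
    proof (cases "?d z = 0")
      case True
      then have "f z = 0" using fb[OF z] s by simp
      then show ?thesis using A L by (simp add: F_def)
    next
      case False
      then have d: "?d z > 0" using infdist_nonneg[of z E] by linarith
      have "norm (F z) \<le> (A * ?d z powr (-\<eta>)) * (L * ?d z powr \<delta>)"
        unfolding F_def g_def norm_mult using ReV[OF z d] fb[OF z] A by (intro mult_mono) auto
      also have "\<dots> = A * L * ?d z powr (\<delta> - \<eta>)" by (simp add: powr_add[symmetric])
      finally show ?thesis .
    qed
    have exponent: "2 * (\<delta> - \<eta>) = 2 * s + \<epsilon>" by (simp add: \<eta>_def \<epsilon>_def field_simps)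
    have powr_sq: "(x powr a)\<^sup>2 = x powr (2 * a)" for x a :: real
      unfolding power2_eq_square powr_add[symmetric] by (simp only: mult_2)
    have sq: "(x powr (\<delta> - \<eta>))\<^sup>2 = x powr (2 * s + \<epsilon>)" for x
      by (simp only: powr_sq exponent)
    have contU: "continuous_on unit_circle ?U"
    proof -
      obtain R where R: "1 < R" "?U holomorphic_on ball 0 R" using holomorphic_herglotz_sum by blast
      have "unit_circle \<subseteq> ball 0 R" using R(1) by auto
      then show ?thesis using holomorphic_on_imp_continuous_on[OF R(2)] continuous_on_subset by blast
    qed
    have contF: "continuous_on unit_circle F"
      unfolding F_def g_def V_def using holder_continuous_on[OF _ f, of unit_circle] s
      by (intro continuous_intros contU) auto
    \<comment> \<open>Both points lie within \<open>7 t\<close> of \<open>E\<close>, so the two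
      values are estimated separately, each by \<open>A L (7 t)^(\<delta> - \<eta>)\<close>. Then
      \<open>56 = 4 * 7 * 2\<close>.\<close>
    have near: "(norm (F (z * cis t) - F z))\<^sup>2 \<le> 56 * (A\<^sup>2 * L\<^sup>2) * t powr (2 * s)"
      if z: "z \<in> unit_circle" and t: "0 < t" "t \<le> 2" and d: "?d z < 6 * t" for z t
    proof -
      have z': "z * cis t \<in> unit_circle" using z by (simp add: norm_mult)
      have "?d (z * cis t) \<le> ?d z + dist (z * cis t) z" by (rule infdist_triangle)
      also have "dist (z * cis t) z \<le> t" using norm_mult_cis_diff_le[OF z, of t] t by (simp add: dist_norm)
      finally have d': "?d (z * cis t) \<le> 7 * t" using d by simp
      have bd: "norm (F w) \<le> A * L * (7 * t) powr (\<delta> - \<eta>)" if "w \<in> unit_circle" "?d w \<le> 7 * t" for w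
      proof -
        have "?d w powr (\<delta> - \<eta>) \<le> (7 * t) powr (\<delta> - \<eta>)"
          using that \<eta> infdist_nonneg[of w E] by (intro powr_mono2) auto
        then have "A * L * ?d w powr (\<delta> - \<eta>) \<le> A * L * (7 * t) powr (\<delta> - \<eta>)"
          using A L by (intro mult_left_mono) auto
        then show ?thesis using Fb[OF that(1)] by linarith
      qed
      have "norm (F (z * cis t) - F z) \<le> norm (F (z * cis t)) + norm (F z)" by (rule norm_triangle_ineq4)
      also have "\<dots> \<le> 2 * (A * L * (7 * t) powr (\<delta> - \<eta>))"
        using bd[OF z' d'] bd[OF z] d t by linarith
      finally have "(norm (F (z * cis t) - F z))\<^sup>2 \<le> (2 * (A * L * (7 * t) powr (\<delta> - \<eta>)))\<^sup>2"
        by (intro power_mono) auto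
      also have "\<dots> = 4 * (A\<^sup>2 * L\<^sup>2) * (7 * t) powr (2 * s + \<epsilon>)"
        by (simp only: power_mult_distrib sq) simp
      also have "(7 * t) powr (2 * s + \<epsilon>) = (7 powr (2 * s + \<epsilon>) * t powr \<epsilon>) * t powr (2 * s)"
        using t by (simp add: powr_mult powr_add)
      also have "\<dots> \<le> (7 * 2) * t powr (2 * s)"
      proof (intro mult_right_mono mult_mono)
        show "(7::real) powr (2 * s + \<epsilon>) \<le> 7"
          using powr_mono[of "2 * s + \<epsilon>" 1 "7::real"] s by (simp add: \<epsilon>_def)
        have "t powr \<epsilon> \<le> 2 powr \<epsilon>" using t \<epsilon> by (intro powr_mono2) auto
        also have "\<dots> \<le> 2 powr 1" using \<epsilon> by (intro powr_mono) auto
        finally show "t powr \<epsilon> \<le> 2" by simp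
      qed auto
      finally show ?thesis by (simp add: mult_left_mono)
    qed
    \<comment> \<open>Here the distances of the two points to \<open>E\<close> agree up to a factor
      2. The increment splits as \<open>(g' - g) f' + g (f' - f)\<close>, and only the first part
      involves the increment of \<open>herglotz_sum\<close>.\<close>
    have far: "(norm (F (z * cis t) - F z))\<^sup>2 \<le>
        4 * (A\<^sup>2 * L\<^sup>2) * t powr (2 * s)
        + 64 * (A\<^sup>2 * L\<^sup>2) * c * t powr (2 * s - 1) * (?d z powr (1 + \<epsilon>) * norm (?U (z * cis t) - ?U z))"
      if z: "z \<in> unit_circle" and t: "0 < t" "t \<le> 2" and d: "6 * t \<le> ?d z" for z t
    proof -
      let ?z = "z * cis t"
      have z': "?z \<in> unit_circle" using z by (simp add: norm_mult)
      have dz: "dist ?z z \<le> t" using norm_mult_cis_diff_le[OF z, of t] t by (simp add: dist_norm)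
      have "?d ?z \<le> ?d z + dist ?z z" "?d z \<le> ?d ?z + dist z ?z" by (rule infdist_triangle)+
      then have d': "?d ?z \<le> 2 * ?d z" "?d z / 2 \<le> ?d ?z" "?d z > 0" "?d ?z > 0"
        using d t dz by (auto simp: dist_commute)
      define e where "e = 2 * (A * ?d z powr (-\<eta>))"
      have e1: "exp (Re (V z)) \<le> e" using ReV[OF z d'(3)] exp_gt_zero[of "Re (V z)"] unfolding e_def by linarith
      have e2: "exp (Re (V ?z)) \<le> e"
      proof -
        have "?d ?z powr (-\<eta>) \<le> (?d z / 2) powr (-\<eta>)" using d' \<eta> by (intro powr_mono2') auto
        also have "\<dots> = ?d z powr (-\<eta>) * 2 powr \<eta>" using d' by (simp add: powr_divide powr_minus field_simps)
        also have "\<dots> \<le> ?d z powr (-\<eta>) * 2"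
          using powr_mono[of \<eta> 1 "2::real"] \<eta> by (intro mult_left_mono) auto
        finally have "A * ?d ?z powr (-\<eta>) \<le> A * (?d z powr (-\<eta>) * 2)" using A by (intro mult_left_mono) auto
        then show ?thesis using ReV[OF z' d'(4)] by (simp add: e_def)
      qed
      have "V ?z - V z = of_real c * (?U ?z - ?U z)" by (simp add: V_def algebra_simps)
      then have "norm (V ?z - V z) = c * norm (?U ?z - ?U z)" using c by (simp add: norm_mult)
      then have gd: "(norm (g ?z - g z))\<^sup>2 \<le> 2 * e\<^sup>2 * (c * norm (?U ?z - ?U z))"
        using norm_exp_diff_sq_le[OF e2 e1] by (simp add: g_def)
      have fz': "norm (f ?z) \<le> L * (2 * ?d z powr \<delta>)"
      proof -
        have "?d ?z powr \<delta> \<le> (2 * ?d z) powr \<delta>" using d' s by (intro powr_mono2) auto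
        also have "\<dots> = 2 powr \<delta> * ?d z powr \<delta>" by (simp add: powr_mult)
        also have "\<dots> \<le> 2 * ?d z powr \<delta>"
          using powr_mono[of \<delta> 1 "2::real"] s by (intro mult_right_mono) auto
        finally show ?thesis using fb[OF z'] L by (meson mult_left_mono less_imp_le order_trans)
      qed
      have e_sq: "e\<^sup>2 = 4 * A\<^sup>2 * ?d z powr (- 2 * \<eta>)"
        by (simp add: e_def power_mult_distrib powr_sq mult_ac)
      have "(norm ((g ?z - g z) * f ?z))\<^sup>2 \<le> (2 * e\<^sup>2 * (c * norm (?U ?z - ?U z))) * (L * (2 * ?d z powr \<delta>))\<^sup>2"
        unfolding norm_mult power_mult_distrib[of "norm _" "norm _"] using gd fz' c by (intro mult_mono power_mono) auto
      also have "\<dots> = 32 * (A\<^sup>2 * L\<^sup>2) * c * norm (?U ?z - ?U z) * ?d z powr (2 * s + \<epsilon>)"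
      proof -
        have "?d z powr (- 2 * \<eta>) * (?d z powr \<delta>)\<^sup>2 = ?d z powr (2 * s + \<epsilon>)"
        proof -
          have "- 2 * \<eta> + 2 * \<delta> = 2 * s + \<epsilon>" using exponent by simp
          then show ?thesis by (simp only: powr_sq powr_add[symmetric])
        qed
        then show ?thesis by (simp add: e_sq power_mult_distrib)
      qed
      also have "?d z powr (2 * s + \<epsilon>) = ?d z powr (1 + \<epsilon>) * ?d z powr (2 * s - 1)"
        by (simp add: powr_add[symmetric] add.commute)
      \<comment> \<open>As \<open>2 s - 1 < 0\<close> and \<open>t \<le> d\<close>, the surplus
        power of \<open>d\<close> is exchanged for one of \<open>t\<close>, which together with the
        factor \<open>t\<close> of the kernel estimate gives \<open>t^(2 s)\<close>. This rests on
        the cap \<open>\<delta> \<le> 1 / 2\<close>.\<close>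
      also have "32 * (A\<^sup>2 * L\<^sup>2) * c * norm (?U ?z - ?U z) * (?d z powr (1 + \<epsilon>) * ?d z powr (2 * s - 1))
        \<le> 32 * (A\<^sup>2 * L\<^sup>2) * c * norm (?U ?z - ?U z) * (?d z powr (1 + \<epsilon>) * t powr (2 * s - 1))"
        using c d t s by (intro mult_left_mono powr_mono2') auto
      finally have 1: "(norm ((g ?z - g z) * f ?z))\<^sup>2
        \<le> 32 * (A\<^sup>2 * L\<^sup>2) * c * t powr (2 * s - 1) * (?d z powr (1 + \<epsilon>) * norm (?U ?z - ?U z))"
        by (simp add: mult_ac)
      have "norm (g z * (f ?z - f z)) \<le> (A * ?d z powr (-\<eta>)) * (L * t powr \<delta>)"
        unfolding norm_mult
      proof (intro mult_mono)
        show "norm (g z) \<le> A * ?d z powr (-\<eta>)" using ReV[OF z d'(3)] by (simp add: g_def)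
        have "norm (f ?z - f z) \<le> L * norm (?z - z) powr \<delta>" by (rule f[OF z' z])
        also have "\<dots> \<le> L * t powr \<delta>" using L s dz by (intro mult_left_mono powr_mono2) (auto simp: dist_norm)
        finally show "norm (f ?z - f z) \<le> L * t powr \<delta>" .
      qed (use A in auto)
      also have "\<dots> \<le> (A * t powr (-\<eta>)) * (L * t powr \<delta>)"
        using A L d t \<eta> by (intro mult_right_mono mult_left_mono powr_mono2') auto
      also have "\<dots> = A * L * t powr (\<delta> - \<eta>)" by (simp add: powr_add[symmetric])
      finally have "(norm (g z * (f ?z - f z)))\<^sup>2 \<le> (A * L * t powr (\<delta> - \<eta>))\<^sup>2" by (intro power_mono) auto
      also have "\<dots> = (A\<^sup>2 * L\<^sup>2) * (t powr \<epsilon> * t powr (2 * s))"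
        by (simp only: power_mult_distrib sq powr_add) (simp add: mult_ac)
      also have "\<dots> \<le> (A\<^sup>2 * L\<^sup>2) * (2 * t powr (2 * s))"
      proof (intro mult_left_mono mult_right_mono)
        have "t powr \<epsilon> \<le> 2 powr \<epsilon>" using t \<epsilon> by (intro powr_mono2) auto
        also have "\<dots> \<le> 2 powr 1" using \<epsilon> by (intro powr_mono) auto
        finally show "t powr \<epsilon> \<le> 2" by simp
      qed auto
      finally have 2: "(norm (g z * (f ?z - f z)))\<^sup>2 \<le> 2 * (A\<^sup>2 * L\<^sup>2) * t powr (2 * s)" by simp
      have "F ?z - F z = (g ?z - g z) * f ?z + g z * (f ?z - f z)" by (simp add: F_def algebra_simps)
      then have "(norm (F ?z - F z))\<^sup>2 \<le> 2 * (norm ((g ?z - g z) * f ?z))\<^sup>2 + 2 * (norm (g z * (f ?z - f z)))\<^sup>2"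
        using norm_sum_sq_le by metis
      with 1 2 show ?thesis by linarith
    qed
    let ?K = "exp (- 2 * c * M) * (448 * B + 4608 * c * C * B * M)"
    have "besov_le s ?K F"
      unfolding besov_le_def
    proof (intro conjI allI impI contF)
      show K0: "0 \<le> ?K" using c C B M by (intro mult_nonneg_nonneg add_nonneg_nonneg) auto
      have "energy F \<le> ennreal (8 * (2 * (A\<^sup>2 * L\<^sup>2)))"
      proof (rule nn_integral_le_const_circle)
        fix z :: complex assume z: "z \<in> unit_circle"
        have "(norm (F z))\<^sup>2 \<le> (A * L * ?d z powr (\<delta> - \<eta>))\<^sup>2" using Fb[OF z] by (intro power_mono) auto
        also have "\<dots> = (A\<^sup>2 * L\<^sup>2) * ?d z powr (2 * s + \<epsilon>)"
          by (simp only: power_mult_distrib sq)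
        also have "\<dots> \<le> (A\<^sup>2 * L\<^sup>2) * 2"
        proof (intro mult_left_mono)
          have "?d z powr (2 * s + \<epsilon>) \<le> 2 powr (2 * s + \<epsilon>)" using d2[OF z] s \<epsilon> by (intro powr_mono2) (auto simp: infdist_nonneg)
          also have "\<dots> \<le> 2 powr 1" using s by (intro powr_mono) (auto simp: \<epsilon>_def)
          finally show "?d z powr (2 * s + \<epsilon>) \<le> 2" by simp
        qed auto
        finally show "(norm (F z))\<^sup>2 \<le> 2 * (A\<^sup>2 * L\<^sup>2)" by simp
      qed auto
      also have "8 * (2 * (A\<^sup>2 * L\<^sup>2)) \<le> ?K"
      proof -
        have "8 * (2 * (A\<^sup>2 * L\<^sup>2)) = exp (- 2 * c * M) * (16 * B)" by (simp add: A2)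
        also have "\<dots> \<le> ?K"
        proof (intro mult_left_mono)
          have "0 \<le> 4608 * c * C * B * M" using c C B M by (intro mult_nonneg_nonneg) auto
          then show "16 * B \<le> 448 * B + 4608 * c * C * B * M" using B by linarith
        qed auto
        finally show ?thesis .
      qed
      finally show "energy F \<le> ennreal ?K"
        by (simp add: ennreal_leI)
      fix t :: real assume t: "0 < t" "t \<le> 2"
      define T where "T = A\<^sup>2 * L\<^sup>2 * t powr (2 * s)"
      have T: "0 \<le> T" by (simp add: T_def)
      \<comment> \<open>One integrand covers both zones: 56 dominates the 4 of the far zone, and the
        kernel term is simply added in the near zone.\<close>
      have "energy (\<lambda>z. F (z * cis t) - F z)
        \<le> (\<integral>\<^sup>+z. ennreal (56 * T) + ennreal (4608 * c * T) * kernel_mass \<epsilon> E J z \<partial>arc_length)"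
      proof (intro nn_integral_mono)
        fix z assume "z \<in> space arc_length"
        then have z: "z \<in> unit_circle" by simp
        show "ennreal ((norm (F (z * cis t) - F z))\<^sup>2) \<le> ennreal (56 * T) + ennreal (4608 * c * T) * kernel_mass \<epsilon> E J z"
        proof (cases "?d z < 6 * t")
          case True
          have "ennreal ((norm (F (z * cis t) - F z))\<^sup>2) \<le> ennreal (56 * T)"
            using near[OF z t True] by (intro ennreal_leI) (simp add: T_def mult_ac)
          then show ?thesis by (rule order_trans) simp
        next
          case False
          let ?X = "?d z powr (1 + \<epsilon>) * norm (?U (z * cis t) - ?U z)"
          define D where "D = 64 * (A\<^sup>2 * L\<^sup>2) * c * t powr (2 * s - 1)"
          have D: "0 \<le> D" using c by (simp add: D_def)
          have "ennreal ((norm (F (z * cis t) - F z))\<^sup>2) \<le> ennreal (4 * T + D * ?X)"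
            using far[OF z t] False by (intro ennreal_leI) (simp add: T_def D_def mult_ac)
          also have "\<dots> = ennreal (4 * T) + ennreal D * ennreal ?X" using T D by (simp add: ennreal_mult)
          also have "\<dots> \<le> ennreal (56 * T) + ennreal D * (ennreal (72 * t) * kernel_mass \<epsilon> E J z)"
          proof (intro add_mono mult_left_mono ennreal_leI)
            show "ennreal ?X \<le> ennreal (72 * t) * kernel_mass \<epsilon> E J z"
              using False t norm_mult_cis_diff_le[OF z, of t] z \<epsilon>
              by (intro herglotz_sum_diff_le) (auto simp: norm_mult)
          qed (use T in auto)
          also have "ennreal D * (ennreal (72 * t) * kernel_mass \<epsilon> E J z) = ennreal (D * (72 * t)) * kernel_mass \<epsilon> E J z"
            using D t by (subst ennreal_mult) (auto simp: mult.assoc)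
          also have "D * (72 * t) = 4608 * c * T"
            using t powr_add[of t "2 * s - 1" 1] by (simp add: D_def T_def)
          finally show ?thesis .
        qed
      qed
      also have "\<dots> = (\<integral>\<^sup>+z. ennreal (56 * T) \<partial>arc_length) + ennreal (4608 * c * T) * (\<integral>\<^sup>+z. kernel_mass \<epsilon> E J z \<partial>arc_length)"
        by (subst nn_integral_add) (auto intro!: borel_measurable_times_ennreal simp: nn_integral_cmult)
      also have "\<dots> \<le> ennreal (8 * (56 * T)) + ennreal (4608 * c * T) * ennreal (C * M)"
      proof (intro add_mono mult_left_mono)
        show "(\<integral>\<^sup>+z. ennreal (56 * T) \<partial>arc_length) \<le> ennreal (8 * (56 * T))"
          using T by (intro nn_integral_le_const_circle) auto
        show "(\<integral>\<^sup>+z. kernel_mass \<epsilon> E J z \<partial>arc_length) \<le> ennreal (C * M)"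
          unfolding M_def using C by (intro nn_integral_kernel_mass) auto
      qed auto
      also have "\<dots> = ennreal (448 * T + 4608 * c * T * (C * M))"
        using T c C M by (simp add: ennreal_mult[symmetric] ennreal_plus[symmetric] del: ennreal_plus)
      also have "448 * T + 4608 * c * T * (C * M) = ?K * t powr (2 * s)"
        by (simp only: T_def A2) (simp add: algebra_simps)
      finally show "energy (\<lambda>z. F (z * cis t) - F z) \<le> ennreal (?K * t powr (2 * s))" .
    qed
    then show "besov_le s (exp (- 2 * c * nbhd_mass E J) * (448 * B + 4608 * c * C * B * nbhd_mass E J))
       (\<lambda>z. exp (of_real c * (herglotz_sum E J z - of_real (nbhd_mass E J))) * f z)"
      by (simp add: F_def[abs_def] g_def[abs_def] V_def M_def)
  qed
qed

section \<open>Approximation by analytic multiples\<close>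

definition holder_le :: "real \<Rightarrow> real \<Rightarrow> (complex \<Rightarrow> complex) \<Rightarrow> bool" where
  "holder_le s \<kappa> F \<longleftrightarrow> 0 \<le> \<kappa> \<and> (\<forall>z\<in>unit_circle. norm (F z) \<le> \<kappa>) \<and>
     (\<forall>z\<in>unit_circle. \<forall>w\<in>unit_circle. norm (F z - F w) \<le> \<kappa> * norm (z - w) powr s)"

lemma holder_leI:
  assumes "0 \<le> \<kappa>" "\<And>z. z \<in> unit_circle \<Longrightarrow> norm (F z) \<le> \<kappa>"
    "\<And>z w. z \<in> unit_circle \<Longrightarrow> w \<in> unit_circle \<Longrightarrow> norm (F z - F w) \<le> \<kappa> * norm (z - w) powr s"
  shows "holder_le s \<kappa> F"
  using assms by (simp add: holder_le_def)

lemma holder_leD: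
  assumes "holder_le s \<kappa> F"
  shows "0 \<le> \<kappa>" "\<And>z. z \<in> unit_circle \<Longrightarrow> norm (F z) \<le> \<kappa>"
    "\<And>z w. z \<in> unit_circle \<Longrightarrow> w \<in> unit_circle \<Longrightarrow> norm (F z - F w) \<le> \<kappa> * norm (z - w) powr s"
  using assms by (auto simp: holder_le_def)

lemma holder_imp_besov_le: "0 < s \<Longrightarrow> holder_le s \<kappa> F \<Longrightarrow> besov_le s (8 * \<kappa>\<^sup>2) F"
  by (intro besov_le_holder) (auto dest: holder_leD)

lemma holder_le_continuous_on: "0 < s \<Longrightarrow> holder_le s \<kappa> F \<Longrightarrow> continuous_on unit_circle F"
  using holder_continuous_on[of s unit_circle F \<kappa>] holder_leD by blast

lemma norm_circle_diff_le_2: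
  fixes z w :: complex
  shows "z \<in> unit_circle \<Longrightarrow> w \<in> unit_circle \<Longrightarrow> norm (z - w) \<le> 2"
  using norm_triangle_ineq4[of z w] by simp

lemma powr_circle_exponent_le:
  assumes "z \<in> unit_circle" "w \<in> unit_circle" "s \<le> \<delta>" "\<delta> \<le> s + 1"
  shows "norm (z - w) powr \<delta> \<le> 2 * norm (z - w) powr s"
proof -
  have "norm (z - w) powr (\<delta> - s) \<le> 2 powr (\<delta> - s)"
    using assms norm_circle_diff_le_2 by (intro powr_mono2) auto
  also have "\<dots> \<le> 2 powr 1" using assms by (intro powr_mono) auto
  finally have "norm (z - w) powr (\<delta> - s) * norm (z - w) powr s \<le> 2 * norm (z - w) powr s"
    by (intro mult_right_mono) auto
  then show ?thesis by (simp add: powr_add[symmetric])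
qed

lemma holder_le_exponent:
  assumes F: "holder_le \<delta> \<kappa> F" and "s \<le> \<delta>" "\<delta> \<le> s + 1"
  shows "holder_le s (2 * \<kappa>) F"
proof (rule holder_leI)
  note h = holder_leD[OF F]
  show "0 \<le> 2 * \<kappa>" using h(1) by simp
  show "norm (F z) \<le> 2 * \<kappa>" if "z \<in> unit_circle" for z using h(1) h(2)[OF that] by simp
  fix z w :: complex assume zw: "z \<in> unit_circle" "w \<in> unit_circle"
  have "norm (F z - F w) \<le> \<kappa> * norm (z - w) powr \<delta>" by (rule h(3)[OF zw])
  also have "\<dots> \<le> \<kappa> * (2 * norm (z - w) powr s)"
    using powr_circle_exponent_le[OF zw assms(2,3)] h(1) by (intro mult_left_mono)
  finally show "norm (F z - F w) \<le> 2 * \<kappa> * norm (z - w) powr s" by simp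
qed

lemma holder_le_mult:
  assumes F: "holder_le s a F" and G: "holder_le s b G"
  shows "holder_le s (2 * a * b) (\<lambda>z. F z * G z)"
proof (rule holder_leI)
  note f = holder_leD[OF F] and g = holder_leD[OF G]
  show "0 \<le> 2 * a * b" using f(1) g(1) by simp
  fix z :: complex assume z: "z \<in> unit_circle"
  have "norm (F z * G z) \<le> a * b" unfolding norm_mult using f g z by (intro mult_mono) auto
  then show "norm (F z * G z) \<le> 2 * a * b" using mult_nonneg_nonneg[OF f(1) g(1)] by simp
next
  note f = holder_leD[OF F] and g = holder_leD[OF G]
  fix z w :: complex assume zw: "z \<in> unit_circle" "w \<in> unit_circle"
  have "F z * G z - F w * G w = (F z - F w) * G z + F w * (G z - G w)" by (simp add: algebra_simps)
  then have "norm (F z * G z - F w * G w) \<le> norm (F z - F w) * norm (G z) + norm (F w) * norm (G z - G w)"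
    by (metis norm_mult norm_triangle_ineq)
  also have "\<dots> \<le> (a * norm (z - w) powr s) * b + a * (b * norm (z - w) powr s)"
    using f g zw by (intro add_mono mult_mono) auto
  finally show "norm (F z * G z - F w * G w) \<le> 2 * a * b * norm (z - w) powr s" by simp
qed

lemma holder_le_add:
  assumes F: "holder_le s a F" and G: "holder_le s b G"
  shows "holder_le s (a + b) (\<lambda>z. F z + G z)"
proof (rule holder_leI)
  note f = holder_leD[OF F] and g = holder_leD[OF G]
  show "0 \<le> a + b" using f(1) g(1) by simp
  show "norm (F z + G z) \<le> a + b" if "z \<in> unit_circle" for z
    using norm_triangle_ineq[of "F z" "G z"] f(2)[OF that] g(2)[OF that] by linarith
  fix z w :: complex assume zw: "z \<in> unit_circle" "w \<in> unit_circle"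
  have "norm (F z + G z - (F w + G w)) \<le> norm (F z - F w) + norm (G z - G w)"
    using norm_triangle_ineq[of "F z - F w" "G z - G w"] by (simp add: algebra_simps)
  then show "norm (F z + G z - (F w + G w)) \<le> (a + b) * norm (z - w) powr s"
    using f(3)[OF zw] g(3)[OF zw] by (simp add: algebra_simps)
qed

lemma holder_le_const: "holder_le s (norm c) (\<lambda>z. c)"
  by (rule holder_leI) auto

lemma holder_le_lipschitz:
  assumes "0 \<le> \<kappa>" "\<And>z. z \<in> unit_circle \<Longrightarrow> norm (F z) \<le> \<kappa>" "0 \<le> s" "s \<le> 1"
    and "\<And>z w. z \<in> unit_circle \<Longrightarrow> w \<in> unit_circle \<Longrightarrow> norm (F z - F w) \<le> \<kappa> * norm (z - w)"
  shows "holder_le s (2 * \<kappa>) F"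
proof (rule holder_le_exponent[where \<delta> = 1])
  show "holder_le 1 \<kappa> F" using assms by (intro holder_leI) (auto simp: powr_one')
qed (use assms in auto)

text \<open>Inversion preserves distances on the circle, which reduces negative exponents to
  positive ones.\<close>

lemma norm_powi_diff_le:
  fixes z w :: complex
  assumes "z \<in> unit_circle" "w \<in> unit_circle"
  shows "norm (z powi n - w powi n) \<le> \<bar>of_int n\<bar> * norm (z - w)"
proof (cases "n \<ge> 0")
  case True
  then have "z powi n = z ^ nat n" "w powi n = w ^ nat n" by (simp_all add: power_int_def)
  then show ?thesis using norm_power_diff[of z w "nat n"] assms True by simp
next
  case False
  have "norm (inverse z ^ nat (-n) - inverse w ^ nat (-n)) \<le> nat (-n) * norm (inverse z - inverse w)"
    using assms by (intro norm_power_diff) (auto simp: norm_inverse)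
  also have "norm (inverse z - inverse w) = norm (z - w)"
  proof -
    have nz: "z \<noteq> 0" "w \<noteq> 0" using assms by auto
    then have "inverse z - inverse w = (w - z) / (z * w)" by (simp add: field_simps)
    then show ?thesis using assms by (simp add: norm_divide norm_mult norm_minus_commute)
  qed
  finally show ?thesis using False by (simp add: power_int_def)
qed

lemma holder_le_powi:
  assumes "0 \<le> s" "s \<le> 1"
  obtains \<kappa> where "holder_le s \<kappa> (\<lambda>z. z powi n)"
proof
  show "holder_le s (2 * (1 + \<bar>of_int n\<bar>)) (\<lambda>z. z powi n)"
  proof (rule holder_le_lipschitz)
    fix z w :: complex assume zw: "z \<in> unit_circle" "w \<in> unit_circle"
    have "norm (z powi n - w powi n) \<le> \<bar>of_int n\<bar> * norm (z - w)" by (rule norm_powi_diff_le[OF zw])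
    also have "\<dots> \<le> (1 + \<bar>of_int n\<bar>) * norm (z - w)" by (intro mult_right_mono) auto
    finally show "norm (z powi n - w powi n) \<le> (1 + \<bar>of_int n\<bar>) * norm (z - w)" .
  qed (use assms in \<open>auto simp: norm_power_int\<close>)
qed

lemma holder_le_sum:
  assumes "finite I" "\<And>i. i \<in> I \<Longrightarrow> \<exists>\<kappa>. holder_le s \<kappa> (F i)"
  shows "\<exists>\<kappa>. holder_le s \<kappa> (\<lambda>z. \<Sum>i\<in>I. F i z)"
  using assms
proof (induction I)
  case empty
  then show ?case using holder_le_const[of s 0] by auto
next
  case (insert x I)
  then show ?case using holder_le_add by (fastforce simp: insert)
qed

lemma holder_le_trig:
  assumes "0 \<le> s" "s \<le> 1" "finite I"
  shows "\<exists>\<kappa>. holder_le s \<kappa> (\<lambda>z. \<Sum>n\<in>I. c n * z powi n)"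
proof (rule holder_le_sum[OF assms(3)])
  fix n
  obtain \<kappa> where "holder_le s \<kappa> (\<lambda>z. z powi n)" using holder_le_powi[OF assms(1,2)] .
  from holder_le_mult[OF holder_le_const this] show "\<exists>\<kappa>. holder_le s \<kappa> (\<lambda>z. c n * z powi n)" by blast
qed

lemma holder_le_poly:
  assumes "0 \<le> s" "s \<le> 1"
  shows "\<exists>\<kappa>. holder_le s \<kappa> (poly P)"
proof (induction P)
  case 0
  then show ?case using holder_le_const[of s 0] by (auto simp: poly_0[abs_def])
next
  case (pCons a P)
  then obtain \<kappa> where "holder_le s \<kappa> (poly P)" by blast
  moreover obtain \<kappa>' where "holder_le s \<kappa>' (\<lambda>z. z powi 1)" using holder_le_powi[OF assms] .
  ultimately have "holder_le s (norm a + 2 * \<kappa>' * \<kappa>) (\<lambda>z. a + z powi 1 * poly P z)"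
    by (intro holder_le_add holder_le_const holder_le_mult)
  then show ?case by (auto simp: fun_eq_iff cong: holder_le_def)
qed

text \<open>The bound of \<open>outer_besov\<close> tends to 0 as the mass grows, so one fixed
  number of scales \<open>J\<close> suffices, after which the multiplier is replaced by a Taylor
  polynomial. The value 1 at 0 arises because \<open>herglotz_sum\<close> at 0 is the very mass that
  is subtracted.\<close>

lemma outer_polynomial_small:
  fixes f :: "complex \<Rightarrow> complex"
  assumes s: "0 < s" "s < \<delta>" "\<delta> \<le> 1 / 2"
    and E: "closed E" "E \<noteq> {}" "E \<subseteq> unit_circle"
    and f: "holder_le \<delta> L f" and f0: "\<And>z. z \<in> E \<Longrightarrow> f z = 0"
    and mass: "filterlim (nbhd_mass E) at_top sequentially" and \<epsilon>: "0 < \<epsilon>"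
  obtains P where "poly P 0 = 1" "besov_le s \<epsilon> (\<lambda>z. poly P z * f z)"
proof -
  note h = holder_leD[OF f]
  have f': "norm (f z - f w) \<le> (L + 1) * norm (z - w) powr \<delta>" if "z \<in> unit_circle" "w \<in> unit_circle" for z w
    using h(3)[OF that] by (rule order_trans) (intro mult_right_mono, auto)
  have L1: "0 < L + 1" using h(1) by simp
  obtain c \<alpha> \<gamma> where c: "0 < c" "0 \<le> \<alpha>" "0 \<le> \<gamma>" and bes:
    "\<And>J. besov_le s (exp (- 2 * c * nbhd_mass E J) * (\<alpha> + \<gamma> * nbhd_mass E J))
       (\<lambda>z. exp (of_real c * (herglotz_sum E J z - of_real (nbhd_mass E J))) * f z)"
    using outer_besov[OF s E L1 f' f0] by blast
  \<comment> \<open>The bound is rewritten in \<open>x = 2 c M\<close>, so that its terms become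
    powers of \<open>x\<close> over \<open>exp x\<close>.\<close>
  have "((\<lambda>x. \<alpha> * (x ^ 0 / exp x) + \<gamma> / (2 * c) * (x ^ 1 / exp x)) \<longlongrightarrow> \<alpha> * 0 + \<gamma> / (2 * c) * 0) at_top"
    by (intro tendsto_intros tendsto_power_div_exp_0)
  then have lim: "((\<lambda>x. \<alpha> * (x ^ 0 / exp x) + \<gamma> / (2 * c) * (x ^ 1 / exp x)) \<longlongrightarrow> 0) at_top" by simp
  have "filterlim (\<lambda>J. 2 * c * nbhd_mass E J) at_top sequentially"
    using c by (intro filterlim_tendsto_pos_mult_at_top[OF tendsto_const _ mass]) auto
  from filterlim_compose[OF lim this] have lim':
    "(\<lambda>J. \<alpha> * ((2 * c * nbhd_mass E J) ^ 0 / exp (2 * c * nbhd_mass E J))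
        + \<gamma> / (2 * c) * ((2 * c * nbhd_mass E J) ^ 1 / exp (2 * c * nbhd_mass E J))) \<longlonglongrightarrow> 0" .
  have eq: "\<alpha> * ((2 * c * M) ^ 0 / exp (2 * c * M)) + \<gamma> / (2 * c) * ((2 * c * M) ^ 1 / exp (2 * c * M))
      = exp (- 2 * c * M) * (\<alpha> + \<gamma> * M)" for M
    using c by (simp add: exp_minus field_simps)
  have "eventually (\<lambda>J. exp (- 2 * c * nbhd_mass E J) * (\<alpha> + \<gamma> * nbhd_mass E J) < \<epsilon> / 4) sequentially"
    using order_tendstoD(2)[OF lim'[unfolded eq], of "\<epsilon> / 4"] \<epsilon> by simp
  then obtain J where J: "exp (- 2 * c * nbhd_mass E J) * (\<alpha> + \<gamma> * nbhd_mass E J) < \<epsilon> / 4"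
    using eventually_happens'[OF sequentially_bot] by blast
  define g where "g z = exp (of_real c * (herglotz_sum E J z - of_real (nbhd_mass E J)))" for z
  have b1: "besov_le s (\<epsilon> / 4) (\<lambda>z. g z * f z)"
    unfolding g_def by (rule besov_le_mono[OF bes]) (use J in simp)
  obtain R where R: "1 < R" "herglotz_sum E J holomorphic_on ball 0 R" using holomorphic_herglotz_sum by blast
  have g: "g holomorphic_on ball 0 R" unfolding g_def[abs_def] by (intro holomorphic_intros R)
  have g0: "g 0 = 1" by (simp add: g_def herglotz_sum_0)
  \<comment> \<open>Chosen so that \<open>8 (8 \<kappa> L)^2\<close>, the constant for the Taylor
    error times \<open>f\<close>, is at most \<open>\<epsilon> / 4\<close>; \<open>L + 1\<close> in
    place of \<open>L\<close> avoids division by 0.\<close>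
  define \<kappa> where "\<kappa> = sqrt (\<epsilon> / 32) / (8 * (L + 1))"
  have \<kappa>: "0 < \<kappa>" using \<epsilon> h(1) by (simp add: \<kappa>_def)
  obtain P where P: "poly P 0 = g 0"
    "\<And>z. z \<in> unit_circle \<Longrightarrow> norm (g z - poly P z) \<le> \<kappa>"
    "\<And>z w. z \<in> unit_circle \<Longrightarrow> w \<in> unit_circle \<Longrightarrow>
       norm ((g z - poly P z) - (g w - poly P w)) \<le> \<kappa> * norm (z - w)"
    using holomorphic_approx_polynomial[OF g R(1) \<kappa>] by blast
  have "holder_le s (2 * \<kappa>) (\<lambda>z. poly P z - g z)"
  proof (rule holder_le_lipschitz)
    fix z w :: complex assume zw: "z \<in> unit_circle" "w \<in> unit_circle"
    show "norm (poly P z - g z) \<le> \<kappa>" using P(2)[OF zw(1)] by (simp add: norm_minus_commute)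
    have "poly P z - g z - (poly P w - g w) = - ((g z - poly P z) - (g w - poly P w))" by simp
    then show "norm (poly P z - g z - (poly P w - g w)) \<le> \<kappa> * norm (z - w)" using P(3)[OF zw] by (metis norm_minus_cancel)
  qed (use \<kappa> s in auto)
  moreover have "holder_le s (2 * L) f" using holder_le_exponent[OF f] s by simp
  ultimately have "holder_le s (2 * (2 * \<kappa>) * (2 * L)) (\<lambda>z. (poly P z - g z) * f z)" by (rule holder_le_mult)
  from holder_imp_besov_le[OF s(1) this]
  have "besov_le s (8 * (8 * \<kappa> * L)\<^sup>2) (\<lambda>z. (poly P z - g z) * f z)" by (simp add: mult_ac)
  moreover have "8 * (8 * \<kappa> * L)\<^sup>2 \<le> \<epsilon> / 4"
  proof -
    have "8 * \<kappa> * L \<le> 8 * \<kappa> * (L + 1)" using \<kappa> by simp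
    also have "\<dots> = sqrt (\<epsilon> / 32)" using h(1) by (simp add: \<kappa>_def field_simps)
    finally have "(8 * \<kappa> * L)\<^sup>2 \<le> (sqrt (\<epsilon> / 32))\<^sup>2" using \<kappa> h(1) by (intro power_mono) auto
    then show ?thesis using \<epsilon> by simp
  qed
  ultimately have b2: "besov_le s (\<epsilon> / 4) (\<lambda>z. (poly P z - g z) * f z)" by (rule besov_le_mono)
  from besov_le_add[OF b1 b2] have "besov_le s \<epsilon> (\<lambda>z. g z * f z + (poly P z - g z) * f z)" by simp
  moreover have "(\<lambda>z. g z * f z + (poly P z - g z) * f z) = (\<lambda>z. poly P z * f z)" by (simp add: algebra_simps)
  ultimately show ?thesis using that P(1) g0 by simp
qed

lemma besov_le_zero: "0 \<le> K \<Longrightarrow> besov_le s K (\<lambda>z. 0)"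
  by (simp add: besov_le_def)

lemma besov_le_cong:
  assumes "\<And>z. z \<in> unit_circle \<Longrightarrow> F z = G z" "besov_le s K F"
  shows "besov_le s K G"
proof -
  have 1: "energy G = energy F"
    using assms by (intro nn_integral_cong) auto
  have 2: "energy (\<lambda>z. G (z * cis t) - G z)
    = energy (\<lambda>z. F (z * cis t) - F z)" for t
    using assms by (intro nn_integral_cong) (auto simp: norm_mult)
  have 3: "continuous_on unit_circle G \<longleftrightarrow> continuous_on unit_circle F"
    using assms by (intro continuous_on_cong) auto
  show ?thesis using assms(2) unfolding besov_le_def 1 2 3 .
qed

text \<open>If \<open>P(0) = 1\<close> and \<open>P z\<^sup>-\<^sup>m\<^sup>-\<^sup>1 A f\<close> is small, then \<open>z\<^sup>-\<^sup>m\<^sup>-\<^sup>1 A f\<close> is close to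
  \<open>z\<^sup>-\<^sup>m\<^sup>-\<^sup>1 A (1 - P) f\<close>, in which a factor \<open>z\<close> cancels.\<close>

lemma analytic_approximation:
  fixes f :: "complex \<Rightarrow> complex"
  assumes s: "0 < s" "s < \<delta>" "\<delta> \<le> 1 / 2"
    and E: "closed E" "E \<noteq> {}" "E \<subseteq> unit_circle"
    and f: "holder_le \<delta> L f" and f0: "\<And>z. z \<in> E \<Longrightarrow> f z = 0"
    and mass: "filterlim (nbhd_mass E) at_top sequentially" and \<epsilon>: "0 < \<epsilon>"
  shows "\<exists>R. besov_le s \<epsilon> (\<lambda>z. (z powi (- int m) * poly A z - poly R z) * f z)"
  using \<epsilon>
proof (induction m arbitrary: A \<epsilon>)
  case 0
  then show ?case by (intro exI[of _ A]) (simp add: besov_le_zero)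
next
  case (Suc m)
  \<comment> \<open>The small multiplier is built for \<open>f1\<close>, which already contains the
    negative power and \<open>A\<close>: it is again Hoelder and vanishes on \<open>E\<close>, and
    the smallness then needs no further multiplication.\<close>
  define f1 where "f1 z = z powi (- int (Suc m)) * poly A z * f z" for z
  obtain \<kappa>1 where k1: "holder_le \<delta> \<kappa>1 (\<lambda>z. z powi (- int (Suc m)))" using holder_le_powi[of \<delta>] s by auto
  obtain \<kappa>2 where k2: "holder_le \<delta> \<kappa>2 (poly A)" using holder_le_poly[of \<delta> A] s by auto
  have "holder_le \<delta> (2 * (2 * \<kappa>1 * \<kappa>2) * L) f1"
    unfolding f1_def[abs_def] by (intro holder_le_mult k1 k2 f)
  then obtain P where P: "poly P 0 = 1" "besov_le s (\<epsilon> / 4) (\<lambda>z. poly P z * f1 z)"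
    using outer_polynomial_small[OF s E _ _ mass, of _ f1 "\<epsilon> / 4"] f0 Suc.prems by (auto simp: f1_def)
  have "poly (1 - P) 0 = 0" using P by simp
  \<comment> \<open>The factor \<open>z\<close> extracted here raises the power
    \<open>- Suc m\<close> to \<open>- m\<close>, and the cofactor \<open>Q\<close> joins
    \<open>A\<close>; this is why \<open>A\<close> is arbitrary in the induction.\<close>
  then obtain Q where Q: "1 - P = [:0, 1:] * Q" using poly_eq_0_iff_dvd[of "1 - P" 0] by (auto simp: dvd_def)
  obtain R where R: "besov_le s (\<epsilon> / 4) (\<lambda>z. (z powi (- int m) * poly (A * Q) z - poly R z) * f z)"
    using Suc.IH[of "\<epsilon> / 4" "A * Q"] Suc.prems by auto
  from besov_le_add[OF P(2) R]
  have "besov_le s \<epsilon> (\<lambda>z. poly P z * f1 z + (z powi (- int m) * poly (A * Q) z - poly R z) * f z)" by simp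
  then have "besov_le s \<epsilon> (\<lambda>z. (z powi (- int (Suc m)) * poly A z - poly R z) * f z)"
  proof (rule besov_le_cong[rotated])
    fix z :: complex assume "z \<in> unit_circle"
    then have nz: "z \<noteq> 0" by auto
    have "1 - poly P z = z * poly Q z" using arg_cong[OF Q, of "\<lambda>p. poly p z"] by simp
    then have "z powi (- int m) * poly Q z = z powi (- int (Suc m)) * (1 - poly P z)"
    proof -
      have "z powi (- int (Suc m) + 1) = z powi (- int (Suc m)) * z" using nz by (intro power_int_add_1) auto
      then have "z powi (- int m) = z powi (- int (Suc m)) * z" by simp
      with \<open>1 - poly P z = z * poly Q z\<close> show ?thesis by (simp only: mult.assoc)
    qed
    then have "z powi (- int m) * poly (A * Q) z = z powi (- int (Suc m)) * (1 - poly P z) * poly A z"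
      by (simp add: mult_ac)
    then show "poly P z * f1 z + (z powi (- int m) * poly (A * Q) z - poly R z) * f z
        = (z powi (- int (Suc m)) * poly A z - poly R z) * f z"
      by (simp only:) (simp add: f1_def algebra_simps)
  qed
  then show ?case by blast
qed

section \<open>From the divergent logarithmic integral to divergent mass\<close>

lemma ext_dist_eq_infdist:
  assumes "E \<noteq> {}"
  shows "ext_dist z E = ereal (infdist z E)"
proof -
  have "ext_dist z E = (INF a\<in>dist z ` E. ereal a)" by (simp add: ext_dist_def image_comp)
  also have "\<dots> = ereal (Inf (dist z ` E))"
    by (rule ereal_Inf'[symmetric]) (use assms in \<open>auto intro!: bdd_belowI[of _ 0]\<close>)
  finally show ?thesis using assms by (simp add: infdist_notempty)
qed

text \<open>A point with \<open>1 / 2 ^ Suc i < d \<le> 1 / 2 ^ i\<close> lies in the first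
  \<open>Suc i\<close> neighbourhoods, while \<open>ln (1 / d) \<le> Suc i * ln 2\<close>; so the
  negative part of the integral is at most \<open>ln 2\<close> times the total mass. Nullity of
  \<open>E\<close> makes \<open>d\<close> positive almost everywhere. An empty \<open>E\<close>
  would give the logarithm the value \<infinity> and no negative part.\<close>

lemma nbhd_mass_at_top:
  assumes closed: "closed E" and null: "E \<in> null_sets arc_length"
    and int: "ext_integral arc_length (\<lambda>z. ext_ln (ext_dist z E)) = -\<infinity>"
  shows "E \<noteq> {}" "filterlim (nbhd_mass E) at_top sequentially"
proof -
  let ?N = "\<integral>\<^sup>+z. e2ennreal (- ext_ln (ext_dist z E)) \<partial>arc_length"
  have N: "?N = \<infinity>"
  proof (rule ccontr)
    assume "?N \<noteq> \<infinity>"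
    then obtain r where r: "?N = ennreal r" "r \<ge> 0" by (cases ?N) auto
    \<comment> \<open>A finite negative part never produces \<open>-\<infinity>\<close>, whatever
      the positive part is.\<close>
    have "enn2ereal x - enn2ereal (ennreal r) \<noteq> -\<infinity>" for x
      using r(2) by (cases x) (auto simp: enn2ereal_ennreal)
    then show False using int r by (simp add: ext_integral_def)
  qed
  show ne: "E \<noteq> {}"
  proof
    assume "E = {}"
    then have "ext_ln (ext_dist z E) = \<infinity>" for z by (simp add: ext_dist_def ext_ln_def top_ereal_def)
    then have "?N = 0" by (simp add: e2ennreal_neg)
    with N show False by simp
  qed
  let ?A = "\<lambda>j. circle_nbhd E (1 / 2 ^ j)"
  have "?N \<le> (\<integral>\<^sup>+z. (\<Sum>j. ennreal (ln 2) * indicator (?A j) z) \<partial>arc_length)"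
  proof (rule nn_integral_mono_AE)
    show "AE z in arc_length. e2ennreal (- ext_ln (ext_dist z E)) \<le> (\<Sum>j. ennreal (ln 2) * indicator (?A j) z)"
      using AE_not_in[OF null] AE_space
    proof eventually_elim
      case (elim z)
      then have z: "z \<in> unit_circle" by simp
      have d: "0 < infdist z E"
        using elim(1) in_closed_iff_infdist_zero[OF closed ne, of z] infdist_nonneg[of z E] by auto
      then have eq: "e2ennreal (- ext_ln (ext_dist z E)) = ennreal (- ln (infdist z E))"
        by (simp add: ext_dist_eq_infdist[OF ne] ext_ln_def)
      show ?case
      proof (cases "infdist z E \<le> 1")
        case False
        then have "- ln (infdist z E) \<le> 0" by simp
        then show ?thesis unfolding eq by (simp add: ennreal_neg)
      next
        case True
        obtain i where i: "1 / 2 ^ Suc i < infdist z E" "infdist z E \<le> 1 / 2 ^ i"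
          using dyadic_bracket[OF d True] .
        have "ln (1 / infdist z E) \<le> ln (2 ^ Suc i)" using i d by (intro ln_mono) (auto simp: field_simps)
        also have "\<dots> = real (Suc i) * ln 2" by (rule ln_realpow)
        finally have "- ln (infdist z E) \<le> real (Suc i) * ln 2" using d by (simp add: ln_div)
        then have "ennreal (- ln (infdist z E)) \<le> ennreal (real (Suc i) * ln 2)" by (rule ennreal_leI)
        also have "\<dots> = (\<Sum>j<Suc i. ennreal (ln 2))" by (subst sum_ennreal) auto
        also have "\<dots> = (\<Sum>j<Suc i. ennreal (ln 2) * indicator (?A j) z)"
        proof (intro sum.cong refl)
          fix j assume "j \<in> {..<Suc i}"
          then have "1 / 2 ^ i \<le> (1 / 2 ^ j :: real)" by (intro divide_left_mono power_increasing) auto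
          then have "z \<in> ?A j" using i z by (simp add: circle_nbhd_def)
          then show "ennreal (ln 2) = ennreal (ln 2) * indicator (?A j) z" by simp
        qed
        also have "\<dots> \<le> (\<Sum>j. ennreal (ln 2) * indicator (?A j) z)" by (rule sum_le_suminf) auto
        finally show ?thesis unfolding eq .
      qed
    qed
  qed
  also have "\<dots> = (\<Sum>j. \<integral>\<^sup>+z. ennreal (ln 2) * indicator (?A j) z \<partial>arc_length)"
    by (intro nn_integral_suminf borel_measurable_times_ennreal borel_measurable_indicator sets_circle_nbhd) auto
  also have "\<dots> = (\<Sum>j. ennreal (ln 2 * measure arc_length (?A j)))"
  proof (intro suminf_cong)
    fix j
    have "(\<integral>\<^sup>+z. ennreal (ln 2) * indicator (?A j) z \<partial>arc_length) = ennreal (ln 2) * emeasure arc_length (?A j)"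
      by (intro nn_integral_cmult_indicator sets_circle_nbhd)
    then show "(\<integral>\<^sup>+z. ennreal (ln 2) * indicator (?A j) z \<partial>arc_length) = ennreal (ln 2 * measure arc_length (?A j))"
      by (simp add: arc_length.emeasure_eq_measure ennreal_mult)
  qed
  also have "\<dots> = (SUP J. \<Sum>j<J. ennreal (ln 2 * measure arc_length (?A j)))" by (rule suminf_eq_SUP)
  also have "(\<lambda>J. \<Sum>j<J. ennreal (ln 2 * measure arc_length (?A j))) = (\<lambda>J. ennreal (ln 2 * nbhd_mass E J))"
    by (intro ext, subst sum_ennreal) (auto simp: nbhd_mass_def sum_distrib_left)
  finally have sup: "(SUP J. ennreal (ln 2 * nbhd_mass E J)) = \<infinity>" using N by (simp add: top_unique)
  have mono: "nbhd_mass E i \<le> nbhd_mass E j" if "i \<le> j" for i j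
    unfolding nbhd_mass_def using that by (intro sum_mono2) auto
  show "filterlim (nbhd_mass E) at_top sequentially"
    unfolding filterlim_at_top
  proof
    fix Z
    have "\<exists>J. Z < nbhd_mass E J"
    proof (rule ccontr)
      assume "\<not> (\<exists>J. Z < nbhd_mass E J)"
      then have "(SUP J. ennreal (ln 2 * nbhd_mass E J)) \<le> ennreal (ln 2 * Z)"
        by (intro SUP_least ennreal_leI) (auto simp: not_less)
      then have "\<infinity> \<le> ennreal (ln 2 * Z)" unfolding sup .
      then show False by (simp add: top_unique)
    qed
    then obtain J where J: "Z < nbhd_mass E J" ..
    show "\<forall>\<^sub>F n in sequentially. Z \<le> nbhd_mass E n"
      using eventually_ge_at_top[of J]
    proof eventually_elim
      case (elim n)
      then show ?case using mono[of J n] J by linarith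
    qed
  qed
qed

section \<open>Fourier coefficients\<close>

definition circle_coeff :: "(complex \<Rightarrow> complex) \<Rightarrow> int \<Rightarrow> complex" where
  "circle_coeff F n = (\<integral>z. F z * z powi (- n) \<partial>arc_length) / (2 * pi)"

lemma continuous_on_powi_circle [continuous_intros]:
  "continuous_on unit_circle (\<lambda>z. z powi n)"
  by (intro continuous_intros) auto

text \<open>For \<open>n\<close> other than 0, rotation by the angle \<open>pi / n\<close>
  multiplies \<open>z powi n\<close> by -1, so the integral equals its own negative.\<close>

lemma integral_powi_circle: "(\<integral>z. z powi n \<partial>arc_length) = (if n = 0 then 2 * pi else 0)"
proof (cases "n = 0")
  case True
  have "measure arc_length unit_circle = 2 * pi" by (simp add: measure_def emeasure_arc_length_circle)
  then show ?thesis using True by (simp add: scaleR_conv_of_real)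
next
  case False
  let ?I = "\<integral>z. z powi n \<partial>arc_length"
  have "?I = (\<integral>z. (z * cis (pi / n)) powi n \<partial>arc_length)"
    by (rule integral_rotate[symmetric]) (intro continuous_measurable_arc_length continuous_intros)
  also have "\<dots> = (\<integral>z. z powi n * (- 1) \<partial>arc_length)"
    using False by (simp add: power_int_mult_distrib cis_power_int)
  also have "\<dots> = - ?I" by simp
  finally show ?thesis using False by simp
qed

lemma circle_coeff_diff:
  assumes "continuous_on unit_circle F" "continuous_on unit_circle G"
  shows "circle_coeff (\<lambda>z. F z - G z) n = circle_coeff F n - circle_coeff G n"
proof -
  have "(\<integral>z. (F z - G z) * z powi (- n) \<partial>arc_length) = (\<integral>z. F z * z powi (- n) - G z * z powi (- n) \<partial>arc_length)"
    by (simp add: left_diff_distrib)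
  also have "\<dots> = (\<integral>z. F z * z powi (- n) \<partial>arc_length) - (\<integral>z. G z * z powi (- n) \<partial>arc_length)"
    by (intro Bochner_Integration.integral_diff integrable_arc_length continuous_intros assms)
  finally show ?thesis by (simp add: circle_coeff_def diff_divide_distrib)
qed

lemma circle_coeff_rotate:
  assumes "continuous_on unit_circle F"
  shows "circle_coeff (\<lambda>z. F (z * cis t)) n = cis (of_int n * t) * circle_coeff F n"
proof -
  let ?G = "\<lambda>z. F z * (z powi (- n) * cis (of_int n * t))"
  have "(\<integral>z. F (z * cis t) * z powi (- n) \<partial>arc_length) = (\<integral>z. ?G (z * cis t) \<partial>arc_length)"
  proof (intro Bochner_Integration.integral_cong refl)
    fix z
    have "(z * cis t) powi (- n) * cis (of_int n * t) = z powi (- n)"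
      by (simp add: power_int_mult_distrib cis_power_int cis_mult)
    then show "F (z * cis t) * z powi (- n) = ?G (z * cis t)" by simp
  qed
  also have "\<dots> = (\<integral>z. ?G z \<partial>arc_length)"
    by (rule integral_rotate) (intro continuous_measurable_arc_length continuous_intros assms)
  also have "\<dots> = (\<integral>z. F z * z powi (- n) \<partial>arc_length) * cis (of_int n * t)"
    by (subst integral_mult_left_zero[symmetric]) (simp add: mult.assoc)
  finally show ?thesis by (simp add: circle_coeff_def)
qed

lemma circle_coeff_trig:
  assumes "finite A"
  shows "circle_coeff (\<lambda>z. \<Sum>m\<in>A. c m * z powi m) n = (if n \<in> A then c n else 0)"
proof -
  have "(\<integral>z. (\<Sum>m\<in>A. c m * z powi m) * z powi (- n) \<partial>arc_length)
      = (\<integral>z. (\<Sum>m\<in>A. c m * z powi (m - n)) \<partial>arc_length)"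
  proof (intro Bochner_Integration.integral_cong refl)
    fix z assume "z \<in> space arc_length"
    then have nz: "z \<noteq> 0" by auto
    show "(\<Sum>m\<in>A. c m * z powi m) * z powi (- n) = (\<Sum>m\<in>A. c m * z powi (m - n))"
      using nz power_int_add[of z _ "- n"] by (simp add: sum_distrib_right mult.assoc)
  qed
  also have "\<dots> = (\<Sum>m\<in>A. c m * (\<integral>z. z powi (m - n) \<partial>arc_length))"
    by (subst Bochner_Integration.integral_sum) (auto intro!: integrable_arc_length continuous_intros)
  also have "\<dots> = (\<Sum>m\<in>A. if m = n then c n * (2 * pi) else 0)"
    by (intro sum.cong refl) (simp add: integral_powi_circle)
  also have "\<dots> = (if n \<in> A then c n * (2 * pi) else 0)" using assms by simp
  finally show ?thesis by (simp add: circle_coeff_def)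
qed

lemma cnj_powi_circle:
  assumes "z \<in> unit_circle"
  shows "cnj z powi n = z powi (- n)"
proof -
  have "z * cnj z = 1" using assms complex_norm_square[of z] by simp
  then have "cnj z = inverse z" by (metis inverse_unique)
  then show ?thesis by (simp add: power_int_minus power_int_inverse)
qed

text \<open>Expansion of the integral of \<open>|F - T|^2\<close>, where \<open>T\<close> is the
  Fourier sum of \<open>F\<close> over \<open>A\<close>. The factor \<open>2 * pi\<close> in front
  of the coefficients is discarded, being at least 1.\<close>

lemma bessel_inequality:
  assumes F: "continuous_on unit_circle F" and A: "finite A"
  shows "ennreal (\<Sum>n\<in>A. (norm (circle_coeff F n))\<^sup>2) \<le> energy F"
proof -
  define a where "a = circle_coeff F"
  define T where "T z = (\<Sum>n\<in>A. a n * z powi n)" for z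
  define S where "S = (\<Sum>n\<in>A. (norm (a n))\<^sup>2)"
  have T: "continuous_on unit_circle T" unfolding T_def by (intro continuous_intros)
  have pair: "(\<integral>z. G z * cnj (T z) \<partial>arc_length) = (\<Sum>n\<in>A. cnj (a n) * (2 * pi * circle_coeff G n))"
    if G: "continuous_on unit_circle G" for G
  proof -
    have "(\<integral>z. G z * cnj (T z) \<partial>arc_length) = (\<integral>z. (\<Sum>n\<in>A. cnj (a n) * (G z * z powi (- n))) \<partial>arc_length)"
      by (intro Bochner_Integration.integral_cong refl)
         (simp add: T_def sum_distrib_left cnj_powi_circle mult_ac)
    also have "\<dots> = (\<Sum>n\<in>A. cnj (a n) * (\<integral>z. G z * z powi (- n) \<partial>arc_length))"
      by (subst Bochner_Integration.integral_sum) (auto intro!: integrable_arc_length continuous_intros G)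
    finally show ?thesis by (simp add: circle_coeff_def)
  qed
  have cnj_sq: "cnj (a n) * (2 * pi * a n) = of_real (2 * pi * (norm (a n))\<^sup>2)" for n
    using complex_norm_square[of "a n"] by (simp add: mult_ac)
  have FT: "(\<integral>z. F z * cnj (T z) \<partial>arc_length) = of_real (2 * pi * S)"
    by (simp only: pair[OF F] a_def[symmetric] cnj_sq S_def sum_distrib_left of_real_sum)
  have TT: "(\<integral>z. T z * cnj (T z) \<partial>arc_length) = of_real (2 * pi * S)"
  proof -
    have "circle_coeff T n = a n" if "n \<in> A" for n
      using that circle_coeff_trig[OF A, of a n] by (simp add: T_def[abs_def])
    then have "(\<integral>z. T z * cnj (T z) \<partial>arc_length) = (\<Sum>n\<in>A. cnj (a n) * (2 * pi * a n))"
      unfolding pair[OF T] by (intro sum.cong) auto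
    then show ?thesis by (simp only: cnj_sq S_def sum_distrib_left of_real_sum)
  qed
  have int: "integrable arc_length (\<lambda>z. F z * cnj (F z))" "integrable arc_length (\<lambda>z. F z * cnj (T z))"
    "integrable arc_length (\<lambda>z. cnj (F z * cnj (T z)))" "integrable arc_length (\<lambda>z. T z * cnj (T z))"
    by (intro integrable_arc_length continuous_intros F T)+
  have "of_real (\<integral>z. (norm (F z - T z))\<^sup>2 \<partial>arc_length) = (\<integral>z. (F z - T z) * cnj (F z - T z) \<partial>arc_length)"
    by (simp only: complex_norm_square integral_complex_of_real[symmetric])
  also have "\<dots> = (\<integral>z. (F z * cnj (F z) - F z * cnj (T z)) - (cnj (F z * cnj (T z)) - T z * cnj (T z)) \<partial>arc_length)"
    by (simp add: algebra_simps)
  also have "\<dots> = ((\<integral>z. F z * cnj (F z) \<partial>arc_length) - (\<integral>z. F z * cnj (T z) \<partial>arc_length))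
      - ((\<integral>z. cnj (F z * cnj (T z)) \<partial>arc_length) - (\<integral>z. T z * cnj (T z) \<partial>arc_length))"
    by (simp only: Bochner_Integration.integral_diff Bochner_Integration.integrable_diff int)
  also have "(\<integral>z. cnj (F z * cnj (T z)) \<partial>arc_length) = of_real (2 * pi * S)"
    using Bochner_Integration.integral_cnj[of arc_length "\<lambda>z. F z * cnj (T z)"] by (simp only: FT complex_cnj_complex_of_real)
  also have "(\<integral>z. F z * cnj (F z) \<partial>arc_length) = of_real (\<integral>z. (norm (F z))\<^sup>2 \<partial>arc_length)"
    by (simp only: complex_norm_square integral_complex_of_real[symmetric])
  finally have "of_real (\<integral>z. (norm (F z - T z))\<^sup>2 \<partial>arc_length) = (of_real ((\<integral>z. (norm (F z))\<^sup>2 \<partial>arc_length) - 2 * pi * S) :: complex)"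
    by (simp add: FT TT)
  then have "(\<integral>z. (norm (F z - T z))\<^sup>2 \<partial>arc_length) = (\<integral>z. (norm (F z))\<^sup>2 \<partial>arc_length) - 2 * pi * S"
    by (simp only: of_real_eq_iff)
  moreover have "0 \<le> (\<integral>z. (norm (F z - T z))\<^sup>2 \<partial>arc_length)" by simp
  ultimately have "2 * pi * S \<le> (\<integral>z. (norm (F z))\<^sup>2 \<partial>arc_length)" by linarith
  moreover have "1 * S \<le> 2 * pi * S"
    using pi_gt3 by (intro mult_right_mono) (auto simp: S_def sum_nonneg)
  ultimately have "S \<le> (\<integral>z. (norm (F z))\<^sup>2 \<partial>arc_length)" by linarith
  then have "ennreal S \<le> ennreal (\<integral>z. (norm (F z))\<^sup>2 \<partial>arc_length)" by (rule ennreal_leI)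
  also have "\<dots> = energy F"
    by (intro nn_integral_eq_integral[symmetric] integrable_arc_length continuous_intros F) auto
  finally show ?thesis by (simp add: S_def a_def)
qed

text \<open>For \<open>x > y\<close> one writes \<open>x powr p = x powr (p - 2) * x^2\<close>,
  where the exponent \<open>p - 2\<close> is not positive, so the first factor may be evaluated at
  \<open>y\<close>.\<close>

lemma powr_le_young:
  fixes x y p :: real
  assumes "0 \<le> x" "0 < y" "0 < p" "p \<le> 2"
  shows "x powr p \<le> y powr p + y powr (p - 2) * x\<^sup>2"
proof (cases "x \<le> y")
  case True
  then have "x powr p \<le> y powr p" using assms by (intro powr_mono2) auto
  then show ?thesis by (simp add: add_increasing2)
next
  case False
  then have x: "0 < x" "y \<le> x" using assms by auto
  have "x powr p = x powr (p - 2) * x powr 2" by (simp only: powr_add[symmetric]) simp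
  also have "x powr 2 = x\<^sup>2" using x by (simp add: powr_numeral)
  also have "x powr (p - 2) \<le> y powr (p - 2)" using x assms by (intro powr_mono2') auto
  finally have "x powr p \<le> y powr (p - 2) * x\<^sup>2" by (simp add: mult_right_mono)
  then show ?thesis by (simp add: add_increasing)
qed

section \<open>Dyadic blocks of frequencies\<close>

definition dyadic_block :: "nat \<Rightarrow> int set" where
  "dyadic_block i = {n. 2 ^ i \<le> \<bar>n\<bar> \<and> \<bar>n\<bar> < 2 ^ Suc i}"

lemma dyadic_block_subset: "dyadic_block i \<subseteq> {2 ^ i..<2 ^ Suc i} \<union> {- (2 ^ Suc i)<..- (2 ^ i)}"
  by (auto simp: dyadic_block_def)

lemma finite_dyadic_block: "finite (dyadic_block i)"
  using dyadic_block_subset by (rule finite_subset) auto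

lemma card_dyadic_block: "card (dyadic_block i) \<le> 2 * 2 ^ i"
proof -
  have "card (dyadic_block i) \<le> card ({2 ^ i..<2 ^ Suc i} \<union> {- (2 ^ Suc i)<..- (2 ^ i) :: int})"
    using dyadic_block_subset by (intro card_mono) auto
  also have "\<dots> \<le> card {2 ^ i..<2 ^ Suc i :: int} + card {- (2 ^ Suc i)<..- (2 ^ i) :: int}" by (rule card_Un_le)
  also have "\<dots> = 2 * 2 ^ i" by (simp add: nat_power_eq)
  finally show ?thesis .
qed

lemma sum_dyadic_blocks:
  fixes g :: "int \<Rightarrow> real"
  shows "(\<Sum>n\<in>{n. \<bar>n\<bar> < 2 ^ I}. g n) = g 0 + (\<Sum>i<I. \<Sum>n\<in>dyadic_block i. g n)"
proof (induction I)
  case 0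
  have "{n :: int. \<bar>n\<bar> < 2 ^ 0} = {0}" by auto
  then show ?case by simp
next
  case (Suc I)
  have fin: "finite {n :: int. \<bar>n\<bar> < 2 ^ I}"
    by (rule finite_subset[of _ "{- (2 ^ I)..2 ^ I}"]) auto
  have "{n :: int. \<bar>n\<bar> < 2 ^ Suc I} = {n. \<bar>n\<bar> < 2 ^ I} \<union> dyadic_block I"
    by (auto simp: dyadic_block_def)
  then have "(\<Sum>n\<in>{n. \<bar>n\<bar> < 2 ^ Suc I}. g n) = (\<Sum>n\<in>{n. \<bar>n\<bar> < 2 ^ I}. g n) + (\<Sum>n\<in>dyadic_block I. g n)"
    using fin finite_dyadic_block by (simp only:) (rule sum.union_disjoint, auto simp: dyadic_block_def)
  then show ?case by (simp add: Suc)
qed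

text \<open>A block spans one octave, so the angle \<open>|n| * pi / 2 ^ Suc i\<close> falls in
  \<open>[pi / 2, pi]\<close>.\<close>

lemma cos_nonpos_dyadic:
  assumes "n \<in> dyadic_block i"
  shows "cos (of_int n * (pi / 2 ^ Suc i)) \<le> 0"
proof -
  define y where "y = \<bar>of_int n\<bar> * (pi / 2 ^ Suc i)"
  have n: "2 ^ i \<le> (\<bar>of_int n\<bar> :: real)" "(\<bar>of_int n\<bar> :: real) \<le> 2 ^ Suc i"
  proof -
    have "of_int (2 ^ i) \<le> (of_int \<bar>n\<bar> :: real)" "of_int \<bar>n\<bar> \<le> (of_int (2 ^ Suc i) :: real)"
      using assms unfolding of_int_le_iff by (auto simp: dyadic_block_def)
    then show "2 ^ i \<le> (\<bar>of_int n\<bar> :: real)" "(\<bar>of_int n\<bar> :: real) \<le> 2 ^ Suc i" by simp_all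
  qed
  have "2 ^ i * (pi / 2 ^ Suc i) \<le> y" "y \<le> 2 ^ Suc i * (pi / 2 ^ Suc i)"
    unfolding y_def by (rule mult_right_mono[OF n(1)], simp, rule mult_right_mono[OF n(2)], simp)
  then have y: "pi / 2 \<le> y" "y \<le> pi" by simp_all
  have "cos y \<le> cos (pi / 2)" using y by (intro cos_monotone_0_pi_le) auto
  moreover have "cos (of_int n * (pi / 2 ^ Suc i)) = cos y"
    unfolding y_def by (cases "n \<ge> 0") auto
  ultimately show ?thesis by simp
qed

lemma norm_cis_minus_one_sq: "(norm (cis x - 1))\<^sup>2 = 2 - 2 * cos x"
proof -
  have "(norm (cis x - 1))\<^sup>2 = (cos x - 1)\<^sup>2 + (sin x)\<^sup>2" by (simp add: cmod_power2)
  also have "\<dots> = 2 - 2 * cos x" using sin_cos_squared_add[of x] by (simp add: power2_diff)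
  finally show ?thesis .
qed

text \<open>Bessel's inequality is applied to an increment of \<open>F\<close>, whose coefficients
  carry the factor \<open>cis (n t) - 1\<close>, of modulus at least 1 on the block.\<close>

lemma besov_block_bound:
  assumes b: "besov_le s K F" and s: "0 < s"
  shows "(\<Sum>n\<in>dyadic_block i. (norm (circle_coeff F n))\<^sup>2) \<le> K * (2 / 2 ^ i) powr (2 * s)"
proof -
  \<comment> \<open>At most \<open>pi / 2\<close>, attained for \<open>i = 0\<close>, and therefore
    inside the range \<open>t \<le> 2\<close> of \<open>besov_le\<close>.\<close>
  define t where "t = pi / 2 ^ Suc i"
  have F: "continuous_on unit_circle F" and K: "0 \<le> K" using b by (auto simp: besov_le_def)
  have t: "0 < t" "t \<le> 2 / 2 ^ i" "t \<le> 2"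
  proof -
    show "0 < t" by (simp add: t_def)
    have "pi / (2 * 2 ^ i) \<le> 4 / (2 * 2 ^ i)" using pi_less_4 by (intro divide_right_mono) auto
    then show 1: "t \<le> 2 / 2 ^ i" by (simp add: t_def)
    have "2 / 2 ^ i \<le> 2 / (1::real)" by (intro divide_left_mono) auto
    with 1 show "t \<le> 2" by simp
  qed
  let ?G = "\<lambda>z. F (z * cis t) - F z"
  have G: "continuous_on unit_circle ?G" by (intro continuous_intros continuous_on_rotate F)
  have coeff: "circle_coeff ?G n = (cis (of_int n * t) - 1) * circle_coeff F n" for n
    by (simp add: circle_coeff_diff[OF continuous_on_rotate[OF F] F] circle_coeff_rotate[OF F] algebra_simps)
  have "ennreal (\<Sum>n\<in>dyadic_block i. (norm (circle_coeff F n))\<^sup>2) \<le> ennreal (\<Sum>n\<in>dyadic_block i. (norm (circle_coeff ?G n))\<^sup>2)"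
  proof (intro ennreal_leI sum_mono)
    fix n assume n: "n \<in> dyadic_block i"
    have "1 \<le> (norm (cis (of_int n * t) - 1))\<^sup>2"
      using cos_nonpos_dyadic[OF n] by (simp add: norm_cis_minus_one_sq t_def)
    then have "1 * (norm (circle_coeff F n))\<^sup>2 \<le> (norm (cis (of_int n * t) - 1))\<^sup>2 * (norm (circle_coeff F n))\<^sup>2"
      by (intro mult_right_mono) auto
    then show "(norm (circle_coeff F n))\<^sup>2 \<le> (norm (circle_coeff ?G n))\<^sup>2"
      unfolding coeff norm_mult power_mult_distrib by simp
  qed
  also have "\<dots> \<le> energy ?G"
    by (rule bessel_inequality[OF G finite_dyadic_block])
  also have "\<dots> \<le> ennreal (K * t powr (2 * s))" using b t unfolding besov_le_def by blast
  also have "\<dots> \<le> ennreal (K * (2 / 2 ^ i) powr (2 * s))"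
    using t s K by (intro ennreal_leI mult_left_mono powr_mono2) auto
  finally show ?thesis using K by (simp add: ennreal_le_iff)
qed

lemma besov_coeff_0_bound:
  assumes b: "besov_le s K F"
  shows "(norm (circle_coeff F 0))\<^sup>2 \<le> K"
proof -
  have F: "continuous_on unit_circle F" and K: "0 \<le> K" using b by (auto simp: besov_le_def)
  have "ennreal (\<Sum>n\<in>{0}. (norm (circle_coeff F n))\<^sup>2) \<le> energy F"
    by (rule bessel_inequality[OF F]) simp
  also have "\<dots> \<le> ennreal K" using b by (simp add: besov_le_def)
  finally show ?thesis using K by (simp add: ennreal_le_iff)
qed

text \<open>On each dyadic block Hoelder's inequality is replaced by \<open>x\<^sup>p \<le> y\<^sup>p + y\<^sup>p\<^sup>-\<^sup>2 x\<^sup>2\<close> with \<open>y\<close> the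
  expected size of the coefficients.\<close>

lemma besov_weighted_sum:
  fixes p \<beta> s :: real
  assumes p: "0 < p" "p \<le> 2" and \<beta>: "0 \<le> \<beta>" and s: "0 < s" "\<beta> + 1 / p - 1 / 2 < s"
  obtains C where "0 < C"
    "\<And>F K A. besov_le s K F \<Longrightarrow> 0 < K \<Longrightarrow> finite A \<Longrightarrow>
       (\<Sum>n\<in>A. norm (circle_coeff F n) powr p * (1 + \<bar>real_of_int n\<bar>) powr (p * \<beta>)) \<le> C * K powr (p / 2)"
proof -
  \<comment> \<open>The exponent of \<open>2 ^ i\<close> in the block estimate: 1 from the number of
    frequencies, \<open>- p (s + 1 / 2)\<close> from \<open>y powr p\<close>, and
    \<open>p \<beta>\<close> from the weight. It is negative exactly when
    \<open>s > \<beta> + 1 / p - 1 / 2\<close>.\<close>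
  define e where "e = 1 - p * s - p / 2 + p * \<beta>"
  have e: "e < 0"
  proof -
    have "p * (\<beta> + 1 / p - 1 / 2) < p * s" using p s by (intro mult_strict_left_mono) auto
    moreover have "p * (\<beta> + 1 / p - 1 / 2) = p * \<beta> + 1 - p / 2"
      using p by (simp add: distrib_left right_diff_distrib)
    ultimately show ?thesis by (simp add: e_def)
  qed
  define \<theta> where "\<theta> = 2 powr e"
  have \<theta>: "0 < \<theta>" "\<theta> < 1" using e powr_less_mono[of e 0 "2::real"] by (auto simp: \<theta>_def)
  \<comment> \<open>The 2 comes from the size of the block, \<open>2 powr (2 * s)\<close> from its
    energy, and \<open>4 powr (p * \<beta>)\<close> from
    \<open>1 + |n| \<le> 4 * 2 ^ i\<close>.\<close>
  define D where "D = (2 + 2 powr (2 * s)) * 4 powr (p * \<beta>)"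
  have D: "0 < D" by (simp add: D_def add_pos_pos)
  show ?thesis
  proof (rule that[of "1 + D / (1 - \<theta>)"])
    show "0 < 1 + D / (1 - \<theta>)" using D \<theta> by (intro add_pos_pos divide_pos_pos) auto
    fix F K and A :: "int set" assume b: "besov_le s K F" and K: "0 < K" and A: "finite A"
    define a where "a n = norm (circle_coeff F n)" for n
    define w where "w n = (1 + \<bar>real_of_int n\<bar>) powr (p * \<beta>)" for n
    have a0: "0 \<le> a n" for n by (simp add: a_def)
    have block: "(\<Sum>n\<in>dyadic_block i. a n powr p * w n) \<le> D * K powr (p / 2) * \<theta> ^ i" for i
    proof -
      define x where "x = (2::real) ^ i"
      have x: "x > 0" by (simp add: x_def)
      \<comment> \<open>The root mean square size: an energy of order \<open>K x^(- 2 s)\<close> is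
        shared by about \<open>x\<close> coefficients.\<close>
      define y where "y = K powr (1 / 2) * x powr (- (s + 1 / 2))"
      have y: "0 < y" using K x by (simp add: y_def)
      have yp: "y powr r = K powr (r / 2) * x powr (- (s + 1 / 2) * r)" for r
        by (simp add: y_def powr_mult powr_powr)
      have "(\<Sum>n\<in>dyadic_block i. a n powr p * w n) \<le> (\<Sum>n\<in>dyadic_block i. (y powr p + y powr (p - 2) * (a n)\<^sup>2) * (4 * x) powr (p * \<beta>))"
      proof (intro sum_mono mult_mono)
        fix n assume n: "n \<in> dyadic_block i"
        show "a n powr p \<le> y powr p + y powr (p - 2) * (a n)\<^sup>2" using p y a0 by (intro powr_le_young) auto
        have "of_int \<bar>n\<bar> \<le> (of_int (2 ^ Suc i) :: real)"
          using n unfolding of_int_le_iff by (auto simp: dyadic_block_def)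
        then have "\<bar>real_of_int n\<bar> \<le> 2 * x" by (simp add: x_def)
        moreover have "1 \<le> x" by (simp add: x_def)
        ultimately have "1 + \<bar>real_of_int n\<bar> \<le> 4 * x" by simp
        then show "w n \<le> (4 * x) powr (p * \<beta>)" unfolding w_def using p \<beta> by (intro powr_mono2) auto
      qed (auto simp: w_def)
      also have "\<dots> = (card (dyadic_block i) * y powr p + y powr (p - 2) * (\<Sum>n\<in>dyadic_block i. (a n)\<^sup>2)) * (4 * x) powr (p * \<beta>)"
        by (simp add: sum_distrib_right[symmetric] sum.distrib sum_distrib_left)
      also have "\<dots> \<le> ((2 * x) * y powr p + y powr (p - 2) * (K * (2 / x) powr (2 * s))) * (4 * x) powr (p * \<beta>)"
      proof (intro mult_right_mono add_mono mult_left_mono)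
        have "real (card (dyadic_block i)) \<le> real (2 * 2 ^ i)" using card_dyadic_block by (intro of_nat_mono)
        then show "real (card (dyadic_block i)) \<le> 2 * x" by (simp add: x_def)
        show "(\<Sum>n\<in>dyadic_block i. (a n)\<^sup>2) \<le> K * (2 / x) powr (2 * s)"
          unfolding a_def x_def by (rule besov_block_bound[OF b s(1)])
      qed auto
      also have "(2 * x) * y powr p = 2 * K powr (p / 2) * x powr (1 - p * s - p / 2)"
      proof -
        have "x * x powr (- (s + 1 / 2) * p) = x powr (1 + - (s + 1 / 2) * p)"
          unfolding powr_add using x by simp
        also have "1 + - (s + 1 / 2) * p = 1 - p * s - p / 2" by (simp add: algebra_simps)
        finally show ?thesis by (simp add: yp)
      qed
      also have "y powr (p - 2) * (K * (2 / x) powr (2 * s)) = 2 powr (2 * s) * K powr (p / 2) * x powr (1 - p * s - p / 2)"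
      proof -
        have "K powr ((p - 2) / 2) * K = K powr ((p - 2) / 2 + 1)" unfolding powr_add using K by simp
        also have "(p - 2) / 2 + 1 = p / 2" by (simp add: field_simps)
        finally have 1: "K powr ((p - 2) / 2) * K = K powr (p / 2)" .
        have "x powr (- (s + 1 / 2) * (p - 2)) * x powr (- (2 * s)) = x powr (- (s + 1 / 2) * (p - 2) + - (2 * s))"
          unfolding powr_add ..
        also have "- (s + 1 / 2) * (p - 2) + - (2 * s) = 1 - p * s - p / 2" by (simp add: field_simps)
        finally have 2: "x powr (- (s + 1 / 2) * (p - 2)) * x powr (- (2 * s)) = x powr (1 - p * s - p / 2)" .
        have 3: "(2 / x) powr (2 * s) = 2 powr (2 * s) * x powr (- (2 * s))"
          by (subst powr_divide) (simp only: powr_minus divide_inverse)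
        have "y powr (p - 2) * (K * (2 / x) powr (2 * s))
          = 2 powr (2 * s) * (K powr ((p - 2) / 2) * K) * (x powr (- (s + 1 / 2) * (p - 2)) * x powr (- (2 * s)))"
          unfolding yp 3 by (simp only: mult_ac)
        then show ?thesis unfolding 1 2 .
      qed
      also have "(2 * K powr (p / 2) * x powr (1 - p * s - p / 2) + 2 powr (2 * s) * K powr (p / 2) * x powr (1 - p * s - p / 2)) * (4 * x) powr (p * \<beta>)
        = D * K powr (p / 2) * (x powr (1 - p * s - p / 2) * x powr (p * \<beta>))"
        unfolding D_def powr_mult by (simp only: distrib_right distrib_left mult_ac)
      also have "x powr (1 - p * s - p / 2) * x powr (p * \<beta>) = x powr e"
        unfolding e_def by (simp only: powr_add)
      also have "x powr e = \<theta> ^ i"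
      proof -
        have "x powr e = (2 powr real i) powr e" by (simp add: x_def powr_realpow)
        also have "\<dots> = \<theta> powr real i" by (simp add: \<theta>_def powr_powr mult.commute)
        also have "\<dots> = \<theta> ^ i" using \<theta> by (simp add: powr_realpow)
        finally show ?thesis .
      qed
      finally show ?thesis .
    qed
    obtain I where I: "A \<subseteq> {n. \<bar>n\<bar> < 2 ^ I}"
    proof
      define N where "N = nat (\<Sum>n\<in>A. \<bar>n\<bar>)"
      show "A \<subseteq> {n. \<bar>n\<bar> < 2 ^ N}"
      proof
        fix n assume "n \<in> A"
        then have "\<bar>n\<bar> \<le> (\<Sum>n\<in>A. \<bar>n\<bar>)" using A by (intro member_le_sum) auto
        also have "\<dots> \<le> int N" by (simp add: N_def)
        also have "int N < 2 ^ N" using less_exp[of N] by (metis of_nat_less_iff of_nat_numeral of_nat_power)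
        finally show "n \<in> {n. \<bar>n\<bar> < 2 ^ N}" by simp
      qed
    qed
    have fin: "finite {n :: int. \<bar>n\<bar> < 2 ^ I}"
      by (rule finite_subset[of _ "{- (2 ^ I)..2 ^ I}"]) auto
    have "(\<Sum>n\<in>A. a n powr p * w n) \<le> (\<Sum>n\<in>{n. \<bar>n\<bar> < 2 ^ I}. a n powr p * w n)"
      by (rule sum_mono2[OF fin I]) (simp add: w_def)
    also have "\<dots> = a 0 powr p * w 0 + (\<Sum>i<I. \<Sum>n\<in>dyadic_block i. a n powr p * w n)"
      by (rule sum_dyadic_blocks)
    also have "\<dots> \<le> K powr (p / 2) + (\<Sum>i<I. D * K powr (p / 2) * \<theta> ^ i)"
    proof (intro add_mono sum_mono block)
      have "a 0 powr p = ((a 0)\<^sup>2) powr (p / 2)"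
      proof (cases "a 0 = 0")
        case False
        then have "(a 0)\<^sup>2 = a 0 powr 2" using a0[of 0] by (simp add: powr_numeral)
        then show ?thesis by (simp add: powr_powr)
      qed simp
      also have "\<dots> \<le> K powr (p / 2)"
        using besov_coeff_0_bound[OF b] p by (intro powr_mono2) (auto simp: a_def)
      finally show "a 0 powr p * w 0 \<le> K powr (p / 2)" by (simp add: w_def)
    qed
    also have "(\<Sum>i<I. D * K powr (p / 2) * \<theta> ^ i) \<le> D * K powr (p / 2) * (1 / (1 - \<theta>))"
    proof -
      have "(\<Sum>i<I. \<theta> ^ i) \<le> (\<Sum>i. \<theta> ^ i)" using \<theta> by (intro sum_le_suminf summable_geometric) auto
      also have "\<dots> = 1 / (1 - \<theta>)" using \<theta> by (intro suminf_geometric) auto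
      finally show ?thesis unfolding sum_distrib_left[symmetric] using D by (intro mult_left_mono) auto
    qed
    also have "K powr (p / 2) + D * K powr (p / 2) * (1 / (1 - \<theta>)) = (1 + D / (1 - \<theta>)) * K powr (p / 2)"
      by (simp add: algebra_simps)
    finally show "(\<Sum>n\<in>A. norm (circle_coeff F n) powr p * (1 + \<bar>real_of_int n\<bar>) powr (p * \<beta>))
        \<le> (1 + D / (1 - \<theta>)) * K powr (p / 2)"
      by (simp add: a_def w_def)
  qed
qed

section \<open>Weighted sums and closed spans\<close>

lemma angular_deriv_cong:
  assumes "\<And>z. z \<in> unit_circle \<Longrightarrow> \<phi> z = \<psi> z"
  shows "angular_deriv k \<phi> = angular_deriv k \<psi>"
proof -
  have "(\<lambda>t. \<phi> (cis t)) = (\<lambda>t. \<psi> (cis t))" using assms by auto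
  then show ?thesis by (simp add: angular_deriv_def)
qed

lemma smooth_on_circle_cong:
  assumes "\<And>z. z \<in> unit_circle \<Longrightarrow> \<phi> z = \<psi> z"
  shows "smooth_on_circle \<phi> \<longleftrightarrow> smooth_on_circle \<psi>"
  using angular_deriv_cong[OF assms] by (simp add: smooth_on_circle_def)

lemma angular_deriv_0: "angular_deriv 0 \<phi> = (\<lambda>t. \<phi> (cis t))"
  by (simp add: angular_deriv_def)

lemma angular_deriv_Suc: "angular_deriv (Suc k) \<phi> t = vector_derivative (angular_deriv k \<phi>) (at t)"
  by (simp add: angular_deriv_def)

lemma has_vector_derivative_cis_mult:
  "((\<lambda>t. c * cis (of_int m * t)) has_vector_derivative c * (\<i> * of_int m) * cis (of_int m * t)) (at t)"
proof -
  have "((\<lambda>z. c * exp (\<i> * of_int m * z)) has_field_derivative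
      c * (\<i> * of_int m) * exp (\<i> * of_int m * of_real t)) (at (of_real t))"
    by (auto intro!: derivative_eq_intros)
  from has_vector_derivative_real_field[OF this] show ?thesis
    by (simp add: cis_conv_exp mult.assoc)
qed

lemma angular_deriv_powi:
  "angular_deriv k (\<lambda>z. z powi m) = (\<lambda>t. (\<i> * of_int m) ^ k * cis (of_int m * t))"
proof (induction k)
  case 0
  show ?case by (simp add: angular_deriv_0 cis_power_int)
next
  case (Suc k)
  show ?case
    using vector_derivative_at[OF has_vector_derivative_cis_mult[of "(\<i> * of_int m) ^ k" m]]
    by (auto simp: fun_eq_iff angular_deriv_Suc Suc mult_ac)
qed

lemma smooth_on_circle_powi: "smooth_on_circle (\<lambda>z. z powi m)"
  unfolding smooth_on_circle_def angular_deriv_powi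
  using has_vector_derivative_cis_mult differentiableI_vector by blast

text \<open>At \<open>z = 0\<close> the product may differ from \<open>z powi (m + n)\<close>, as
  for \<open>m = 1\<close> and \<open>n = -1\<close>, so the two are compared on the circle
  only.\<close>

lemma smooth_on_circle_powi_mult: "smooth_on_circle (\<lambda>z. z powi m * z powi n)"
proof -
  have "smooth_on_circle (\<lambda>z. z powi m * z powi n) \<longleftrightarrow> smooth_on_circle (\<lambda>z. z powi (m + n))"
  proof (rule smooth_on_circle_cong)
    fix z :: complex assume "z \<in> unit_circle"
    then have "z \<noteq> 0" by auto
    then show "z powi m * z powi n = z powi (m + n)" by (simp add: power_int_add)
  qed
  then show ?thesis using smooth_on_circle_powi by simp
qed

lemma smooth_imp_continuous_on_circle:
  assumes "smooth_on_circle \<phi>"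
  shows "continuous_on UNIV (\<lambda>t. \<phi> (cis t))"
proof -
  have "angular_deriv 0 \<phi> differentiable at t" for t
    using assms unfolding smooth_on_circle_def by blast
  then have "(\<lambda>t. \<phi> (cis t)) differentiable at t" for t by (simp only: angular_deriv_0)
  then show ?thesis
    by (intro continuous_at_imp_continuous_on ballI differentiable_imp_continuous_within)
qed

lemma fourier_coeff_distr_of_fun: "fourier_coeff (distr_of_fun F) n = circle_coeff F n"
  using smooth_on_circle_powi by (simp add: fourier_coeff_def distr_of_fun_def circle_coeff_def)

text \<open>The dictionary between the span of shifts, made of functionals, and trigonometric
  polynomials times \<open>f\<close>; all approximations take place on the function side.\<close>

lemma fourier_coeff_shift_sum:
  assumes f: "continuous_on unit_circle f" and "finite A"
  shows "fourier_coeff (\<lambda>\<phi>. \<Sum>n\<in>A. c n * mult_power n (distr_of_fun f) \<phi>) m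
    = circle_coeff (\<lambda>z. (\<Sum>n\<in>A. c n * z powi n) * f z) m"
proof -
  have "(\<integral>z. ((\<Sum>n\<in>A. c n * z powi n) * f z) * z powi (- m) \<partial>arc_length)
      = (\<integral>z. (\<Sum>n\<in>A. c n * (f z * (z powi n * z powi (- m)))) \<partial>arc_length)"
    by (simp add: sum_distrib_left sum_distrib_right mult_ac)
  also have "\<dots> = (\<Sum>n\<in>A. c n * (\<integral>z. f z * (z powi n * z powi (- m)) \<partial>arc_length))"
    by (subst Bochner_Integration.integral_sum) (auto intro!: integrable_arc_length continuous_intros f)
  finally show ?thesis
    using smooth_on_circle_powi_mult
    by (simp add: fourier_coeff_def mult_power_def distr_of_fun_def circle_coeff_def sum_divide_distrib)
qed

text \<open>Phrased with finite partial sums, so that no summability has to be carried along.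
  \<open>X\<close> bounds the power of order \<open>p\<close> of the norm.\<close>

definition weighted_sum_le :: "real \<Rightarrow> real \<Rightarrow> (int \<Rightarrow> complex) \<Rightarrow> real \<Rightarrow> bool" where
  "weighted_sum_le p \<beta> a X \<longleftrightarrow>
     (\<forall>A. finite A \<longrightarrow> (\<Sum>n\<in>A. norm (a n) powr p * (1 + \<bar>real_of_int n\<bar>) powr (p * \<beta>)) \<le> X)"

lemma weighted_sum_le_summable:
  assumes "weighted_sum_le p \<beta> a X"
  shows "(\<lambda>n. norm (a n) powr p * (1 + \<bar>real_of_int n\<bar>) powr (p * \<beta>)) summable_on UNIV"
proof (rule nonneg_bdd_above_summable_on)
  show "bdd_above (sum (\<lambda>n. norm (a n) powr p * (1 + \<bar>real_of_int n\<bar>) powr (p * \<beta>)) ` {F. F \<subseteq> UNIV \<and> finite F})"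
    using assms by (intro bdd_aboveI2[where M = X]) (auto simp: weighted_sum_le_def)
qed auto

lemma weighted_sum_le_infsum:
  assumes "(\<lambda>n. norm (a n) powr p * (1 + \<bar>real_of_int n\<bar>) powr (p * \<beta>)) summable_on UNIV"
  shows "weighted_sum_le p \<beta> a (\<Sum>\<^sub>\<infinity>n\<in>UNIV. norm (a n) powr p * (1 + \<bar>real_of_int n\<bar>) powr (p * \<beta>))"
  unfolding weighted_sum_le_def using assms by (auto intro!: finite_sum_le_infsum)

text \<open>A quasi-triangle inequality from \<open>|a + b| \<le> 2 max |a| |b|\<close>, in place of
  Minkowski. It dictates the choice \<open>\<eta>1 = \<eta> / (2 * 2 powr p)\<close> in the density
  arguments.\<close>

lemma weighted_sum_le_add:
  assumes a: "weighted_sum_le p \<beta> a X" and b: "weighted_sum_le p \<beta> b Y" and p: "0 < p"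
  shows "weighted_sum_le p \<beta> (\<lambda>n. a n + b n) (2 powr p * (X + Y))"
  unfolding weighted_sum_le_def
proof (intro allI impI)
  fix A :: "int set" assume A: "finite A"
  let ?w = "\<lambda>n. (1 + \<bar>real_of_int n\<bar>) powr (p * \<beta>)"
  have le: "norm (a n + b n) powr p \<le> 2 powr p * (norm (a n) powr p + norm (b n) powr p)" for n
  proof -
    have "norm (a n + b n) \<le> 2 * max (norm (a n)) (norm (b n))"
      using norm_triangle_ineq[of "a n" "b n"] by (auto simp: max_def)
    then have "norm (a n + b n) powr p \<le> (2 * max (norm (a n)) (norm (b n))) powr p"
      using p by (intro powr_mono2) auto
    also have "\<dots> = 2 powr p * (max (norm (a n)) (norm (b n))) powr p" by (simp add: powr_mult)
    also have "(max (norm (a n)) (norm (b n))) powr p \<le> norm (a n) powr p + norm (b n) powr p"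
      by (auto simp: max_def)
    finally show ?thesis by (simp add: mult_left_mono)
  qed
  have "(\<Sum>n\<in>A. norm (a n + b n) powr p * ?w n) \<le> (\<Sum>n\<in>A. (2 powr p * (norm (a n) powr p + norm (b n) powr p)) * ?w n)"
    by (intro sum_mono mult_right_mono le) auto
  also have "\<dots> = 2 powr p * ((\<Sum>n\<in>A. norm (a n) powr p * ?w n) + (\<Sum>n\<in>A. norm (b n) powr p * ?w n))"
    by (simp add: sum.distrib sum_distrib_left algebra_simps)
  also have "\<dots> \<le> 2 powr p * (X + Y)"
    using a b A by (intro mult_left_mono add_mono) (auto simp: weighted_sum_le_def)
  finally show "(\<Sum>n\<in>A. norm (a n + b n) powr p * ?w n) \<le> 2 powr p * (X + Y)" .
qed

lemma fourier_coeff_diff: "fourier_coeff (\<lambda>\<phi>. T \<phi> - P \<phi>) n = fourier_coeff T n - fourier_coeff P n"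
  by (simp add: fourier_coeff_def)

lemma closed_shift_span_intro:
  assumes p: "0 < p" and T: "T \<in> A_space p \<beta>"
    and approx: "\<And>\<eta>. 0 < \<eta> \<Longrightarrow> \<exists>P\<in>shift_span S \<Lambda>. weighted_sum_le p \<beta> (\<lambda>n. fourier_coeff T n - fourier_coeff P n) \<eta>"
  shows "T \<in> closed_shift_span p \<beta> S \<Lambda>"
  unfolding closed_shift_span_def
proof (intro CollectI conjI T allI impI)
  fix \<epsilon> :: real assume \<epsilon>: "0 < \<epsilon>"
  obtain P where P: "P \<in> shift_span S \<Lambda>"
    "weighted_sum_le p \<beta> (\<lambda>n. fourier_coeff T n - fourier_coeff P n) ((\<epsilon> / 2) powr p)"
    using approx[of "(\<epsilon> / 2) powr p"] \<epsilon> by auto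
  have "A_norm p \<beta> (\<lambda>\<phi>. T \<phi> - P \<phi>) \<le> ((\<epsilon> / 2) powr p) powr (1 / p)"
    unfolding A_norm_def fourier_coeff_diff
  proof (intro powr_mono2)
    show "(\<Sum>\<^sub>\<infinity>n\<in>UNIV. norm (fourier_coeff T n - fourier_coeff P n) powr p * (1 + \<bar>real_of_int n\<bar>) powr (p * \<beta>)) \<le> (\<epsilon> / 2) powr p"
      using P(2) by (intro infsum_le_finite_sums weighted_sum_le_summable[OF P(2)]) (auto simp: weighted_sum_le_def)
  qed (use p in \<open>auto intro!: infsum_nonneg\<close>)
  also have "\<dots> = \<epsilon> / 2" using p \<epsilon> by (simp add: powr_powr)
  finally show "\<exists>P\<in>shift_span S \<Lambda>. A_norm p \<beta> (\<lambda>\<phi>. T \<phi> - P \<phi>) < \<epsilon>" using P(1) \<epsilon> by force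
qed

text \<open>The hypothesis \<open>fin\<close> guards against the convention that
  \<open>infsum\<close> of a non-summable family is 0, under which a small \<open>A_norm\<close>
  would say nothing about the coefficients.\<close>

lemma closed_shift_span_elim:
  assumes p: "0 < p" and T: "T \<in> closed_shift_span p \<beta> S \<Lambda>"
    and fin: "\<And>P. P \<in> shift_span S \<Lambda> \<Longrightarrow> \<exists>X. weighted_sum_le p \<beta> (fourier_coeff P) X" and \<eta>: "0 < \<eta>"
  obtains P where "P \<in> shift_span S \<Lambda>" "weighted_sum_le p \<beta> (\<lambda>n. fourier_coeff T n - fourier_coeff P n) \<eta>"
proof -
  have "0 < \<eta> powr (1 / p)" using \<eta> by simp
  then obtain P where P: "P \<in> shift_span S \<Lambda>" "A_norm p \<beta> (\<lambda>\<phi>. T \<phi> - P \<phi>) < \<eta> powr (1 / p)"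
    using T unfolding closed_shift_span_def by blast
  let ?I = "\<Sum>\<^sub>\<infinity>n\<in>UNIV. norm (fourier_coeff T n - fourier_coeff P n) powr p * (1 + \<bar>real_of_int n\<bar>) powr (p * \<beta>)"
  obtain X where X: "weighted_sum_le p \<beta> (fourier_coeff P) X" using fin[OF P(1)] ..
  then have X': "weighted_sum_le p \<beta> (\<lambda>n. - fourier_coeff P n) X" by (simp add: weighted_sum_le_def)
  have "T \<in> A_space p \<beta>" using T by (simp add: closed_shift_span_def)
  then have "\<exists>Y. weighted_sum_le p \<beta> (fourier_coeff T) Y"
    unfolding A_space_def using weighted_sum_le_infsum by blast
  then obtain Y where Y: "weighted_sum_le p \<beta> (fourier_coeff T) Y" ..
  have "weighted_sum_le p \<beta> (\<lambda>n. fourier_coeff T n - fourier_coeff P n) (2 powr p * (Y + X))"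
    using weighted_sum_le_add[OF Y X' p] by simp
  from weighted_sum_le_infsum[OF weighted_sum_le_summable[OF this]]
  have I: "weighted_sum_le p \<beta> (\<lambda>n. fourier_coeff T n - fourier_coeff P n) ?I" .
  have I0: "0 \<le> ?I" by (rule infsum_nonneg) auto
  have "?I powr (1 / p) < \<eta> powr (1 / p)" using P(2) unfolding A_norm_def fourier_coeff_diff .
  then have "?I < \<eta>"
  proof (rule contrapos_pp)
    assume "\<not> ?I < \<eta>"
    then have "\<eta> powr (1 / p) \<le> ?I powr (1 / p)" using \<eta> p by (intro powr_mono2) auto
    then show "\<not> ?I powr (1 / p) < \<eta> powr (1 / p)" by simp
  qed
  with I have "weighted_sum_le p \<beta> (\<lambda>n. fourier_coeff T n - fourier_coeff P n) \<eta>"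
    unfolding weighted_sum_le_def by (meson less_imp_le order_trans)
  with P(1) that show ?thesis by blast
qed

lemma besov_small_weighted_sum:
  fixes p \<beta> s :: real
  assumes "0 < p" "p \<le> 2" "0 \<le> \<beta>" "0 < s" "\<beta> + 1 / p - 1 / 2 < s" and \<eta>: "0 < \<eta>"
  obtains \<epsilon> where "0 < \<epsilon>" "\<And>F. besov_le s \<epsilon> F \<Longrightarrow> weighted_sum_le p \<beta> (circle_coeff F) \<eta>"
proof -
  obtain C where C: "0 < C" "\<And>F K A. besov_le s K F \<Longrightarrow> 0 < K \<Longrightarrow> finite A \<Longrightarrow>
       (\<Sum>n\<in>A. norm (circle_coeff F n) powr p * (1 + \<bar>real_of_int n\<bar>) powr (p * \<beta>)) \<le> C * K powr (p / 2)"
    using besov_weighted_sum[OF assms(1-5)] by blast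
  define \<epsilon> where "\<epsilon> = (\<eta> / C) powr (2 / p)"
  have \<epsilon>: "0 < \<epsilon>" "C * \<epsilon> powr (p / 2) = \<eta>" using C(1) \<eta> assms(1) by (auto simp: \<epsilon>_def powr_powr)
  show ?thesis
    by (rule that[OF \<epsilon>(1)]) (use C(2)[OF _ \<epsilon>(1)] \<epsilon>(2) in \<open>auto simp: weighted_sum_le_def\<close>)
qed

lemma besov_weighted_sum_exists:
  fixes p \<beta> s :: real
  assumes "0 < p" "p \<le> 2" "0 \<le> \<beta>" "0 < s" "\<beta> + 1 / p - 1 / 2 < s" and "besov_le s K F"
  shows "\<exists>X. weighted_sum_le p \<beta> (circle_coeff F) X"
proof -
  obtain C where "0 < C" and C: "\<And>F K A. besov_le s K F \<Longrightarrow> 0 < K \<Longrightarrow> finite A \<Longrightarrow>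
       (\<Sum>n\<in>A. norm (circle_coeff F n) powr p * (1 + \<bar>real_of_int n\<bar>) powr (p * \<beta>)) \<le> C * K powr (p / 2)"
    using besov_weighted_sum[OF assms(1-5)] by blast
  have "0 \<le> K" using assms(6) unfolding besov_le_def by blast
  then have "0 < K + 1" by simp
  moreover have "besov_le s (K + 1) F" by (rule besov_le_mono[OF assms(6)]) simp
  ultimately show ?thesis unfolding weighted_sum_le_def using C[of "K + 1" F] by blast
qed

text \<open>Supplies the finiteness that \<open>closed_shift_span_elim\<close> asks for: a
  trigonometric polynomial times \<open>f\<close> is again Hoelder of order
  \<open>s\<close>.\<close>

lemma shift_span_weighted_sum:
  fixes p \<beta> s :: real
  assumes "0 < p" "p \<le> 2" "0 \<le> \<beta>" "0 < s" "\<beta> + 1 / p - 1 / 2 < s" "s \<le> 1"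
    and f: "holder_le s L f" and P: "P \<in> shift_span (distr_of_fun f) \<Lambda>"
  shows "\<exists>X. weighted_sum_le p \<beta> (fourier_coeff P) X"
proof -
  obtain A c where A: "finite A" "P = (\<lambda>\<phi>. \<Sum>n\<in>A. c n * mult_power n (distr_of_fun f) \<phi>)"
    using P unfolding shift_span_def by blast
  obtain \<kappa> where \<kappa>: "holder_le s \<kappa> (\<lambda>z. \<Sum>n\<in>A. c n * z powi n)" using holder_le_trig[of s A c] assms A by auto
  have "fourier_coeff P = circle_coeff (\<lambda>z. (\<Sum>n\<in>A. c n * z powi n) * f z)"
    unfolding A(2) using fourier_coeff_shift_sum[OF holder_le_continuous_on[OF assms(4) f] A(1)] by blast
  then show ?thesis
    using besov_weighted_sum_exists[OF assms(1-5) holder_imp_besov_le[OF assms(4) holder_le_mult[OF \<kappa> f]]] by simp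
qed

lemma circle_coeff_cong:
  assumes "\<And>z. z \<in> unit_circle \<Longrightarrow> F z = G z"
  shows "circle_coeff F n = circle_coeff G n"
  unfolding circle_coeff_def using assms
  by (intro arg_cong2[where f = "(/)"] Bochner_Integration.integral_cong refl) auto

text \<open>An approximant from the two-sided span is \<open>f\<close> times
  \<open>z powi (- m)\<close> times a polynomial; \<open>analytic_approximation\<close> exchanges it
  for \<open>f\<close> times a polynomial at arbitrarily small cost.\<close>

lemma closed_shift_span_analytic:
  fixes p \<beta> s \<delta> :: real
  assumes p: "0 < p" "p \<le> 2" and \<beta>: "0 \<le> \<beta>" and s: "0 < s" "\<beta> + 1 / p - 1 / 2 < s" "s < \<delta>" "\<delta> \<le> 1 / 2"
    and f: "holder_le \<delta> L f" and E: "closed E" "E \<noteq> {}" "E \<subseteq> unit_circle" and f0: "\<And>z. z \<in> E \<Longrightarrow> f z = 0"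
    and mass: "filterlim (nbhd_mass E) at_top sequentially"
  shows "closed_shift_span p \<beta> (distr_of_fun f) UNIV = closed_shift_span p \<beta> (distr_of_fun f) {0..}"
proof
  have "shift_span (distr_of_fun f) {0..} \<subseteq> shift_span (distr_of_fun f) UNIV"
    unfolding shift_span_def by blast
  then show "closed_shift_span p \<beta> (distr_of_fun f) {0..} \<subseteq> closed_shift_span p \<beta> (distr_of_fun f) UNIV"
    unfolding closed_shift_span_def by blast
  show "closed_shift_span p \<beta> (distr_of_fun f) UNIV \<subseteq> closed_shift_span p \<beta> (distr_of_fun f) {0..}"
  proof
    fix T assume T: "T \<in> closed_shift_span p \<beta> (distr_of_fun f) UNIV"
    have fs: "holder_le s (2 * L) f" using holder_le_exponent[OF f] s by simp
    have cf: "continuous_on unit_circle f" using holder_le_continuous_on[OF s(1) fs] .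
    show "T \<in> closed_shift_span p \<beta> (distr_of_fun f) {0..}"
    proof (rule closed_shift_span_intro[OF p(1)])
      show "T \<in> A_space p \<beta>" using T by (simp add: closed_shift_span_def)
      fix \<eta> :: real assume \<eta>: "0 < \<eta>"
      define \<eta>1 where "\<eta>1 = \<eta> / (2 * 2 powr p)"
      have \<eta>1: "0 < \<eta>1" "2 powr p * (\<eta>1 + \<eta>1) = \<eta>" using \<eta> by (auto simp: \<eta>1_def)
      have fin: "\<exists>X. weighted_sum_le p \<beta> (fourier_coeff P) X" if "P \<in> shift_span (distr_of_fun f) UNIV" for P
        using shift_span_weighted_sum[OF p \<beta> s(1,2) _ fs that] s by simp
      obtain P where P: "P \<in> shift_span (distr_of_fun f) UNIV"
        "weighted_sum_le p \<beta> (\<lambda>n. fourier_coeff T n - fourier_coeff P n) \<eta>1"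
        using closed_shift_span_elim[OF p(1) T fin \<eta>1(1)] by blast
      obtain A c where A: "finite A" "P = (\<lambda>\<phi>. \<Sum>n\<in>A. c n * mult_power n (distr_of_fun f) \<phi>)"
        using P(1) unfolding shift_span_def by blast
      obtain \<epsilon> where \<epsilon>: "0 < \<epsilon>" "\<And>F. besov_le s \<epsilon> F \<Longrightarrow> weighted_sum_le p \<beta> (circle_coeff F) \<eta>1"
        using besov_small_weighted_sum[OF p \<beta> s(1,2) \<eta>1(1)] by blast
      \<comment> \<open>A crude bound for all \<open>|n|\<close> with \<open>n\<close> in
        \<open>A\<close>, large enough to clear every negative exponent.\<close>
      define m where "m = nat (\<Sum>n\<in>A. \<bar>n\<bar>)"
      have m: "0 \<le> n + int m" if "n \<in> A" for n
      proof -
        have "\<bar>n\<bar> \<le> (\<Sum>n\<in>A. \<bar>n\<bar>)" using A that by (intro member_le_sum) auto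
        then show ?thesis by (simp add: m_def)
      qed
      define B where "B = (\<Sum>n\<in>A. monom (c n) (nat (n + int m)))"
      have B: "z powi (- int m) * poly B z = (\<Sum>n\<in>A. c n * z powi n)" if "z \<in> unit_circle" for z
      proof -
        have nz: "z \<noteq> 0" using that by auto
        have "z powi (- int m) * (c n * z ^ nat (n + int m)) = c n * z powi n" if "n \<in> A" for n
        proof -
          have "z ^ nat (n + int m) = z powi (n + int m)" using m[OF that] by (simp add: power_int_def)
          then have "z powi (- int m) * z ^ nat (n + int m) = z powi (- int m + (n + int m))"
            using power_int_add[of z "- int m" "n + int m"] nz by simp
          then show ?thesis by simp
        qed
        then have "(\<Sum>n\<in>A. z powi (- int m) * (c n * z ^ nat (n + int m))) = (\<Sum>n\<in>A. c n * z powi n)"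
          by (intro sum.cong) auto
        then show ?thesis by (simp only: B_def poly_sum poly_monom sum_distrib_left)
      qed
      obtain R where R: "besov_le s \<epsilon> (\<lambda>z. (z powi (- int m) * poly B z - poly R z) * f z)"
        using analytic_approximation[OF s(1,3,4) E f f0 mass \<epsilon>(1)] by blast
      define A' where "A' = {0..int (degree R)}"
      define P' where "P' = (\<lambda>\<phi>. \<Sum>n\<in>A'. coeff R (nat n) * mult_power n (distr_of_fun f) \<phi>)"
      have P': "P' \<in> shift_span (distr_of_fun f) {0..}"
        unfolding shift_span_def P'_def
        by (intro CollectI exI[of _ A'] exI[of _ "\<lambda>n. coeff R (nat n)"]) (auto simp: A'_def)
      have R': "(\<Sum>n\<in>A'. coeff R (nat n) * z powi n) = poly R z" for z
      proof -
        have "(\<Sum>n\<in>A'. coeff R (nat n) * z powi n) = (\<Sum>i\<le>degree R. coeff R i * z ^ i)"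
          unfolding A'_def
          by (rule sum.reindex_bij_witness[of _ int nat]) (auto simp: power_int_def)
        then show ?thesis by (simp add: poly_altdef)
      qed
      have "fourier_coeff P n - fourier_coeff P' n = circle_coeff (\<lambda>z. (z powi (- int m) * poly B z - poly R z) * f z) n" for n
      proof -
        have "fourier_coeff P n - fourier_coeff P' n
            = circle_coeff (\<lambda>z. (\<Sum>n\<in>A. c n * z powi n) * f z) n - circle_coeff (\<lambda>z. (\<Sum>n\<in>A'. coeff R (nat n) * z powi n) * f z) n"
          unfolding A(2) P'_def using A(1)
          by (subst (1 2) fourier_coeff_shift_sum[OF cf]) (auto simp: A'_def)
        also have "\<dots> = circle_coeff (\<lambda>z. (\<Sum>n\<in>A. c n * z powi n) * f z - (\<Sum>n\<in>A'. coeff R (nat n) * z powi n) * f z) n"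
          by (rule circle_coeff_diff[symmetric]; intro continuous_intros cf)
        also have "\<dots> = circle_coeff (\<lambda>z. (z powi (- int m) * poly B z - poly R z) * f z) n"
          by (rule circle_coeff_cong) (simp add: B R' left_diff_distrib)
        finally show ?thesis .
      qed
      then have "weighted_sum_le p \<beta> (\<lambda>n. fourier_coeff P n - fourier_coeff P' n) \<eta>1"
        using \<epsilon>(2)[OF R] by simp
      from weighted_sum_le_add[OF P(2) this p(1)]
      have "weighted_sum_le p \<beta> (\<lambda>n. fourier_coeff T n - fourier_coeff P' n) \<eta>"
        unfolding \<eta>1(2) by simp
      with P' show "\<exists>P\<in>shift_span (distr_of_fun f) {0..}. weighted_sum_le p \<beta> (\<lambda>n. fourier_coeff T n - fourier_coeff P n) \<eta>"
        by blast
    qed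
  qed
qed

section \<open>Trigonometric approximation\<close>

text \<open>At \<open>w = cis t\<close> this is \<open>(2 cos (t / 2))^(2 N)\<close>, the de la
  Vallee Poussin kernel without its normalization: non-negative, peaked at 1, and a trigonometric
  polynomial of degree \<open>N\<close>.\<close>

definition bump_kernel :: "nat \<Rightarrow> complex \<Rightarrow> real" where
  "bump_kernel N w = (norm (1 + w)) ^ (2 * N)"

lemma bump_kernel_trig:
  assumes "w \<in> unit_circle"
  shows "of_real (bump_kernel N w) = (\<Sum>j\<le>2 * N. of_nat (2 * N choose j) * w powi (int j - int N))"
proof -
  have nz: "w \<noteq> 0" using assms by auto
  have "w * cnj w = 1" using assms complex_norm_square[of w] by simp
  then have "cnj w = inverse w" by (metis inverse_unique)
  then have "of_real ((norm (1 + w))\<^sup>2) = (1 + w) * (1 + inverse w)"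
    unfolding complex_norm_square by simp
  also have "\<dots> = (1 + w)\<^sup>2 * inverse w" using nz by (simp add: power2_eq_square field_simps)
  finally have "of_real ((norm (1 + w))\<^sup>2) = (1 + w)\<^sup>2 * inverse w" .
  moreover have "complex_of_real (bump_kernel N w) = (complex_of_real ((norm (1 + w))\<^sup>2)) ^ N"
    by (simp add: bump_kernel_def power_mult)
  ultimately have "complex_of_real (bump_kernel N w) = (1 + w) ^ (2 * N) * w powi (- int N)"
    by (simp add: power_mult_distrib power_mult power_int_minus power_inverse)
  also have "(1 + w) ^ (2 * N) = (\<Sum>j\<le>2 * N. of_nat (2 * N choose j) * w ^ j)"
    using binomial_ring[of w 1 "2 * N"] by (simp add: add.commute)
  also have "\<dots> * w powi (- int N) = (\<Sum>j\<le>2 * N. of_nat (2 * N choose j) * (w ^ j * w powi (- int N)))"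
    by (simp add: sum_distrib_right mult.assoc)
  also have "\<dots> = (\<Sum>j\<le>2 * N. of_nat (2 * N choose j) * w powi (int j - int N))"
  proof (intro sum.cong refl)
    fix j
    have "w powi (int j - int N) = w ^ j * w powi (- int N)"
      using power_int_add[of w "int j" "- int N"] nz by simp
    then show "of_nat (2 * N choose j) * (w ^ j * w powi (- int N)) = of_nat (2 * N choose j) * w powi (int j - int N)"
      by simp
  qed
  finally show ?thesis .
qed

lemma continuous_on_bump_kernel [continuous_intros]: "continuous_on S (bump_kernel N)"
  unfolding bump_kernel_def[abs_def] by (intro continuous_intros)

lemma norm_one_plus_sq:
  assumes "w \<in> unit_circle"
  shows "(norm (1 + w))\<^sup>2 = 4 - (norm (w - 1))\<^sup>2"
proof -
  have "(Re w)\<^sup>2 + (Im w)\<^sup>2 = 1" using assms by (simp add: cmod_power2[symmetric])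
  then show ?thesis by (simp add: cmod_power2 power2_sum power2_diff)
qed

lemma arc_length_near_one:
  assumes "0 < \<rho>" "\<rho> \<le> 2"
  shows "\<rho> \<le> measure arc_length {w \<in> unit_circle. norm (w - 1) \<le> \<rho>}"
proof -
  define A where "A = {w \<in> unit_circle. norm (w - 1) \<le> \<rho>}"
  have A: "A \<in> sets arc_length" unfolding A_def by (rule cball_sets_arc_length)
  have "ennreal \<rho> = (\<integral>\<^sup>+x. indicator {0..\<rho>} x \<partial>lborel)" using assms by simp
  also have "\<dots> \<le> (\<integral>\<^sup>+x. indicator A (cis x) * indicator {0..<2 * pi} x \<partial>lborel)"
  proof (intro nn_integral_mono)
    fix x :: real
    show "indicator {0..\<rho>} x \<le> (indicator A (cis x) * indicator {0..<2 * pi} x :: ennreal)"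
    proof (cases "x \<in> {0..\<rho>}")
      case True
      have "norm (cis x - 1) \<le> x" using norm_mult_cis_diff_le[of 1 x] True by simp
      moreover have "x < 2 * pi" using True assms pi_gt3 by simp
      ultimately show ?thesis using True by (simp add: A_def)
    qed simp
  qed
  also have "\<dots> = emeasure arc_length A"
    using A by (subst nn_integral_arc_length[symmetric]) auto
  finally show ?thesis by (simp add: arc_length.emeasure_eq_measure A_def)
qed

text \<open>Off the arc of radius \<rho> the kernel is at most \<open>q ^ N\<close>, while the arc
  of radius \<open>\<rho> / 2\<close> alone gives it mass at least
  \<open>Q ^ N * (\<rho> / 2)\<close>, with \<open>q < Q\<close>. This avoids any asymptotics of
  binomial coefficients.\<close>

lemma bump_kernel_concentration:
  assumes \<rho>: "0 < \<rho>" "\<rho> \<le> 1" and \<epsilon>: "0 < \<epsilon>"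
  obtains N where "0 < (\<integral>w. bump_kernel N w \<partial>arc_length)"
    "\<And>w. w \<in> unit_circle \<Longrightarrow> \<rho> \<le> norm (w - 1) \<Longrightarrow> bump_kernel N w \<le> \<epsilon> * (\<integral>w. bump_kernel N w \<partial>arc_length)"
proof -
  define q where "q = 4 - \<rho>\<^sup>2"
  define Q where "Q = 4 - (\<rho> / 2)\<^sup>2"
  have "\<rho>\<^sup>2 \<le> 1" using \<rho> by (simp add: power_le_one)
  then have qQ: "0 < q" "q < Q" using \<rho> by (auto simp: q_def Q_def power_divide)
  have "(\<lambda>N. (q / Q) ^ N) \<longlonglongrightarrow> 0" using qQ by (intro LIMSEQ_realpow_zero) auto
  moreover have "0 < \<epsilon> * (\<rho> / 2)" using \<epsilon> \<rho> by simp
  ultimately have "eventually (\<lambda>N. (q / Q) ^ N < \<epsilon> * (\<rho> / 2)) sequentially" by (rule order_tendstoD(2))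
  then obtain N where N: "(q / Q) ^ N < \<epsilon> * (\<rho> / 2)" using eventually_happens'[OF sequentially_bot] by blast
  let ?m = "\<integral>w. bump_kernel N w \<partial>arc_length"
  define A where "A = {w \<in> unit_circle. norm (w - 1) \<le> \<rho> / 2}"
  have A: "A \<in> sets arc_length" unfolding A_def by (rule cball_sets_arc_length)
  have "Q ^ N * (\<rho> / 2) \<le> Q ^ N * measure arc_length A"
    unfolding A_def using qQ \<rho> by (intro mult_left_mono arc_length_near_one) auto
  also have "\<dots> = (\<integral>w. Q ^ N * indicator A w \<partial>arc_length)"
    using sets.sets_into_space[OF A] by (simp add: Int_absorb2)
  also have "\<dots> \<le> ?m"
  proof (rule integral_mono)
    show "integrable arc_length (\<lambda>w. Q ^ N * indicator A w)" using A by (simp add: arc_length.emeasure_eq_measure)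
    show "integrable arc_length (bump_kernel N)" by (intro integrable_arc_length continuous_intros)
    fix w assume "w \<in> space arc_length"
    then have w: "w \<in> unit_circle" by simp
    show "Q ^ N * indicator A w \<le> bump_kernel N w"
    proof (cases "w \<in> A")
      case True
      then have "(norm (w - 1))\<^sup>2 \<le> (\<rho> / 2)\<^sup>2" by (intro power_mono) (auto simp: A_def)
      then have "Q ^ N \<le> ((norm (1 + w))\<^sup>2) ^ N"
        using norm_one_plus_sq[OF w] qQ by (intro power_mono) (auto simp: Q_def)
      then show ?thesis using True by (simp add: bump_kernel_def power_mult)
    qed (simp add: bump_kernel_def)
  qed
  finally have m: "Q ^ N * (\<rho> / 2) \<le> ?m" .
  show ?thesis
  proof (rule that[of N])
    have "0 < Q ^ N * (\<rho> / 2)" using qQ \<rho> by simp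
    with m show "0 < ?m" by linarith
    fix w assume w: "w \<in> unit_circle" "\<rho> \<le> norm (w - 1)"
    then have "\<rho>\<^sup>2 \<le> (norm (w - 1))\<^sup>2" using \<rho> by (intro power_mono) auto
    then have "(norm (1 + w))\<^sup>2 \<le> q" using norm_one_plus_sq[OF w(1)] by (simp add: q_def)
    then have "((norm (1 + w))\<^sup>2) ^ N \<le> q ^ N" by (rule power_mono) simp
    then have "bump_kernel N w \<le> q ^ N" by (simp add: bump_kernel_def power_mult)
    also have "q ^ N = (q / Q) ^ N * Q ^ N" using qQ by (simp add: power_divide)
    also have "\<dots> \<le> (\<epsilon> * (\<rho> / 2)) * Q ^ N" using N qQ by (intro mult_right_mono) auto
    also have "\<dots> = \<epsilon> * (Q ^ N * (\<rho> / 2))" by simp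
    also have "\<dots> \<le> \<epsilon> * ?m" using m \<epsilon> by (intro mult_left_mono) auto
    finally show "bump_kernel N w \<le> \<epsilon> * ?m" .
  qed
qed

text \<open>Convolution with the normalized kernel. An average of rotations has the same Hoelder
  constant \<kappa>, and this uniform control, besides closeness, is what the interpolation in
  \<open>holder_trig_approximation\<close> consumes.\<close>

lemma uniform_trig_approximation:
  assumes u: "holder_le \<delta> \<kappa> u" and \<delta>: "0 < \<delta>" and \<epsilon>: "0 < \<epsilon>"
  obtains A c where "finite A"
    "\<And>z. z \<in> unit_circle \<Longrightarrow> norm (u z - (\<Sum>n\<in>A. c n * z powi n)) \<le> \<epsilon>"
    "\<And>z z'. z \<in> unit_circle \<Longrightarrow> z' \<in> unit_circle \<Longrightarrow>
       norm ((\<Sum>n\<in>A. c n * z powi n) - (\<Sum>n\<in>A. c n * z' powi n)) \<le> \<kappa> * norm (z - z') powr \<delta>"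
proof -
  note h = holder_leD[OF u]
  \<comment> \<open>Gives \<open>\<kappa> * \<rho> powr \<delta> \<le> \<epsilon> / 2\<close>, so
    that inside the arc the Hoelder bound suffices. The minimum with 1 is for the concentration
    lemma, and \<open>\<kappa> + 1\<close> avoids division by 0.\<close>
  define \<rho> where "\<rho> = min 1 ((\<epsilon> / (2 * (\<kappa> + 1))) powr (1 / \<delta>))"
  have \<rho>: "0 < \<rho>" "\<rho> \<le> 1" using \<epsilon> h(1) by (auto simp: \<rho>_def)
  have "\<rho> powr \<delta> \<le> ((\<epsilon> / (2 * (\<kappa> + 1))) powr (1 / \<delta>)) powr \<delta>"
    using \<rho> \<delta> by (intro powr_mono2) (auto simp: \<rho>_def)
  also have "\<dots> = \<epsilon> / (2 * (\<kappa> + 1))" using \<delta> \<epsilon> h(1) by (simp add: powr_powr)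
  finally have "\<kappa> * \<rho> powr \<delta> \<le> \<kappa> * (\<epsilon> / (2 * (\<kappa> + 1)))" using h(1) by (intro mult_left_mono)
  also have \<kappa>\<epsilon>: "\<dots> \<le> \<epsilon> / 2" using h(1) \<epsilon> by (simp add: field_simps)
  finally have \<rho>\<delta>: "\<kappa> * \<rho> powr \<delta> \<le> \<epsilon> / 2" .
  \<comment> \<open>Off the arc the error, relative to the mass \<open>m\<close>, is at most
    \<open>2 \<kappa> \<epsilon>1\<close> on a circle of length \<open>2 * pi\<close>, in total at
    most \<open>\<epsilon> / 2\<close>.\<close>
  define \<epsilon>1 where "\<epsilon>1 = \<epsilon> / (2 * (\<kappa> + 1) * (4 * pi))"
  have \<epsilon>1: "0 < \<epsilon>1" using \<epsilon> h(1) by (simp add: \<epsilon>1_def)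
  obtain N where m0: "0 < (\<integral>w. bump_kernel N w \<partial>arc_length)" and N:
    "\<And>w. w \<in> unit_circle \<Longrightarrow> \<rho> \<le> norm (w - 1) \<Longrightarrow> bump_kernel N w \<le> \<epsilon>1 * (\<integral>w. bump_kernel N w \<partial>arc_length)"
    using bump_kernel_concentration[OF \<rho> \<epsilon>1] by blast
  define k where "k = bump_kernel N"
  define m where "m = (\<integral>w. k w \<partial>arc_length)"
  have m: "0 < m" using m0 by (simp add: m_def k_def)
  have k0: "0 \<le> k w" for w by (simp add: k_def bump_kernel_def)
  have k: "continuous_on unit_circle k" unfolding k_def by (rule continuous_on_bump_kernel)
  have uc: "continuous_on unit_circle u" using holder_le_continuous_on[OF \<delta> u] .
  have uz: "continuous_on unit_circle (\<lambda>w. u (z * w))" if "z \<in> unit_circle" for z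
    by (rule continuous_on_compose2[OF uc]) (use that in \<open>auto intro!: continuous_intros simp: norm_mult\<close>)
  define Q where "Q z = (\<integral>w. u (z * w) * of_real (k w) \<partial>arc_length) / of_real m" for z
  \<comment> \<open>The frequencies from \<open>- N\<close> to \<open>N\<close>. The substitution
    \<open>v = z w\<close> puts \<open>inverse z\<close> into the kernel, hence the reversed index
    \<open>N - j\<close>.\<close>
  define A where "A = (\<lambda>j. int N - int j) ` {..2 * N}"
  define c where "c n = of_nat (2 * N choose nat (int N - n)) * (\<integral>v. u v * v powi (- n) \<partial>arc_length) / of_real m" for n
  have Q_trig: "Q z = (\<Sum>n\<in>A. c n * z powi n)" if z: "z \<in> unit_circle" for z
  proof -
    have nz: "z \<noteq> 0" using z by auto
    have zeq: "z = cis (Arg z)" using z nz by (simp add: cis_Arg sgn_eq)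
    let ?G = "\<lambda>v. u v * of_real (k (v * inverse z))"
    have G: "continuous_on unit_circle ?G"
      unfolding k_def
      by (intro continuous_intros uc continuous_on_compose2[OF continuous_on_bump_kernel]) auto
    have "u (z * w) * of_real (k w) = ?G (w * cis (Arg z))" for w
    proof -
      have e: "w * cis (Arg z) = z * w" using zeq by (metis mult.commute)
      have "z * w * inverse z = w" using nz by simp
      then show ?thesis by (simp only: e)
    qed
    then have "(\<integral>w. u (z * w) * of_real (k w) \<partial>arc_length) = (\<integral>w. ?G (w * cis (Arg z)) \<partial>arc_length)"
      by (simp only:)
    also have "\<dots> = (\<integral>v. ?G v \<partial>arc_length)"
      by (rule integral_rotate) (rule continuous_measurable_arc_length[OF G])
    also have "\<dots> = (\<integral>v. (\<Sum>j\<le>2 * N. (of_nat (2 * N choose j) * z powi (int N - int j)) * (u v * v powi (int j - int N))) \<partial>arc_length)"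
    proof (intro Bochner_Integration.integral_cong refl)
      fix v assume "v \<in> space arc_length"
      then have "v * inverse z \<in> unit_circle" using z by (simp add: norm_mult norm_inverse)
      then have "of_real (k (v * inverse z)) = (\<Sum>j\<le>2 * N. of_nat (2 * N choose j) * (v * inverse z) powi (int j - int N))"
        unfolding k_def by (rule bump_kernel_trig)
      also have "\<dots> = (\<Sum>j\<le>2 * N. of_nat (2 * N choose j) * (v powi (int j - int N) * z powi (int N - int j)))"
      proof (intro sum.cong refl)
        fix j
        have "inverse z powi (int j - int N) = z powi (int N - int j)"
          using power_int_minus[of z "int j - int N"] by (simp add: power_int_inverse)
        then show "of_nat (2 * N choose j) * (v * inverse z) powi (int j - int N) = of_nat (2 * N choose j) * (v powi (int j - int N) * z powi (int N - int j))"
          by (simp add: power_int_mult_distrib)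
      qed
      finally show "?G v = (\<Sum>j\<le>2 * N. (of_nat (2 * N choose j) * z powi (int N - int j)) * (u v * v powi (int j - int N)))"
        by (simp add: sum_distrib_left mult_ac)
    qed
    also have "\<dots> = (\<Sum>j\<le>2 * N. (of_nat (2 * N choose j) * z powi (int N - int j)) * (\<integral>v. u v * v powi (int j - int N) \<partial>arc_length))"
      by (subst Bochner_Integration.integral_sum) (auto intro!: integrable_arc_length continuous_intros uc)
    finally have "Q z = (\<Sum>j\<le>2 * N. c (int N - int j) * z powi (int N - int j))"
      by (simp add: Q_def c_def sum_divide_distrib mult_ac)
    also have "\<dots> = (\<Sum>n\<in>A. c n * z powi n)"
      unfolding A_def by (subst sum.reindex) (auto intro!: inj_onI)
    finally show ?thesis .
  qed
  have int1: "integrable arc_length (\<lambda>w. u (z * w) * of_real (k w))" if "z \<in> unit_circle" for z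
    by (intro integrable_arc_length continuous_intros uz[OF that] k)
  have close: "norm (u z - Q z) \<le> \<epsilon>" if z: "z \<in> unit_circle" for z
  proof -
    have km: "(\<integral>w. u z * of_real (k w) \<partial>arc_length) = u z * of_real m"
      unfolding m_def by simp
    have "u z - Q z = ((\<integral>w. u z * of_real (k w) \<partial>arc_length) - (\<integral>w. u (z * w) * of_real (k w) \<partial>arc_length)) / of_real m"
      unfolding km Q_def diff_divide_distrib using m by simp
    also have "\<dots> = (\<integral>w. u z * of_real (k w) - u (z * w) * of_real (k w) \<partial>arc_length) / of_real m"
      by (subst Bochner_Integration.integral_diff) (auto intro!: int1[OF z] integrable_arc_length continuous_intros k)
    finally have eq: "norm (u z - Q z) = norm (\<integral>w. u z * of_real (k w) - u (z * w) * of_real (k w) \<partial>arc_length) / m"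
      using m by (simp add: norm_divide)
    have "norm (\<integral>w. u z * of_real (k w) - u (z * w) * of_real (k w) \<partial>arc_length)
        \<le> (\<integral>w. norm (u z * of_real (k w) - u (z * w) * of_real (k w)) \<partial>arc_length)"
      by (rule integral_norm_bound)
    also have "\<dots> \<le> (\<integral>w. \<epsilon> / 2 * k w + 2 * \<kappa> * (\<epsilon>1 * m) \<partial>arc_length)"
    proof (intro integral_mono integrable_norm integrable_arc_length continuous_intros uz[OF z] k)
      fix w assume "w \<in> space arc_length"
      then have w: "w \<in> unit_circle" "z * w \<in> unit_circle" using z by (auto simp: norm_mult)
      have "norm (u z * of_real (k w) - u (z * w) * of_real (k w)) = norm (u z - u (z * w)) * k w"
        using k0[of w] by (simp add: left_diff_distrib[symmetric] norm_mult)
      also have "\<dots> \<le> \<epsilon> / 2 * k w + 2 * \<kappa> * (\<epsilon>1 * m)"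
      proof (cases "\<rho> \<le> norm (w - 1)")
        case True
        have "norm (u z - u (z * w)) \<le> 2 * \<kappa>"
          using norm_triangle_ineq4[of "u z" "u (z * w)"] h(2)[OF z] h(2)[OF w(2)] by linarith
        moreover have "k w \<le> \<epsilon>1 * m" using N[OF w(1) True] by (simp add: k_def m_def)
        ultimately have "norm (u z - u (z * w)) * k w \<le> 2 * \<kappa> * (\<epsilon>1 * m)"
          using k0 h(1) by (intro mult_mono) auto
        moreover have "0 \<le> \<epsilon> / 2 * k w" using \<epsilon> k0[of w] by simp
        ultimately show ?thesis by linarith
      next
        case False
        have "z - z * w = z * (1 - w)" by (simp add: algebra_simps)
        then have "norm (z - z * w) = norm (w - 1)" using z by (simp add: norm_mult norm_minus_commute)
        then have "norm (u z - u (z * w)) \<le> \<kappa> * norm (w - 1) powr \<delta>" using h(3)[OF z w(2)] by simp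
        also have "\<dots> \<le> \<kappa> * \<rho> powr \<delta>" using False h(1) \<delta> by (intro mult_left_mono powr_mono2) auto
        also have "\<dots> \<le> \<epsilon> / 2" by (rule \<rho>\<delta>)
        finally have "norm (u z - u (z * w)) * k w \<le> \<epsilon> / 2 * k w" using k0 by (intro mult_right_mono)
        moreover have "0 \<le> 2 * \<kappa> * (\<epsilon>1 * m)" using h(1) \<epsilon>1 m by simp
        ultimately show ?thesis by linarith
      qed
      finally show "norm (u z * of_real (k w) - u (z * w) * of_real (k w)) \<le> \<epsilon> / 2 * k w + 2 * \<kappa> * (\<epsilon>1 * m)" .
    qed
    also have "\<dots> = \<epsilon> / 2 * m + 2 * \<kappa> * (\<epsilon>1 * m) * (2 * pi)"
    proof -
      have "(\<integral>w. \<epsilon> / 2 * k w + 2 * \<kappa> * (\<epsilon>1 * m) \<partial>arc_length)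
        = (\<integral>w. \<epsilon> / 2 * k w \<partial>arc_length) + (\<integral>w. 2 * \<kappa> * (\<epsilon>1 * m) \<partial>arc_length)"
        by (intro Bochner_Integration.integral_add integrable_arc_length continuous_intros k)
      then show ?thesis by (simp add: m_def measure_def emeasure_arc_length_circle)
    qed
    also have "\<dots> = (\<epsilon> / 2 + \<kappa> * \<epsilon>1 * (4 * pi)) * m" by (simp add: algebra_simps)
    also have "\<dots> \<le> \<epsilon> * m"
    proof (intro mult_right_mono)
      have "\<kappa> * \<epsilon>1 * (4 * pi) = \<kappa> * (\<epsilon> / (2 * (\<kappa> + 1)))" by (simp add: \<epsilon>1_def)
      also have "\<dots> \<le> \<epsilon> / 2" by (rule \<kappa>\<epsilon>)
      finally show "\<epsilon> / 2 + \<kappa> * \<epsilon>1 * (4 * pi) \<le> \<epsilon>" by simp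
    qed (use m in auto)
    finally show ?thesis using m by (simp add: eq pos_divide_le_eq)
  qed
  have hol: "norm (Q z - Q z') \<le> \<kappa> * norm (z - z') powr \<delta>" if z: "z \<in> unit_circle" and z': "z' \<in> unit_circle" for z z'
  proof -
    have "Q z - Q z' = (\<integral>w. u (z * w) * of_real (k w) - u (z' * w) * of_real (k w) \<partial>arc_length) / of_real m"
      by (subst Bochner_Integration.integral_diff) (auto intro!: int1 z z' simp: Q_def diff_divide_distrib)
    then have eq: "norm (Q z - Q z') = norm (\<integral>w. u (z * w) * of_real (k w) - u (z' * w) * of_real (k w) \<partial>arc_length) / m"
      using m by (simp add: norm_divide)
    have "norm (\<integral>w. u (z * w) * of_real (k w) - u (z' * w) * of_real (k w) \<partial>arc_length)
        \<le> (\<integral>w. norm (u (z * w) * of_real (k w) - u (z' * w) * of_real (k w)) \<partial>arc_length)"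
      by (rule integral_norm_bound)
    also have "\<dots> \<le> (\<integral>w. \<kappa> * norm (z - z') powr \<delta> * k w \<partial>arc_length)"
    proof (intro integral_mono integrable_norm integrable_arc_length continuous_intros uz z z' k)
      fix w assume "w \<in> space arc_length"
      then have w: "norm w = 1" "z * w \<in> unit_circle" "z' * w \<in> unit_circle" using z z' by (auto simp: norm_mult)
      have "norm (u (z * w) * of_real (k w) - u (z' * w) * of_real (k w)) = norm (u (z * w) - u (z' * w)) * k w"
        using k0[of w] by (simp add: left_diff_distrib[symmetric] norm_mult)
      also have "\<dots> \<le> (\<kappa> * norm (z * w - z' * w) powr \<delta>) * k w"
        using h(3)[OF w(2,3)] k0 by (intro mult_right_mono)
      also have "norm (z * w - z' * w) = norm (z - z')" using w by (simp add: left_diff_distrib[symmetric] norm_mult)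
      finally show "norm (u (z * w) * of_real (k w) - u (z' * w) * of_real (k w)) \<le> \<kappa> * norm (z - z') powr \<delta> * k w" .
    qed
    also have "\<dots> = \<kappa> * norm (z - z') powr \<delta> * m" by (simp add: m_def)
    finally show ?thesis using m by (simp add: eq pos_divide_le_eq)
  qed
  show ?thesis
  proof (rule that[of A c])
    show "finite A" by (simp add: A_def)
    show "norm (u z - (\<Sum>n\<in>A. c n * z powi n)) \<le> \<epsilon>" if "z \<in> unit_circle" for z
      using close[OF that] Q_trig[OF that] by simp
    show "norm ((\<Sum>n\<in>A. c n * z powi n) - (\<Sum>n\<in>A. c n * z' powi n)) \<le> \<kappa> * norm (z - z') powr \<delta>"
      if "z \<in> unit_circle" "z' \<in> unit_circle" for z z'
      using hol[OF that] Q_trig[OF that(1)] Q_trig[OF that(2)] by simp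
  qed
qed

text \<open>Interpolation between two ranges. For \<open>|z - w| \<le> r\<close> both
  \<open>u\<close> and its approximant have Hoelder constant \<kappa> of order \<delta>, which gains
  \<open>r powr (\<delta> - s)\<close>; beyond \<open>r\<close> the uniform error is small against
  \<open>r powr s\<close>. In general some loss from \<delta> to \<open>s\<close> is
  unavoidable.\<close>

lemma holder_trig_approximation:
  assumes u: "holder_le \<delta> \<kappa> u" and s: "0 < s" "s < \<delta>" and \<epsilon>: "0 < \<epsilon>"
  obtains A c where "finite A" "holder_le s \<epsilon> (\<lambda>z. u z - (\<Sum>n\<in>A. c n * z powi n))"
proof -
  note h = holder_leD[OF u]
  define r where "r = (\<epsilon> / (2 * (\<kappa> + 1))) powr (1 / (\<delta> - s))"
  have r: "0 < r" using \<epsilon> h(1) by (simp add: r_def)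
  have "r powr (\<delta> - s) = \<epsilon> / (2 * (\<kappa> + 1))" using s \<epsilon> h(1) by (simp add: r_def powr_powr)
  then have "\<epsilon> = 2 * \<kappa> * r powr (\<delta> - s) + 2 * r powr (\<delta> - s)" using h(1) by (simp add: field_simps)
  moreover have "0 \<le> r powr (\<delta> - s)" by simp
  ultimately have rs: "2 * \<kappa> * r powr (\<delta> - s) \<le> \<epsilon>" by linarith
  have \<delta>: "0 < \<delta>" using s by simp
  define \<epsilon>1 where "\<epsilon>1 = min \<epsilon> (\<epsilon> * r powr s / 2)"
  have \<epsilon>1: "0 < \<epsilon>1" using \<epsilon> r by (simp add: \<epsilon>1_def)
  obtain A c where A: "finite A"
    "\<And>z. z \<in> unit_circle \<Longrightarrow> norm (u z - (\<Sum>n\<in>A. c n * z powi n)) \<le> \<epsilon>1"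
    "\<And>z z'. z \<in> unit_circle \<Longrightarrow> z' \<in> unit_circle \<Longrightarrow>
       norm ((\<Sum>n\<in>A. c n * z powi n) - (\<Sum>n\<in>A. c n * z' powi n)) \<le> \<kappa> * norm (z - z') powr \<delta>"
    using uniform_trig_approximation[OF u \<delta> \<epsilon>1] by blast
  let ?Q = "\<lambda>z. \<Sum>n\<in>A. c n * z powi n"
  have "holder_le s \<epsilon> (\<lambda>z. u z - ?Q z)"
  proof (rule holder_leI)
    show "norm (u z - ?Q z) \<le> \<epsilon>" if "z \<in> unit_circle" for z using A(2)[OF that] by (simp add: \<epsilon>1_def)
    fix z w :: complex assume zw: "z \<in> unit_circle" "w \<in> unit_circle"
    show "norm (u z - ?Q z - (u w - ?Q w)) \<le> \<epsilon> * norm (z - w) powr s"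
    proof (cases "norm (z - w) \<le> r")
      case True
      have "norm (u z - ?Q z - (u w - ?Q w)) \<le> norm (u z - u w) + norm (?Q z - ?Q w)"
        using norm_triangle_ineq4[of "u z - u w" "?Q z - ?Q w"] by (simp add: algebra_simps)
      also have "\<dots> \<le> 2 * \<kappa> * norm (z - w) powr \<delta>" using h(3)[OF zw] A(3)[OF zw] by linarith
      also have "norm (z - w) powr \<delta> = norm (z - w) powr (\<delta> - s) * norm (z - w) powr s"
        by (simp add: powr_add[symmetric])
      also have "2 * \<kappa> * (norm (z - w) powr (\<delta> - s) * norm (z - w) powr s) \<le> 2 * \<kappa> * (r powr (\<delta> - s) * norm (z - w) powr s)"
        using True s h(1) by (intro mult_left_mono mult_right_mono powr_mono2) auto
      also have "\<dots> = (2 * \<kappa> * r powr (\<delta> - s)) * norm (z - w) powr s" by simp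
      also have "\<dots> \<le> \<epsilon> * norm (z - w) powr s" using rs by (intro mult_right_mono) auto
      finally show ?thesis .
    next
      case False
      have "norm (u z - ?Q z - (u w - ?Q w)) \<le> norm (u z - ?Q z) + norm (u w - ?Q w)" by (rule norm_triangle_ineq4)
      also have "\<dots> \<le> 2 * \<epsilon>1" using A(2)[OF zw(1)] A(2)[OF zw(2)] by linarith
      also have "\<dots> \<le> \<epsilon> * r powr s" by (simp add: \<epsilon>1_def)
      also have "\<dots> \<le> \<epsilon> * norm (z - w) powr s" using False r s \<epsilon> by (intro mult_left_mono powr_mono2) auto
      finally show ?thesis .
    qed
  qed (use \<epsilon> in auto)
  with A(1) that show ?thesis by blast
qed

section \<open>Cutoffs near sets of small Hausdorff measure\<close>

text \<open>Cutoffs are combined by maxima rather than sums, because then the bounds on squared increments add up.\<close>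

definition cutoff_le :: "real \<Rightarrow> real \<Rightarrow> (complex \<Rightarrow> real) \<Rightarrow> bool" where
  "cutoff_le s K \<phi> \<longleftrightarrow> (\<forall>z. 0 \<le> \<phi> z \<and> \<phi> z \<le> 1) \<and> (\<exists>L. \<forall>z w. \<bar>\<phi> z - \<phi> w\<bar> \<le> L * norm (z - w)) \<and>
     besov_le s K (\<lambda>z. of_real (\<phi> z))"

text \<open>The increment of a maximum is at most the larger of the two increments, and the square
  of a maximum at most the sum of the squares. The factor 2 of \<open>besov_le_add\<close> does not
  appear; it would be fatal over an uncontrolled number of balls.\<close>

lemma cutoff_le_max:
  assumes a: "cutoff_le s K1 \<phi>" and b: "cutoff_le s K2 \<psi>"
  shows "cutoff_le s (K1 + K2) (\<lambda>z. max (\<phi> z) (\<psi> z))"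
proof -
  obtain L1 L2 where L: "\<And>z w. \<bar>\<phi> z - \<phi> w\<bar> \<le> L1 * norm (z - w)" "\<And>z w. \<bar>\<psi> z - \<psi> w\<bar> \<le> L2 * norm (z - w)"
    using a b unfolding cutoff_le_def by blast
  have r: "0 \<le> \<phi> z" "\<phi> z \<le> 1" "0 \<le> \<psi> z" "\<psi> z \<le> 1" for z using a b unfolding cutoff_le_def by blast+
  have ba: "besov_le s K1 (\<lambda>z. of_real (\<phi> z))" and bb: "besov_le s K2 (\<lambda>z. of_real (\<psi> z))"
    using a b unfolding cutoff_le_def by blast+
  then have ca: "continuous_on unit_circle (\<lambda>z. complex_of_real (\<phi> z))" 
    and cb: "continuous_on unit_circle (\<lambda>z. complex_of_real (\<psi> z))"
    unfolding besov_le_def by blast+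
  have ca': "continuous_on unit_circle \<phi>" and cb': "continuous_on unit_circle \<psi>"
    using continuous_on_Re[OF ca] continuous_on_Re[OF cb] by simp_all
  have gen: "energy (\<lambda>z. complex_of_real (h z)) \<le> ennreal (A + B)"
    if "continuous_on unit_circle f" "continuous_on unit_circle g" "0 \<le> A" "0 \<le> B"
      "\<And>z. (h z)\<^sup>2 \<le> (f z)\<^sup>2 + (g z)\<^sup>2"
      "energy (\<lambda>z. complex_of_real (f z)) \<le> ennreal A"
      "energy (\<lambda>z. complex_of_real (g z)) \<le> ennreal B" for f g h :: "complex \<Rightarrow> real" and A B
  proof -
    have [measurable]: "f \<in> borel_measurable arc_length" "g \<in> borel_measurable arc_length"
      using that by (auto intro: continuous_measurable_arc_length)
    have "energy (\<lambda>z. complex_of_real (h z))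
        \<le> (\<integral>\<^sup>+z. ennreal ((norm (complex_of_real (f z)))\<^sup>2) + ennreal ((norm (complex_of_real (g z)))\<^sup>2) \<partial>arc_length)"
      using that(5) by (intro nn_integral_mono) (simp flip: ennreal_plus)
    also have "\<dots> = energy (\<lambda>z. complex_of_real (f z)) + energy (\<lambda>z. complex_of_real (g z))"
      by (rule nn_integral_add) simp_all
    also have "\<dots> \<le> ennreal A + ennreal B" using that by (intro add_mono)
    finally show ?thesis using that by (simp add: ennreal_plus)
  qed
  have K: "0 \<le> K1" "0 \<le> K2" using ba bb unfolding besov_le_def by blast+
  have "besov_le s (K1 + K2) (\<lambda>z. of_real (max (\<phi> z) (\<psi> z)))"
    unfolding besov_le_def
  proof (intro conjI allI impI)
    show "0 \<le> K1 + K2" using K by simp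
    show "continuous_on unit_circle (\<lambda>z. complex_of_real (max (\<phi> z) (\<psi> z)))"
      by (intro continuous_intros ca' cb')
    show "energy (\<lambda>z. complex_of_real (max (\<phi> z) (\<psi> z))) \<le> ennreal (K1 + K2)"
    proof (rule gen[OF ca' cb' K])
      show "(max (\<phi> z) (\<psi> z))\<^sup>2 \<le> (\<phi> z)\<^sup>2 + (\<psi> z)\<^sup>2" for z by (simp add: max_def)
    qed (use ba bb in \<open>auto simp: besov_le_def\<close>)
    fix t :: real assume t: "0 < t" "t \<le> 2"
    have "energy (\<lambda>z. complex_of_real (max (\<phi> (z * cis t)) (\<psi> (z * cis t)) - max (\<phi> z) (\<psi> z)))
      \<le> ennreal (K1 * t powr (2 * s) + K2 * t powr (2 * s))"
    proof (rule gen[where f = "\<lambda>z. \<phi> (z * cis t) - \<phi> z" and g = "\<lambda>z. \<psi> (z * cis t) - \<psi> z"])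
      have "continuous_on unit_circle (\<lambda>z. \<phi> (z * cis t))" "continuous_on unit_circle (\<lambda>z. \<psi> (z * cis t))"
        by (rule continuous_on_compose2[OF ca'] continuous_on_compose2[OF cb'];
            auto intro!: continuous_intros simp: norm_mult)+
      then show "continuous_on unit_circle (\<lambda>z. \<phi> (z * cis t) - \<phi> z)" "continuous_on unit_circle (\<lambda>z. \<psi> (z * cis t) - \<psi> z)"
        using ca' cb' by (auto intro!: continuous_on_diff)
      fix z
      have "\<bar>max (\<phi> (z * cis t)) (\<psi> (z * cis t)) - max (\<phi> z) (\<psi> z)\<bar> \<le> max \<bar>\<phi> (z * cis t) - \<phi> z\<bar> \<bar>\<psi> (z * cis t) - \<psi> z\<bar>"
        by (simp add: max_def abs_if)
      then have "\<bar>max (\<phi> (z * cis t)) (\<psi> (z * cis t)) - max (\<phi> z) (\<psi> z)\<bar>\<^sup>2 \<le> (max \<bar>\<phi> (z * cis t) - \<phi> z\<bar> \<bar>\<psi> (z * cis t) - \<psi> z\<bar>)\<^sup>2"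
        by (rule power_mono) simp
      also have "\<dots> \<le> (\<phi> (z * cis t) - \<phi> z)\<^sup>2 + (\<psi> (z * cis t) - \<psi> z)\<^sup>2" by (simp add: max_def)
      finally show "(max (\<phi> (z * cis t)) (\<psi> (z * cis t)) - max (\<phi> z) (\<psi> z))\<^sup>2
        \<le> (\<phi> (z * cis t) - \<phi> z)\<^sup>2 + (\<psi> (z * cis t) - \<psi> z)\<^sup>2" by simp
    next
      show "energy (\<lambda>z. complex_of_real (\<phi> (z * cis t) - \<phi> z)) \<le> ennreal (K1 * t powr (2 * s))"
        using ba t unfolding besov_le_def of_real_diff by blast
      show "energy (\<lambda>z. complex_of_real (\<psi> (z * cis t) - \<psi> z)) \<le> ennreal (K2 * t powr (2 * s))"
        using bb t unfolding besov_le_def of_real_diff by blast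
    qed (use K in auto)
    then show "energy (\<lambda>z. complex_of_real (max (\<phi> (z * cis t)) (\<psi> (z * cis t))) - complex_of_real (max (\<phi> z) (\<psi> z)))
      \<le> ennreal ((K1 + K2) * t powr (2 * s))"
      unfolding of_real_diff distrib_right .
  qed
  moreover have "\<bar>max (\<phi> z) (\<psi> z) - max (\<phi> w) (\<psi> w)\<bar> \<le> max L1 L2 * norm (z - w)" for z w
  proof -
    have "\<bar>max (\<phi> z) (\<psi> z) - max (\<phi> w) (\<psi> w)\<bar> \<le> max \<bar>\<phi> z - \<phi> w\<bar> \<bar>\<psi> z - \<psi> w\<bar>"
      by (simp add: max_def abs_if)
    also have "\<dots> \<le> max L1 L2 * norm (z - w)"
    proof (rule max.boundedI)
      have "L1 * norm (z - w) \<le> max L1 L2 * norm (z - w)" "L2 * norm (z - w) \<le> max L1 L2 * norm (z - w)"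
        by (auto intro!: mult_right_mono)
      then show "\<bar>\<phi> z - \<phi> w\<bar> \<le> max L1 L2 * norm (z - w)" "\<bar>\<psi> z - \<psi> w\<bar> \<le> max L1 L2 * norm (z - w)"
        using L(1)[of z w] L(2)[of z w] by linarith+
    qed
    finally show ?thesis .
  qed
  moreover have "0 \<le> max (\<phi> z) (\<psi> z) \<and> max (\<phi> z) (\<psi> z) \<le> 1" for z using r[of z] by (simp add: le_max_iff_disj)
  ultimately show ?thesis unfolding cutoff_le_def by blast
qed

text \<open>The bump is 1 up to distance \<open>2 l\<close> and vanishes beyond \<open>3 l\<close>.
  Its increment over the angle \<open>t\<close> is at most \<open>min 1 (t / l)\<close> and nonzero
  only on a set of measure of order \<open>l\<close>, so the energy is of order
  \<open>l (t / l)^(2 s)\<close>. This scaling is the source of the exponent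
  \<open>1 - 2 s\<close>.\<close>

lemma cutoff_le_ball:
  assumes x: "x \<in> unit_circle" and l: "0 < l" "l \<le> 1" and s: "0 < s" "s < 1 / 2"
  shows "cutoff_le s (48 * l powr (1 - 2 * s)) (\<lambda>z. max 0 (min 1 (3 - norm (z - x) / l)))"
proof -
  define \<phi> where "\<phi> z = max 0 (min 1 (3 - norm (z - x) / l))" for z
  have r: "0 \<le> \<phi> z" "\<phi> z \<le> 1" for z by (auto simp: \<phi>_def)
  have lip: "\<bar>\<phi> z - \<phi> w\<bar> \<le> (1 / l) * norm (z - w)" for z w
  proof -
    have "\<bar>\<phi> z - \<phi> w\<bar> \<le> \<bar>norm (z - x) / l - norm (w - x) / l\<bar>"
      unfolding \<phi>_def by linarith
    also have "\<dots> = \<bar>norm (z - x) - norm (w - x)\<bar> / l" using l by (simp add: diff_divide_distrib[symmetric])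
    also have "\<dots> \<le> norm (z - w) / l"
      using norm_triangle_ineq3[of "z - x" "w - x"] l by (intro divide_right_mono) auto
    finally show ?thesis by simp
  qed
  have cont: "continuous_on unit_circle \<phi>" unfolding \<phi>_def[abs_def] by (intro continuous_intros) (use l in auto)
  define A where "A = {z \<in> unit_circle. norm (z - x) \<le> 3 * l}"
  have A: "A \<in> sets arc_length" unfolding A_def by (rule cball_sets_arc_length)
  have eA: "emeasure arc_length A \<le> ennreal (24 * l)"
    using arc_length_cball[OF x, of "3 * l"] l by (simp add: A_def)
  have supp: "\<phi> z = 0" if "z \<in> unit_circle" "z \<notin> A" for z
  proof -
    have "3 < norm (z - x) / l" using that l by (simp add: A_def pos_less_divide_eq)
    then show ?thesis by (simp add: \<phi>_def)
  qed
  have "besov_le s (48 * l powr (1 - 2 * s)) (\<lambda>z. of_real (\<phi> z))"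
    unfolding besov_le_def
  proof (intro conjI allI impI)
    show "0 \<le> 48 * l powr (1 - 2 * s)" by simp
    show "continuous_on unit_circle (\<lambda>z. complex_of_real (\<phi> z))" by (intro continuous_intros cont)
    have "energy (\<lambda>z. complex_of_real (\<phi> z)) \<le> (\<integral>\<^sup>+z. indicator A z \<partial>arc_length)"
    proof (intro nn_integral_mono)
      fix z assume z: "z \<in> space arc_length"
      show "ennreal ((norm (complex_of_real (\<phi> z)))\<^sup>2) \<le> indicator A z"
        using supp[of z] z r[of z] by (cases "z \<in> A") (auto simp: power_le_one)
    qed
    also have "\<dots> \<le> ennreal (24 * l)" using A eA by simp
    also have "\<dots> \<le> ennreal (48 * l powr (1 - 2 * s))"
    proof (rule ennreal_leI)
      have "l powr 1 \<le> l powr (1 - 2 * s)" using l s by (intro powr_mono') auto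
      then show "24 * l \<le> 48 * l powr (1 - 2 * s)" using l by simp
    qed
    finally show "energy (\<lambda>z. complex_of_real (\<phi> z)) \<le> ennreal (48 * l powr (1 - 2 * s))" .
    fix t :: real assume t: "0 < t" "t \<le> 2"
    let ?c = "(t / l) powr (2 * s)"
    have mi: "(\<lambda>z. indicator A z :: ennreal) \<in> borel_measurable arc_length"
      "(\<lambda>z. indicator A (z * cis t) :: ennreal) \<in> borel_measurable arc_length"
      using borel_measurable_indicator[OF A] measurable_compose[OF measurable_rotate borel_measurable_indicator[OF A]]
      by simp_all
    have "energy (\<lambda>z. complex_of_real (\<phi> (z * cis t)) - complex_of_real (\<phi> z))
      \<le> (\<integral>\<^sup>+z. ennreal ?c * (indicator A (z * cis t) + indicator A z) \<partial>arc_length)"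
    proof (intro nn_integral_mono)
      fix z assume "z \<in> space arc_length"
      then have z: "z \<in> unit_circle" "z * cis t \<in> unit_circle" by (auto simp: norm_mult)
      show "ennreal ((norm (complex_of_real (\<phi> (z * cis t)) - complex_of_real (\<phi> z)))\<^sup>2)
        \<le> ennreal ?c * (indicator A (z * cis t) + indicator A z)"
      proof (cases "z \<in> A \<or> z * cis t \<in> A")
        case True
        have d1: "\<bar>\<phi> (z * cis t) - \<phi> z\<bar> \<le> 1" using r[of z] r[of "z * cis t"] by linarith
        have d2: "\<bar>\<phi> (z * cis t) - \<phi> z\<bar> \<le> t / l"
        proof -
          have "(1 / l) * norm (z * cis t - z) \<le> (1 / l) * t"
            using norm_mult_cis_diff_le[OF z(1), of t] t l by (intro mult_left_mono) auto
          with lip[of "z * cis t" z] show ?thesis by simp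
        qed
        \<comment> \<open>With \<open>x = t / l\<close>, the square of \<open>min 1 x\<close> is at
          most \<open>x powr (2 * s)\<close> since \<open>0 < 2 s < 2\<close>, by comparing
          exponents on either side of \<open>x = 1\<close>.\<close>
        have "\<bar>\<phi> (z * cis t) - \<phi> z\<bar>\<^sup>2 \<le> ?c"
        proof (cases "t / l \<le> 1")
          case True
          have "\<bar>\<phi> (z * cis t) - \<phi> z\<bar>\<^sup>2 \<le> (t / l)\<^sup>2" using d2 by (rule power_mono) simp
          also have "\<dots> = (t / l) powr 2" using t l by (simp add: powr_numeral)
          also have "\<dots> \<le> ?c" using True t l s by (intro powr_mono') auto
          finally show ?thesis .
        next
          case False
          have "\<bar>\<phi> (z * cis t) - \<phi> z\<bar>\<^sup>2 \<le> 1" using d1 by (intro power_le_one) auto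
          also have "1 \<le> ?c" using False s by (intro ge_one_powr_ge_zero) auto
          finally show ?thesis .
        qed
        then have "ennreal ((norm (complex_of_real (\<phi> (z * cis t)) - complex_of_real (\<phi> z)))\<^sup>2) \<le> ennreal ?c * 1"
          by (simp add: ennreal_leI flip: of_real_diff)
        also have "\<dots> \<le> ennreal ?c * (indicator A (z * cis t) + indicator A z)"
          using True by (intro mult_left_mono) (auto simp: indicator_def)
        finally show ?thesis .
      next
        case False
        then show ?thesis using supp z by simp
      qed
    qed
    also have "\<dots> = ennreal ?c * (\<integral>\<^sup>+z. indicator A (z * cis t) + indicator A z \<partial>arc_length)"
      by (intro nn_integral_cmult borel_measurable_add mi)
    also have "(\<integral>\<^sup>+z. indicator A (z * cis t) + indicator A z \<partial>arc_length)
      = (\<integral>\<^sup>+z. indicator A (z * cis t) \<partial>arc_length) + (\<integral>\<^sup>+z. indicator A z \<partial>arc_length)"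
      by (intro nn_integral_add mi)
    also have "(\<integral>\<^sup>+z. indicator A (z * cis t) \<partial>arc_length) = (\<integral>\<^sup>+z. indicator A z \<partial>arc_length)"
      using A by (intro nn_integral_rotate) simp
    also have "ennreal ?c * ((\<integral>\<^sup>+z. indicator A z \<partial>arc_length) + (\<integral>\<^sup>+z. indicator A z \<partial>arc_length)) \<le> ennreal ?c * (ennreal (24 * l) + ennreal (24 * l))"
      using A eA by (intro mult_left_mono add_mono) auto
    also have "\<dots> = ennreal (?c * (48 * l))"
    proof -
      have "ennreal (24 * l) + ennreal (24 * l) = ennreal (48 * l)" using l by (subst ennreal_plus[symmetric]) auto
      moreover have "ennreal ?c * ennreal (48 * l) = ennreal (?c * (48 * l))" using l by (intro ennreal_mult[symmetric]) auto
      ultimately show ?thesis by (simp only:)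
    qed
    also have "?c * (48 * l) = 48 * l powr (1 - 2 * s) * t powr (2 * s)"
    proof -
      have "l powr (1 - 2 * s) = l / l powr (2 * s)" unfolding powr_diff using l by simp
      then show ?thesis by (simp add: powr_divide)
    qed
    finally show "energy (\<lambda>z. complex_of_real (\<phi> (z * cis t)) - complex_of_real (\<phi> z))
      \<le> ennreal (48 * l powr (1 - 2 * s) * t powr (2 * s))" .
  qed
  moreover have "\<exists>L. \<forall>z w. \<bar>\<phi> z - \<phi> w\<bar> \<le> L * norm (z - w)" using lip by blast
  ultimately show ?thesis unfolding cutoff_le_def \<phi>_def[symmetric] using r by blast
qed

lemma cutoff_exists:
  assumes "finite I" "\<And>i. i \<in> I \<Longrightarrow> x i \<in> unit_circle \<and> 0 < l i \<and> l i \<le> 1" and s: "0 < s" "s < 1 / 2"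
  shows "\<exists>\<phi>. cutoff_le s (\<Sum>i\<in>I. 48 * l i powr (1 - 2 * s)) \<phi> \<and> (\<forall>z. \<forall>i\<in>I. norm (z - x i) \<le> 2 * l i \<longrightarrow> \<phi> z = 1)"
  using assms(1,2)
proof (induction I)
  case empty
  have "cutoff_le s 0 (\<lambda>z. 0)" unfolding cutoff_le_def using besov_le_zero[of 0 s] by (auto intro: exI[of _ 0])
  then show ?case by auto
next
  case (insert i I)
  then obtain \<phi> where \<phi>: "cutoff_le s (\<Sum>i\<in>I. 48 * l i powr (1 - 2 * s)) \<phi>"
    "\<And>z j. j \<in> I \<Longrightarrow> norm (z - x j) \<le> 2 * l j \<Longrightarrow> \<phi> z = 1" by auto
  define \<psi> where "\<psi> z = max 0 (min 1 (3 - norm (z - x i) / l i))" for z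
  have \<psi>: "cutoff_le s (48 * l i powr (1 - 2 * s)) \<psi>"
    unfolding \<psi>_def[abs_def] using insert.prems s by (intro cutoff_le_ball) auto
  have one: "\<psi> z = 1" if "norm (z - x i) \<le> 2 * l i" for z
  proof -
    have "0 < l i" using insert.prems by auto
    then have "norm (z - x i) / l i \<le> 2" using that by (simp add: pos_divide_le_eq)
    then show ?thesis by (simp add: \<psi>_def)
  qed
  have le: "\<phi> z \<le> 1" "\<psi> z \<le> 1" for z using \<phi>(1) \<psi> unfolding cutoff_le_def by blast+
  have "cutoff_le s (48 * l i powr (1 - 2 * s) + (\<Sum>i\<in>I. 48 * l i powr (1 - 2 * s))) (\<lambda>z. max (\<psi> z) (\<phi> z))"
    by (rule cutoff_le_max[OF \<psi> \<phi>(1)])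
  moreover have "max (\<psi> z) (\<phi> z) = 1" if "j \<in> insert i I" "norm (z - x j) \<le> 2 * l j" for z j
    using that \<phi>(2)[of j z] one[of z] le[of z] by (auto simp: max_def intro: antisym)
  ultimately show ?case using insert.hyps by (intro exI[of _ "\<lambda>z. max (\<psi> z) (\<phi> z)"]) auto
qed

text \<open>The cutoffs need finitely many balls centred in \<open>E\<close>. Each covering set that
  meets \<open>E\<close> is replaced by a ball around one of its points in \<open>E\<close>,
  slightly enlarged, and compactness leaves finitely many. Diameters of at most 1 allow the passage
  from \<open>s0\<close> to the larger exponent \<gamma>.\<close>

lemma hausdorff_null_cover:
  fixes E :: "complex set"
  assumes "hausdorff_measure s0 E = 0" and s0: "0 < s0" "s0 \<le> \<gamma>" and E: "compact E" and \<epsilon>: "0 < \<epsilon>" "\<epsilon> \<le> 1"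
  obtains I :: "nat set" and x l where "finite I"
    "\<And>i. i \<in> I \<Longrightarrow> x i \<in> E \<and> 0 < l i \<and> l i \<le> 1"
    "E \<subseteq> (\<Union>i\<in>I. ball (x i) (2 * l i))" "(\<Sum>i\<in>I. l i powr \<gamma>) \<le> \<epsilon>"
proof -
  have \<gamma>: "0 < \<gamma>" using s0 by simp
  \<comment> \<open>Scale 1 is fine enough: the diameters only have to stay below 1 for the change
    of exponent.\<close>
  have "hausdorff_premeasure s0 1 E \<le> hausdorff_measure s0 E"
    unfolding hausdorff_measure_def by (rule SUP_upper) simp
  then have "hausdorff_premeasure s0 1 E < ennreal (\<epsilon> / 2)" using assms(1) \<epsilon> by simp
  then obtain U :: "nat \<Rightarrow> complex set" where U: "E \<subseteq> (\<Union>i. U i)" "\<And>i. bounded (U i)" "\<And>i. diameter (U i) \<le> 1"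
    "(\<Sum>i. ennreal (diameter (U i) powr s0)) < ennreal (\<epsilon> / 2)"
    unfolding hausdorff_premeasure_def INF_less_iff by auto
  \<comment> \<open>The added term makes every radius positive, even for one-point sets, whose
    diameter is 0; over all indices it costs \<open>\<epsilon> / 2\<close>.\<close>
  define l where "l i = (diameter (U i) powr \<gamma> + \<epsilon> / 2 * (1 / 2) ^ Suc i) powr (1 / \<gamma>)" for i
  have pos: "0 < diameter (U i) powr \<gamma> + \<epsilon> / 2 * (1 / 2) ^ Suc i" for i
    using \<epsilon> by (intro add_nonneg_pos) auto
  have l\<gamma>: "l i powr \<gamma> = diameter (U i) powr \<gamma> + \<epsilon> / 2 * (1 / 2) ^ Suc i" for i
    using pos[of i] \<gamma> by (simp add: l_def powr_powr)
  have l0: "0 < l i" for i unfolding l_def using pos[of i] by (subst powr_gt_zero) linarith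
  have d0: "0 \<le> diameter (U i)" for i using U(2) by (rule diameter_ge_0)
  have diam: "diameter (U i) \<le> l i" for i
  proof -
    have "diameter (U i) = (diameter (U i) powr \<gamma>) powr (1 / \<gamma>)" using \<gamma> d0[of i] by (simp add: powr_powr)
    also have "\<dots> \<le> l i" unfolding l_def using \<gamma> \<epsilon> by (intro powr_mono2) auto
    finally show ?thesis .
  qed
  have sum_le: "(\<Sum>i\<in>I. l i powr \<gamma>) \<le> \<epsilon>" if I: "finite I" for I
  proof -
    have "ennreal (\<Sum>i\<in>I. diameter (U i) powr s0) = (\<Sum>i\<in>I. ennreal (diameter (U i) powr s0))"
      by (rule sum_ennreal[symmetric]) simp
    also have "\<dots> \<le> (\<Sum>i. ennreal (diameter (U i) powr s0))" using I by (intro sum_le_suminf) auto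
    also have "\<dots> \<le> ennreal (\<epsilon> / 2)" using U(4) by simp
    finally have 1: "(\<Sum>i\<in>I. diameter (U i) powr s0) \<le> \<epsilon> / 2" using \<epsilon> by (simp add: ennreal_le_iff)
    have "diameter (U i) powr \<gamma> \<le> diameter (U i) powr s0" for i
      using U(3)[of i] d0[of i] s0 by (intro powr_mono') auto
    then have "(\<Sum>i\<in>I. diameter (U i) powr \<gamma>) \<le> (\<Sum>i\<in>I. diameter (U i) powr s0)" by (intro sum_mono)
    with 1 have 2: "(\<Sum>i\<in>I. diameter (U i) powr \<gamma>) \<le> \<epsilon> / 2" by linarith
    have geo: "(\<lambda>i. (1 / 2 :: real) ^ Suc i) sums 1" by (rule power_half_series)
    have "(\<Sum>i\<in>I. (1 / 2 :: real) ^ Suc i) \<le> (\<Sum>i. (1 / 2) ^ Suc i)"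
      by (rule sum_le_suminf) (use geo I in \<open>auto simp: sums_iff\<close>)
    then have "(\<Sum>i\<in>I. (1 / 2 :: real) ^ Suc i) \<le> 1" using geo by (simp only: sums_iff)
    then have 3: "(\<Sum>i\<in>I. \<epsilon> / 2 * (1 / 2) ^ Suc i) \<le> \<epsilon> / 2"
      unfolding sum_distrib_left[symmetric] using \<epsilon> mult_left_mono[of _ 1 "\<epsilon> / 2"] by simp
    show ?thesis unfolding l\<gamma> sum.distrib using 2 3 by linarith
  qed
  have l1: "l i \<le> 1" for i
  proof -
    have "l i powr \<gamma> \<le> 1" using sum_le[of "{i}"] \<epsilon> by simp
    then have "(l i powr \<gamma>) powr (1 / \<gamma>) \<le> 1 powr (1 / \<gamma>)" using \<gamma> by (intro powr_mono2) auto
    then show ?thesis using \<gamma> l0[of i] by (simp add: powr_powr)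
  qed
  define J where "J = {i. U i \<inter> E \<noteq> {}}"
  define x where "x i = (SOME y. y \<in> U i \<inter> E)" for i
  have x: "x i \<in> U i \<inter> E" if "i \<in> J" for i
    using that unfolding x_def J_def by (intro someI_ex[of "\<lambda>y. y \<in> U i \<inter> E"]) auto
  have cover: "E \<subseteq> (\<Union>i\<in>J. ball (x i) (2 * l i))"
  proof
    fix z assume z: "z \<in> E"
    then obtain i where i: "z \<in> U i" using U(1) by auto
    then have J: "i \<in> J" using z by (auto simp: J_def)
    have "dist (x i) z \<le> diameter (U i)" using x[OF J] i U(2) by (intro diameter_bounded_bound) auto
    also have "\<dots> < 2 * l i" using diam[of i] l0[of i] by linarith
    finally show "z \<in> (\<Union>i\<in>J. ball (x i) (2 * l i))" using J by auto
  qed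
  obtain I where I: "I \<subseteq> J" "finite I" "E \<subseteq> (\<Union>i\<in>I. ball (x i) (2 * l i))"
    using compactE_image[OF E _ cover] by (metis open_ball)
  show ?thesis
    by (rule that[of I x l]) (use I x l0 l1 sum_le in auto)
qed

text \<open>The increment is \<open>G' (F' - F) + (G' - G) F\<close>. The first part contributes
  \<open>2 \<kappa>^2 K t^(2 s)\<close>, the second \<open>2 \<kappa>^2 K t^2\<close>, and
  \<open>t^2 \<le> 4 t^(2 s)\<close> for \<open>t \<le> 2\<close>, whence
  \<open>10 = 2 + 2 * 4\<close>.\<close>

lemma holder_mult_besov_le:
  assumes G: "holder_le 1 \<kappa> G" and F: "besov_le s K F" and s: "0 < s" "s \<le> 1"
  shows "besov_le s (10 * \<kappa>\<^sup>2 * K) (\<lambda>z. G z * F z)"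
proof -
  note h = holder_leD[OF G]
  have K: "0 \<le> K" and cF: "continuous_on unit_circle F"
    and F0: "energy F \<le> ennreal K"
    using F unfolding besov_le_def by blast+
  have cG: "continuous_on unit_circle G" using holder_le_continuous_on[OF _ G] by simp
  have mF [measurable]: "F \<in> borel_measurable arc_length" using cF by (rule continuous_measurable_arc_length)
  have scale: "(\<integral>\<^sup>+z. ennreal c * ennreal ((norm (H z))\<^sup>2) \<partial>arc_length) \<le> ennreal (c * X)"
    if "continuous_on unit_circle H" "energy H \<le> ennreal X" "0 \<le> c" "0 \<le> X"
    for H :: "complex \<Rightarrow> complex" and c X
  proof -
    have [measurable]: "H \<in> borel_measurable arc_length" using that by (intro continuous_measurable_arc_length)
    have "(\<integral>\<^sup>+z. ennreal c * ennreal ((norm (H z))\<^sup>2) \<partial>arc_length) = ennreal c * energy H"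
      by (rule nn_integral_cmult) simp
    also have "\<dots> \<le> ennreal c * ennreal X" using that by (intro mult_left_mono) auto
    finally show ?thesis using that by (simp add: ennreal_mult)
  qed
  show ?thesis
    unfolding besov_le_def
  proof (intro conjI allI impI)
    show "0 \<le> 10 * \<kappa>\<^sup>2 * K" using K by simp
    show "continuous_on unit_circle (\<lambda>z. G z * F z)" by (intro continuous_intros cG cF)
    have "energy (\<lambda>z. G z * F z) \<le> (\<integral>\<^sup>+z. ennreal (\<kappa>\<^sup>2) * ennreal ((norm (F z))\<^sup>2) \<partial>arc_length)"
    proof (intro nn_integral_mono)
      fix z assume "z \<in> space arc_length"
      then have "(norm (G z))\<^sup>2 \<le> \<kappa>\<^sup>2" using h(2)[of z] by (intro power_mono) auto
      then have "(norm (G z * F z))\<^sup>2 \<le> \<kappa>\<^sup>2 * (norm (F z))\<^sup>2"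
        unfolding norm_mult power_mult_distrib by (rule mult_right_mono) simp
      then show "ennreal ((norm (G z * F z))\<^sup>2) \<le> ennreal (\<kappa>\<^sup>2) * ennreal ((norm (F z))\<^sup>2)"
        by (simp add: ennreal_mult[symmetric] ennreal_leI)
    qed
    also have "\<dots> \<le> ennreal (\<kappa>\<^sup>2 * K)" by (rule scale[OF cF F0]) (use K in auto)
    also have "\<dots> \<le> ennreal (10 * \<kappa>\<^sup>2 * K)" using K by (intro ennreal_leI mult_right_mono) auto
    finally show "energy (\<lambda>z. G z * F z) \<le> ennreal (10 * \<kappa>\<^sup>2 * K)" .
    fix t :: real assume t: "0 < t" "t \<le> 2"
    have cD: "continuous_on unit_circle (\<lambda>z. F (z * cis t) - F z)" by (intro continuous_intros continuous_on_rotate cF)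
    have mD [measurable]: "(\<lambda>z. F (z * cis t) - F z) \<in> borel_measurable arc_length"
      using cD by (rule continuous_measurable_arc_length)
    have "energy (\<lambda>z. G (z * cis t) * F (z * cis t) - G z * F z)
      \<le> (\<integral>\<^sup>+z. ennreal (2 * \<kappa>\<^sup>2) * ennreal ((norm (F (z * cis t) - F z))\<^sup>2) + ennreal (2 * \<kappa>\<^sup>2 * t\<^sup>2) * ennreal ((norm (F z))\<^sup>2) \<partial>arc_length)"
    proof (intro nn_integral_mono)
      fix z assume "z \<in> space arc_length"
      then have z: "z \<in> unit_circle" "z * cis t \<in> unit_circle" by (auto simp: norm_mult)
      have "G (z * cis t) * F (z * cis t) - G z * F z = G (z * cis t) * (F (z * cis t) - F z) + (G (z * cis t) - G z) * F z"
        by (simp add: algebra_simps)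
      then have "(norm (G (z * cis t) * F (z * cis t) - G z * F z))\<^sup>2
        \<le> 2 * (norm (G (z * cis t) * (F (z * cis t) - F z)))\<^sup>2 + 2 * (norm ((G (z * cis t) - G z) * F z))\<^sup>2"
        using norm_sum_sq_le by metis
      also have "\<dots> \<le> 2 * (\<kappa>\<^sup>2 * (norm (F (z * cis t) - F z))\<^sup>2) + 2 * ((\<kappa> * t)\<^sup>2 * (norm (F z))\<^sup>2)"
      proof -
        have "(norm (G (z * cis t)))\<^sup>2 \<le> \<kappa>\<^sup>2" using h(2)[OF z(2)] by (intro power_mono) auto
        moreover have "norm (G (z * cis t) - G z) \<le> \<kappa> * t"
        proof -
          have "norm (G (z * cis t) - G z) \<le> \<kappa> * norm (z * cis t - z) powr 1" by (rule h(3)[OF z(2,1)])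
          also have "\<dots> \<le> \<kappa> * t" using norm_mult_cis_diff_le[OF z(1), of t] t h(1) by (simp add: mult_left_mono powr_one')
          finally show ?thesis .
        qed
        then have "(norm (G (z * cis t) - G z))\<^sup>2 \<le> (\<kappa> * t)\<^sup>2" by (intro power_mono) auto
        ultimately show ?thesis unfolding norm_mult power_mult_distrib[of "norm _" "norm _"]
          by (intro add_mono mult_left_mono mult_right_mono) auto
      qed
      finally have "ennreal ((norm (G (z * cis t) * F (z * cis t) - G z * F z))\<^sup>2)
        \<le> ennreal (2 * \<kappa>\<^sup>2 * (norm (F (z * cis t) - F z))\<^sup>2 + 2 * \<kappa>\<^sup>2 * t\<^sup>2 * (norm (F z))\<^sup>2)"
        by (intro ennreal_leI) (simp add: power_mult_distrib mult_ac)
      then show "ennreal ((norm (G (z * cis t) * F (z * cis t) - G z * F z))\<^sup>2)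
        \<le> ennreal (2 * \<kappa>\<^sup>2) * ennreal ((norm (F (z * cis t) - F z))\<^sup>2) + ennreal (2 * \<kappa>\<^sup>2 * t\<^sup>2) * ennreal ((norm (F z))\<^sup>2)"
        by (simp add: ennreal_mult[symmetric] flip: ennreal_plus)
    qed
    also have "\<dots> = (\<integral>\<^sup>+z. ennreal (2 * \<kappa>\<^sup>2) * ennreal ((norm (F (z * cis t) - F z))\<^sup>2) \<partial>arc_length)
        + (\<integral>\<^sup>+z. ennreal (2 * \<kappa>\<^sup>2 * t\<^sup>2) * ennreal ((norm (F z))\<^sup>2) \<partial>arc_length)"
      by (rule nn_integral_add) simp_all
    also have "\<dots> \<le> ennreal (2 * \<kappa>\<^sup>2 * (K * t powr (2 * s))) + ennreal (2 * \<kappa>\<^sup>2 * t\<^sup>2 * K)"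
    proof (intro add_mono scale cD cF F0)
      show "energy (\<lambda>z. F (z * cis t) - F z) \<le> ennreal (K * t powr (2 * s))"
        using F t unfolding besov_le_def by blast
    qed (use K in auto)
    also have "\<dots> = ennreal (2 * \<kappa>\<^sup>2 * (K * t powr (2 * s)) + 2 * \<kappa>\<^sup>2 * t\<^sup>2 * K)"
      using K by (intro ennreal_plus[symmetric]) auto
    also have "\<dots> \<le> ennreal (10 * \<kappa>\<^sup>2 * K * t powr (2 * s))"
    proof (rule ennreal_leI)
      have "t\<^sup>2 = t powr (2 - 2 * s) * t powr (2 * s)" unfolding powr_add[symmetric] using t by (simp add: powr_numeral)
      also have "\<dots> \<le> 4 * t powr (2 * s)"
      proof (rule mult_right_mono)
        have "t powr (2 - 2 * s) \<le> 2 powr (2 - 2 * s)" using t s by (intro powr_mono2) auto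
        also have "\<dots> \<le> 2 powr 2" using s by (intro powr_mono) auto
        finally show "t powr (2 - 2 * s) \<le> 4" by (simp add: powr_numeral)
      qed simp
      finally have "2 * \<kappa>\<^sup>2 * K * t\<^sup>2 \<le> 2 * \<kappa>\<^sup>2 * K * (4 * t powr (2 * s))" using K by (intro mult_left_mono) auto
      then show "2 * \<kappa>\<^sup>2 * (K * t powr (2 * s)) + 2 * \<kappa>\<^sup>2 * t\<^sup>2 * K \<le> 10 * \<kappa>\<^sup>2 * K * t powr (2 * s)"
        by (simp add: mult_ac)
    qed
    finally show "energy (\<lambda>z. G (z * cis t) * F (z * cis t) - G z * F z)
      \<le> ennreal (10 * \<kappa>\<^sup>2 * K * t powr (2 * s))" .
  qed
qed

section \<open>Cyclicity\<close>

lemma smooth_on_circle_linear: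
  assumes \<phi>: "smooth_on_circle \<phi>" and \<psi>: "smooth_on_circle \<psi>"
  shows "smooth_on_circle (\<lambda>z. a * \<phi> z + b * \<psi> z)"
proof -
  have d: "angular_deriv k \<phi> differentiable at t" "angular_deriv k \<psi> differentiable at t" for k t
    using \<phi> \<psi> unfolding smooth_on_circle_def by blast+
  have eq: "angular_deriv k (\<lambda>z. a * \<phi> z + b * \<psi> z) = (\<lambda>t. a * angular_deriv k \<phi> t + b * angular_deriv k \<psi> t)" for k
  proof (induction k)
    case 0
    show ?case by (simp add: angular_deriv_0)
  next
    case (Suc k)
    have "((\<lambda>t. a * angular_deriv k \<phi> t + b * angular_deriv k \<psi> t) has_vector_derivative
        a * angular_deriv (Suc k) \<phi> t + b * angular_deriv (Suc k) \<psi> t) (at t)" for t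
      unfolding angular_deriv_Suc
      using d[of k t, THEN vector_derivative_works[THEN iffD1]]
      by (intro has_vector_derivative_add has_vector_derivative_mult_right)
    then show ?case by (auto simp: fun_eq_iff angular_deriv_Suc Suc intro!: vector_derivative_at)
  qed
  show ?thesis unfolding smooth_on_circle_def eq using d by (intro allI differentiable_add differentiable_mult differentiable_const)
qed

text \<open>Smoothness is defined in the angle. Near \<open>z\<close> an angle of \<open>w\<close>
  is \<open>Arg z + Arg (w / z)\<close>, with the second \<open>Arg\<close> taken near 1 and away
  from its branch cut, so that \<open>z = -1\<close> needs no separate case.\<close>

lemma smooth_on_circle_continuous_on:
  assumes "smooth_on_circle \<phi>"
  shows "continuous_on unit_circle \<phi>"
proof -
  have "continuous (at z within unit_circle) \<phi>" if z: "z \<in> unit_circle" for z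
  proof -
    have nz: "z \<noteq> 0" using z by auto
    define g where "g w = \<phi> (z * cis (Arg (w / z)))" for w
    have z1: "z = cis (Arg z)" using z nz by (simp add: cis_Arg sgn_eq)
    have "g = (\<lambda>w. \<phi> (cis (Arg z + Arg (w / z))))"
      unfolding g_def using z1 by (simp add: cis_mult[symmetric] fun_eq_iff)
    moreover have "continuous (at z within unit_circle) (\<lambda>w. \<phi> (cis (Arg z + Arg (w / z))))"
    proof -
      have "continuous (at z within unit_circle) (\<lambda>w. Arg z + Arg (w / z))"
      proof -
        have "isCont Arg (z / z)" using nz by (intro continuous_at_Arg) auto
        moreover have "continuous (at z within unit_circle) (\<lambda>w. w / z)" using nz by (intro continuous_intros)
        ultimately have "continuous (at z within unit_circle) (\<lambda>w. Arg (w / z))" by (rule continuous_within_compose3)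
        then show ?thesis by (intro continuous_intros)
      qed
      moreover have "isCont (\<lambda>t. \<phi> (cis t)) (Arg z + Arg (z / z))"
        using smooth_imp_continuous_on_circle[OF assms] by (simp add: continuous_on_eq_continuous_at)
      ultimately show ?thesis by (rule continuous_within_compose3[rotated])
    qed
    ultimately have "continuous (at z within unit_circle) g" by simp
    moreover have "g w = \<phi> w" if "w \<in> unit_circle" for w
    proof -
      have "w / z \<noteq> 0" "norm (w / z) = 1" using that z by (auto simp: norm_divide)
      then have "cis (Arg (w / z)) = w / z" by (simp add: cis_Arg sgn_eq)
      then show ?thesis using nz by (simp add: g_def)
    qed
    ultimately show ?thesis
      using z continuous_transform_within[of z unit_circle g 1 \<phi>] by auto
  qed
  then show ?thesis by (simp add: continuous_on_eq_continuous_within)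
qed

text \<open>A distribution of order zero: the seminorm with \<open>N = 0\<close> suffices, and a
  bound of \<open>|f|\<close> on the circle is the constant.\<close>

lemma circle_distribution_distr_of_fun:
  assumes f: "continuous_on unit_circle f"
  shows "circle_distribution (distr_of_fun f)"
proof -
  have "bounded (f ` unit_circle)"
    by (intro compact_imp_bounded compact_continuous_image f compact_sphere)
  then obtain B where B: "\<And>z. z \<in> unit_circle \<Longrightarrow> norm (f z) \<le> B" unfolding bounded_iff by blast
  have "norm (f 1) \<le> B" using B[of 1] by simp
  then have B0: "0 \<le> B" using norm_ge_zero[of "f 1"] by linarith
  have int: "integrable arc_length (\<lambda>z. f z * \<phi> z)" if "smooth_on_circle \<phi>" for \<phi>
    by (intro integrable_arc_length continuous_intros f smooth_on_circle_continuous_on that)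
  have lin: "distr_of_fun f (\<lambda>z. a * \<phi> z + b * \<psi> z) = a * distr_of_fun f \<phi> + b * distr_of_fun f \<psi>"
    if s: "smooth_on_circle \<phi>" "smooth_on_circle \<psi>" for \<phi> \<psi> a b
  proof -
    have "(\<integral>z. f z * (a * \<phi> z + b * \<psi> z) \<partial>arc_length) = (\<integral>z. a * (f z * \<phi> z) + b * (f z * \<psi> z) \<partial>arc_length)"
      by (simp add: algebra_simps)
    also have "\<dots> = a * (\<integral>z. f z * \<phi> z \<partial>arc_length) + b * (\<integral>z. f z * \<psi> z \<partial>arc_length)"
      using int[OF s(1)] int[OF s(2)] by simp
    finally show ?thesis using s smooth_on_circle_linear[OF s]
      by (simp add: distr_of_fun_def add_divide_distrib)
  qed
  have cong: "distr_of_fun f \<phi> = distr_of_fun f \<psi>" if "\<And>z. z \<in> unit_circle \<Longrightarrow> \<phi> z = \<psi> z" for \<phi> \<psi>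
  proof -
    have "(\<integral>z. f z * \<phi> z \<partial>arc_length) = (\<integral>z. f z * \<psi> z \<partial>arc_length)"
      using that by (intro Bochner_Integration.integral_cong refl) auto
    then show ?thesis using smooth_on_circle_cong[OF that] by (simp add: distr_of_fun_def)
  qed
  have bound: "norm (distr_of_fun f \<phi>) \<le> B * (\<Sum>k\<le>0. SUP t. norm (angular_deriv k \<phi> t))" if s: "smooth_on_circle \<phi>" for \<phi>
  proof -
    let ?S = "SUP t. norm (\<phi> (cis t))"
    have "bounded (\<phi> ` unit_circle)"
      by (intro compact_imp_bounded compact_continuous_image smooth_on_circle_continuous_on s compact_sphere)
    then obtain D where "\<And>z. z \<in> unit_circle \<Longrightarrow> norm (\<phi> z) \<le> D" unfolding bounded_iff by blast
    then have bdd: "bdd_above (range (\<lambda>t. norm (\<phi> (cis t))))" by (intro bdd_aboveI2[where M = D]) auto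
    have le: "norm (\<phi> z) \<le> ?S" if "z \<in> unit_circle" for z
    proof -
      have "z \<noteq> 0" using that by auto
      then have "z = cis (Arg z)" using that by (simp add: cis_Arg sgn_eq)
      then have "norm (\<phi> z) = norm (\<phi> (cis (Arg z)))" by simp
      also have "\<dots> \<le> ?S" by (rule cSUP_upper[OF _ bdd]) simp
      finally show ?thesis .
    qed
    have "norm (\<integral>z. f z * \<phi> z \<partial>arc_length) \<le> (\<integral>z. norm (f z * \<phi> z) \<partial>arc_length)" by (rule integral_norm_bound)
    also have "\<dots> \<le> (\<integral>z. B * ?S \<partial>arc_length)"
      using B le B0 by (intro integral_mono integrable_norm int s) (auto simp: norm_mult intro!: mult_mono)
    also have "\<dots> = B * ?S * (2 * pi)" by (simp add: measure_def emeasure_arc_length_circle)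
    finally have "norm (\<integral>z. f z * \<phi> z \<partial>arc_length) / (2 * pi) \<le> B * ?S" by (simp add: pos_divide_le_eq)
    then show ?thesis using s by (simp add: distr_of_fun_def norm_divide norm_mult angular_deriv_0)
  qed
  show ?thesis
    unfolding circle_distribution_def
  proof (intro conjI)
    show "\<forall>\<phi>. \<not> smooth_on_circle \<phi> \<longrightarrow> distr_of_fun f \<phi> = 0" by (simp add: distr_of_fun_def)
    show "\<exists>C N. \<forall>\<phi>. smooth_on_circle \<phi> \<longrightarrow> norm (distr_of_fun f \<phi>) \<le> C * (\<Sum>k\<le>N. SUP t. norm (angular_deriv k \<phi> t))"
      using bound by blast
  qed (use lin cong in blast)+
qed

section \<open>Density of trigonometric polynomials, and division by \<open>f\<close>\<close>

lemma summable_on_tail: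
  fixes g :: "int \<Rightarrow> real"
  assumes g: "g summable_on UNIV" and nn: "\<And>n. 0 \<le> g n" and \<eta>: "0 < \<eta>"
  obtains A where "finite A" "\<And>B. finite B \<Longrightarrow> B \<inter> A = {} \<Longrightarrow> sum g B \<le> \<eta>"
proof -
  have "(sum g \<longlongrightarrow> infsum g UNIV) (finite_subsets_at_top UNIV)"
    using has_sum_infsum[OF g] by (simp add: has_sum_def)
  then have "eventually (\<lambda>X. infsum g UNIV - \<eta> < sum g X) (finite_subsets_at_top UNIV)"
    by (rule order_tendstoD(1)) (use \<eta> in simp)
  then obtain A where A: "finite A" "infsum g UNIV - \<eta> < sum g A"
    unfolding eventually_finite_subsets_at_top by blast
  show ?thesis
  proof (rule that[OF A(1)])
    fix B :: "int set" assume B: "finite B" "B \<inter> A = {}"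
    have "sum g B + sum g A = sum g (B \<union> A)" using A B by (intro sum.union_disjoint[symmetric])
    also have "\<dots> \<le> infsum g UNIV" using A B nn by (intro finite_sum_le_infsum g) auto
    finally show "sum g B \<le> \<eta>" using A(2) by linarith
  qed
qed

text \<open>The norm is a weighted sum over single coefficients, so plain truncation already yields
  density of trigonometric polynomials, with no summation method.\<close>

lemma truncated_fourier_series:
  assumes T: "T \<in> A_space p \<beta>" and \<eta>: "0 < \<eta>"
  obtains A where "finite A"
    "weighted_sum_le p \<beta> (\<lambda>n. fourier_coeff T n - (if n \<in> A then fourier_coeff T n else 0)) \<eta>"
proof -
  let ?g = "\<lambda>n. norm (fourier_coeff T n) powr p * (1 + \<bar>real_of_int n\<bar>) powr (p * \<beta>)"
  have "?g summable_on UNIV" using T by (simp add: A_space_def)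
  then obtain A where A: "finite A" "\<And>B. finite B \<Longrightarrow> B \<inter> A = {} \<Longrightarrow> sum ?g B \<le> \<eta>"
    using summable_on_tail[of ?g \<eta>] \<eta> by auto
  have "weighted_sum_le p \<beta> (\<lambda>n. fourier_coeff T n - (if n \<in> A then fourier_coeff T n else 0)) \<eta>"
    unfolding weighted_sum_le_def
  proof (intro allI impI)
    fix B :: "int set" assume B: "finite B"
    have "(\<Sum>n\<in>B. norm (fourier_coeff T n - (if n \<in> A then fourier_coeff T n else 0)) powr p * (1 + \<bar>real_of_int n\<bar>) powr (p * \<beta>))
      = sum ?g (B - A)"
      using B by (intro sum.mono_neutral_cong_right) auto
    also have "\<dots> \<le> \<eta>" using B by (intro A(2)) auto
    finally show "(\<Sum>n\<in>B. norm (fourier_coeff T n - (if n \<in> A then fourier_coeff T n else 0)) powr p * (1 + \<bar>real_of_int n\<bar>) powr (p * \<beta>)) \<le> \<eta>" .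
  qed
  with A(1) that show ?thesis by blast
qed

lemma closed_zero_set:
  assumes "continuous_on unit_circle f"
  shows "closed (zero_set f)"
proof -
  have "closed {z \<in> unit_circle. f z = 0}"
    by (rule continuous_closed_preimage_constant[OF assms]) simp
  then show ?thesis by (simp add: zero_set_def)
qed

text \<open>Away from the zeros of \<open>f\<close> this is the quotient rule. If
  \<open>|f| < m\<close> at one of the points, \<psi> vanishes there, and the quotient at the other
  point is bounded through the increment of \<psi> alone.\<close>

lemma holder_le_divide:
  assumes \<psi>: "holder_le \<delta> a \<psi>" and f: "holder_le \<delta> L f" and m: "0 < m"
    and zero: "\<And>z. z \<in> unit_circle \<Longrightarrow> norm (f z) < m \<Longrightarrow> \<psi> z = 0"
  shows "holder_le \<delta> (a / m + a * L / m\<^sup>2) (\<lambda>z. \<psi> z / f z)"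
proof (rule holder_leI)
  note h = holder_leD[OF \<psi>] and k = holder_leD[OF f]
  have pos: "0 \<le> a / m" "0 \<le> a * L / m\<^sup>2" using h(1) k(1) m by auto
  then show "0 \<le> a / m + a * L / m\<^sup>2" by simp
  show "norm (\<psi> z / f z) \<le> a / m + a * L / m\<^sup>2" if z: "z \<in> unit_circle" for z
  proof (cases "norm (f z) < m")
    case True
    then show ?thesis using zero[OF z] pos by simp
  next
    case False
    then have "norm (\<psi> z / f z) \<le> a / m" using h(1) h(2)[OF z] m unfolding norm_divide by (intro frac_le) auto
    then show ?thesis using pos by linarith
  qed
  fix z w :: complex assume zw: "z \<in> unit_circle" "w \<in> unit_circle"
  define d where "d = norm (z - w) powr \<delta>"
  have d: "0 \<le> d" by (simp add: d_def)
  have le: "a / m * d \<le> (a / m + a * L / m\<^sup>2) * d" using pos d by (intro mult_right_mono) auto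
  have \<psi>d: "norm (\<psi> z - \<psi> w) \<le> a * d" using h(3)[OF zw] by (simp add: d_def)
  have "norm (\<psi> z / f z - \<psi> w / f w) \<le> (a / m + a * L / m\<^sup>2) * d"
  proof (cases "norm (f z) < m \<or> norm (f w) < m")
    case True
    then consider "\<psi> z = 0" "\<psi> w = 0" | "\<psi> z = 0" "m \<le> norm (f w)" | "\<psi> w = 0" "m \<le> norm (f z)"
      using zero zw by fastforce
    then show ?thesis
    proof cases
      case 1
      then show ?thesis using pos d by simp
    next
      case 2
      then have "norm (\<psi> w / f w) \<le> a * d / m" using \<psi>d m h(1) d unfolding norm_divide by (intro frac_le) auto
      then show ?thesis using 2 le by simp
    next
      case 3
      then have "norm (\<psi> z / f z) \<le> a * d / m" using \<psi>d m h(1) d unfolding norm_divide by (intro frac_le) auto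
      then show ?thesis using 3 le by simp
    qed
  next
    case False
    then have fz: "m \<le> norm (f z)" "m \<le> norm (f w)" by auto
    then have nz: "f z \<noteq> 0" "f w \<noteq> 0" using m by auto
    have eq: "\<psi> z / f z - \<psi> w / f w = (\<psi> z - \<psi> w) / f z + \<psi> w * (f w - f z) / (f z * f w)"
      using nz by (simp add: field_simps)
    have "norm (\<psi> z / f z - \<psi> w / f w) \<le> norm ((\<psi> z - \<psi> w) / f z) + norm (\<psi> w * (f w - f z) / (f z * f w))"
      unfolding eq by (rule norm_triangle_ineq)
    also have "norm ((\<psi> z - \<psi> w) / f z) \<le> a * d / m"
      unfolding norm_divide using \<psi>d fz m h(1) d by (intro frac_le) auto
    also have "norm (\<psi> w * (f w - f z) / (f z * f w)) \<le> a * (L * d) / (m * m)"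
      unfolding norm_divide norm_mult
    proof (intro frac_le mult_mono)
      show "norm (f w - f z) \<le> L * d" using k(3)[OF zw(2,1)] by (simp add: d_def norm_minus_commute)
    qed (use h k zw fz m d in auto)
    finally show ?thesis by (simp add: power2_eq_square algebra_simps)
  qed
  then show "norm (\<psi> z / f z - \<psi> w / f w) \<le> (a / m + a * L / m\<^sup>2) * norm (z - w) powr \<delta>" by (simp add: d_def)
qed

text \<open>The order of choices matters: first the trigonometric polynomial \<open>g\<close> near
  \<open>T\<close>, then the cutoff, whose cost is multiplied by the square of the Lipschitz
  constant of \<open>g\<close>, and last the approximation of \<open>u\<close>. The Hoelder constant
  of \<open>u\<close> is uncontrolled, as \<open>m\<close> may be tiny, but only its finiteness
  enters \<open>holder_trig_approximation\<close>.\<close>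

lemma closed_shift_span_full:
  fixes p \<beta> s \<delta> s0 :: real
  assumes p: "0 < p" "p \<le> 2" and \<beta>: "0 \<le> \<beta>" and s: "0 < s" "\<beta> + 1 / p - 1 / 2 < s" "s < \<delta>" "\<delta> \<le> 1 / 2"
    and f: "holder_le \<delta> L f" and null: "hausdorff_measure s0 (zero_set f) = 0" and s0: "0 < s0" "s0 \<le> 1 - 2 * s"
    and T: "T \<in> A_space p \<beta>"
  shows "T \<in> closed_shift_span p \<beta> (distr_of_fun f) UNIV"
proof (rule closed_shift_span_intro[OF p(1) T])
  fix \<eta> :: real assume \<eta>: "0 < \<eta>"
  have \<delta>: "0 < \<delta>" using s by simp
  have cf: "continuous_on unit_circle f" using holder_le_continuous_on[OF \<delta> f] .
  have fs: "holder_le s (2 * L) f" using holder_le_exponent[OF f] s by simp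
  have L: "0 \<le> L" using holder_leD(1)[OF f] .
  define \<eta>1 where "\<eta>1 = \<eta> / (2 * 2 powr p)"
  have \<eta>1: "0 < \<eta>1" "2 powr p * (\<eta>1 + \<eta>1) = \<eta>" using \<eta> by (auto simp: \<eta>1_def)
  obtain A where A: "finite A"
    "weighted_sum_le p \<beta> (\<lambda>n. fourier_coeff T n - (if n \<in> A then fourier_coeff T n else 0)) \<eta>1"
    using truncated_fourier_series[OF T \<eta>1(1)] by blast
  define g where "g z = (\<Sum>n\<in>A. fourier_coeff T n * z powi n)" for z
  have cg: "continuous_on unit_circle g" unfolding g_def[abs_def] by (intro continuous_intros)
  have g_coeff: "circle_coeff g n = (if n \<in> A then fourier_coeff T n else 0)" for n
    unfolding g_def[abs_def] by (rule circle_coeff_trig[OF A(1)])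
  obtain \<epsilon> where \<epsilon>: "0 < \<epsilon>" "\<And>F. besov_le s \<epsilon> F \<Longrightarrow> weighted_sum_le p \<beta> (circle_coeff F) \<eta>1"
    using besov_small_weighted_sum[OF p \<beta> s(1,2) \<eta>1(1)] by blast
  obtain \<kappa> where \<kappa>: "holder_le 1 \<kappa> g" unfolding g_def[abs_def] using holder_le_trig[of 1 A] A(1) by auto
  \<comment> \<open>\<open>480 = 10 * 48\<close> combines the multiplication by \<open>g\<close>
    with the cost of the bumps, and 4 is for the final sum; the 1 added to the square of \<kappa>
    avoids division by 0.\<close>
  define \<epsilon>0 where "\<epsilon>0 = min 1 (\<epsilon> / (4 * (480 * (\<kappa>\<^sup>2 + 1))))"
  have "0 < 4 * (480 * (\<kappa>\<^sup>2 + 1))" by (simp add: add_nonneg_pos)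
  then have \<epsilon>0: "0 < \<epsilon>0" "\<epsilon>0 \<le> 1" "4 * (480 * (\<kappa>\<^sup>2 + 1)) * \<epsilon>0 \<le> \<epsilon>"
    using \<epsilon>(1) by (auto simp: \<epsilon>0_def min_def pos_le_divide_eq mult.commute)
  have E: "compact (zero_set f)"
    using closed_zero_set[OF cf] by (auto simp: compact_eq_bounded_closed zero_set_def intro: bounded_subset[OF bounded_sphere[of 0 1]])
  obtain I :: "nat set" and x l where I: "finite I" "\<And>i. i \<in> I \<Longrightarrow> x i \<in> zero_set f \<and> 0 < l i \<and> l i \<le> 1"
    "zero_set f \<subseteq> (\<Union>i\<in>I. ball (x i) (2 * l i))" "(\<Sum>i\<in>I. l i powr (1 - 2 * s)) \<le> \<epsilon>0"
    using hausdorff_null_cover[OF null s0 E \<epsilon>0(1,2)] by blast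
  have xI: "x i \<in> unit_circle \<and> 0 < l i \<and> l i \<le> 1" if "i \<in> I" for i
    using I(2)[OF that] by (simp add: zero_set_def)
  have s12: "s < 1 / 2" using s by simp
  have "\<exists>\<phi>. cutoff_le s (\<Sum>i\<in>I. 48 * l i powr (1 - 2 * s)) \<phi> \<and>
    (\<forall>z. \<forall>i\<in>I. norm (z - x i) \<le> 2 * l i \<longrightarrow> \<phi> z = 1)"
    by (rule cutoff_exists[OF I(1) xI s(1) s12])
  then obtain \<phi> where \<phi>: "cutoff_le s (\<Sum>i\<in>I. 48 * l i powr (1 - 2 * s)) \<phi>"
    "\<forall>z. \<forall>i\<in>I. norm (z - x i) \<le> 2 * l i \<longrightarrow> \<phi> z = 1"
    by (elim exE conjE)
  define U where "U = (\<Union>i\<in>I. ball (x i) (2 * l i))"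
  have \<phi>U: "\<phi> z = 1" if zU: "z \<in> U" for z
  proof -
    obtain i where "i \<in> I" "dist (x i) z < 2 * l i" using zU by (auto simp: U_def)
    then have "norm (z - x i) \<le> 2 * l i" by (simp add: dist_norm norm_minus_commute)
    then show ?thesis using \<phi>(2) \<open>i \<in> I\<close> by blast
  qed
  obtain L1 where L1: "\<And>z w. \<bar>\<phi> z - \<phi> w\<bar> \<le> L1 * norm (z - w)" using \<phi>(1) unfolding cutoff_le_def by blast
  have r: "0 \<le> \<phi> z" "\<phi> z \<le> 1" for z using \<phi>(1) unfolding cutoff_le_def by blast+
  have b\<phi>: "besov_le s (48 * \<epsilon>0) (\<lambda>z. of_real (\<phi> z))"
  proof (rule besov_le_mono)
    show "besov_le s (\<Sum>i\<in>I. 48 * l i powr (1 - 2 * s)) (\<lambda>z. of_real (\<phi> z))" using \<phi>(1) unfolding cutoff_le_def by blast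
    show "(\<Sum>i\<in>I. 48 * l i powr (1 - 2 * s)) \<le> 48 * \<epsilon>0" using I(4) by (simp add: sum_distrib_left[symmetric])
  qed
  have "besov_le s (10 * \<kappa>\<^sup>2 * (48 * \<epsilon>0)) (\<lambda>z. g z * of_real (\<phi> z))"
    using holder_mult_besov_le[OF \<kappa> b\<phi>] s by simp
  moreover have "10 * \<kappa>\<^sup>2 * (48 * \<epsilon>0) \<le> \<epsilon> / 4"
  proof -
    have "480 * \<kappa>\<^sup>2 * \<epsilon>0 \<le> 480 * (\<kappa>\<^sup>2 + 1) * \<epsilon>0" using \<epsilon>0 by (intro mult_right_mono) auto
    then have "4 * (480 * \<kappa>\<^sup>2 * \<epsilon>0) \<le> \<epsilon>" using \<epsilon>0(3) by linarith
    then show ?thesis by simp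
  qed
  ultimately have b1: "besov_le s (\<epsilon> / 4) (\<lambda>z. g z * of_real (\<phi> z))" by (rule besov_le_mono)
  \<comment> \<open>Compactness gives a positive minimum of \<open>|f|\<close> off \<open>U\<close>.
    If \<open>U\<close> covers the circle, \<open>m = 1\<close> is a vacuous choice, and \<psi>
    vanishes on the whole circle.\<close>
  obtain m where m: "0 < m" "\<And>z. z \<in> unit_circle \<Longrightarrow> z \<notin> U \<Longrightarrow> m \<le> norm (f z)"
  proof (cases "unit_circle - U = {}")
    case True
    show ?thesis by (rule that[of 1]) (use True in auto)
  next
    case False
    have "open U" by (auto simp: U_def)
    then have "compact (unit_circle - U)" by (intro compact_diff compact_sphere)
    moreover have "continuous_on (unit_circle - U) (\<lambda>z. norm (f z))"
      by (intro continuous_on_norm continuous_on_subset[OF cf]) auto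
    ultimately obtain z0 where z0: "z0 \<in> unit_circle - U" "\<And>z. z \<in> unit_circle - U \<Longrightarrow> norm (f z0) \<le> norm (f z)"
      using continuous_attains_inf[OF _ False] by blast
    have "f z0 \<noteq> 0" using z0(1) I(3) by (auto simp: U_def zero_set_def)
    then show ?thesis using z0 that[of "norm (f z0)"] by auto
  qed
  define \<psi> where "\<psi> z = g z * of_real (1 - \<phi> z)" for z
  have "holder_le \<delta> (2 * (1 + \<bar>L1\<bar>)) (\<lambda>z. of_real (1 - \<phi> z))"
  proof (rule holder_le_lipschitz)
    show "norm (complex_of_real (1 - \<phi> z)) \<le> 1 + \<bar>L1\<bar>" for z unfolding norm_of_real using r[of z] by (simp add: abs_if)
    fix z w
    have "norm (complex_of_real (1 - \<phi> z) - complex_of_real (1 - \<phi> w)) = \<bar>\<phi> z - \<phi> w\<bar>"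
      unfolding of_real_diff[symmetric] norm_of_real by simp
    also have "\<dots> \<le> L1 * norm (z - w)" by (rule L1)
    also have "\<dots> \<le> (1 + \<bar>L1\<bar>) * norm (z - w)" by (intro mult_right_mono) auto
    finally show "norm (complex_of_real (1 - \<phi> z) - complex_of_real (1 - \<phi> w)) \<le> (1 + \<bar>L1\<bar>) * norm (z - w)" .
  qed (use s in auto)
  moreover obtain \<kappa>2 where "holder_le \<delta> \<kappa>2 g" unfolding g_def[abs_def] using holder_le_trig[of \<delta> A] A(1) s by auto
  ultimately obtain a where \<psi>: "holder_le \<delta> a \<psi>" unfolding \<psi>_def[abs_def] using holder_le_mult by blast
  define u where "u z = \<psi> z / f z" for z
  have "holder_le \<delta> (a / m + a * L / m\<^sup>2) u"
    unfolding u_def[abs_def]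
  proof (rule holder_le_divide[OF \<psi> f m(1)])
    fix z assume "z \<in> unit_circle" "norm (f z) < m"
    then have "z \<in> U" using m(2)[of z] by (meson not_le)
    then show "\<psi> z = 0" using \<phi>U by (simp add: \<psi>_def)
  qed
  \<comment> \<open>Makes \<open>8 (4 \<kappa>3 L)^2\<close>, the constant of
    \<open>(u - Q) f\<close>, at most \<open>\<epsilon> / 4\<close>.\<close>
  moreover define \<kappa>3 where "\<kappa>3 = sqrt (\<epsilon> / 32) / (4 * (L + 1))"
  moreover have \<kappa>3: "0 < \<kappa>3" using \<epsilon>(1) L by (simp add: \<kappa>3_def)
  ultimately obtain B c where B: "finite B" "holder_le s \<kappa>3 (\<lambda>z. u z - (\<Sum>n\<in>B. c n * z powi n))"
    using holder_trig_approximation[of \<delta> _ u s \<kappa>3] s by blast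
  define Q where "Q z = (\<Sum>n\<in>B. c n * z powi n)" for z
  have cQ: "continuous_on unit_circle Q" unfolding Q_def[abs_def] by (intro continuous_intros)
  have "holder_le s (2 * \<kappa>3 * (2 * L)) (\<lambda>z. (u z - Q z) * f z)"
    using holder_le_mult[OF B(2) fs] by (simp add: Q_def)
  from holder_imp_besov_le[OF s(1) this]
  have "besov_le s (8 * (4 * \<kappa>3 * L)\<^sup>2) (\<lambda>z. (u z - Q z) * f z)" by (simp add: mult_ac)
  moreover have "8 * (4 * \<kappa>3 * L)\<^sup>2 \<le> \<epsilon> / 4"
  proof -
    have "4 * \<kappa>3 * L \<le> 4 * \<kappa>3 * (L + 1)" using \<kappa>3 by simp
    also have "\<dots> = sqrt (\<epsilon> / 32)" using L by (simp add: \<kappa>3_def field_simps)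
    finally have "(4 * \<kappa>3 * L)\<^sup>2 \<le> (sqrt (\<epsilon> / 32))\<^sup>2" using \<kappa>3 L by (intro power_mono) auto
    then show ?thesis using \<epsilon>(1) by simp
  qed
  ultimately have b2: "besov_le s (\<epsilon> / 4) (\<lambda>z. (u z - Q z) * f z)" by (rule besov_le_mono)
  have b: "besov_le s \<epsilon> (\<lambda>z. g z * of_real (\<phi> z) + (u z - Q z) * f z)" using besov_le_add[OF b1 b2] by simp
  define P where "P = (\<lambda>\<phi>. \<Sum>n\<in>B. c n * mult_power n (distr_of_fun f) \<phi>)"
  have P: "P \<in> shift_span (distr_of_fun f) UNIV" unfolding shift_span_def P_def using B(1) by blast
  \<comment> \<open>At a zero of \<open>f\<close> the library quotient \<open>u z\<close> is 0, and
    \<open>\<psi> z\<close> is 0 as well because \<open>z\<close> lies in \<open>U\<close>.\<close>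
  have uf: "u z * f z = \<psi> z" if z: "z \<in> unit_circle" for z
  proof (cases "f z = 0")
    case True
    then have "z \<in> zero_set f" using z by (simp add: zero_set_def)
    then have "z \<in> U" using I(3) unfolding U_def by blast
    then show ?thesis using True \<phi>U by (simp add: u_def \<psi>_def)
  next
    case False
    then show ?thesis by (simp add: u_def)
  qed
  have "(if n \<in> A then fourier_coeff T n else 0) - fourier_coeff P n = circle_coeff (\<lambda>z. g z * of_real (\<phi> z) + (u z - Q z) * f z) n" for n
  proof -
    have "(if n \<in> A then fourier_coeff T n else 0) - fourier_coeff P n = circle_coeff g n - circle_coeff (\<lambda>z. Q z * f z) n"
      unfolding g_coeff P_def Q_def by (simp add: fourier_coeff_shift_sum[OF cf B(1)])
    also have "\<dots> = circle_coeff (\<lambda>z. g z - Q z * f z) n"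
      by (intro circle_coeff_diff[symmetric] continuous_intros cg cQ cf)
    also have "\<dots> = circle_coeff (\<lambda>z. g z * of_real (\<phi> z) + (u z - Q z) * f z) n"
    proof (rule circle_coeff_cong)
      fix z :: complex assume "z \<in> unit_circle"
      then have "u z * f z = g z * of_real (1 - \<phi> z)" using uf by (simp add: \<psi>_def)
      then show "g z - Q z * f z = g z * of_real (\<phi> z) + (u z - Q z) * f z" by (simp add: algebra_simps)
    qed
    finally show ?thesis .
  qed
  then have "weighted_sum_le p \<beta> (\<lambda>n. (if n \<in> A then fourier_coeff T n else 0) - fourier_coeff P n) \<eta>1"
    using \<epsilon>(2)[OF b] by simp
  from weighted_sum_le_add[OF A(2) this p(1)]
  have "weighted_sum_le p \<beta> (\<lambda>n. fourier_coeff T n - fourier_coeff P n) \<eta>" unfolding \<eta>1(2) by simp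
  with P show "\<exists>P\<in>shift_span (distr_of_fun f) UNIV. weighted_sum_le p \<beta> (\<lambda>n. fourier_coeff T n - fourier_coeff P n) \<eta>"
    by blast
qed

section \<open>Choice of exponents and conclusion\<close>

lemma Lip_imp_holder_le:
  assumes f: "f \<in> Lip \<delta>" and s: "0 \<le> s" "s \<le> \<delta>"
  shows "\<exists>\<kappa>. holder_le s \<kappa> f"
proof -
  obtain C where C: "C > 0" "\<And>z w. z \<in> unit_circle \<Longrightarrow> w \<in> unit_circle \<Longrightarrow> norm (f z - f w) \<le> C * norm (z - w) powr \<delta>"
    using f unfolding Lip_def by blast
  define D where "D = C * 2 powr \<delta>"
  have le: "norm (f z - f w) \<le> D * norm (z - w) powr s" "norm (f z - f w) \<le> D" if zw: "z \<in> unit_circle" "w \<in> unit_circle" for z w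
  proof -
    have "norm (z - w) powr \<delta> = norm (z - w) powr (\<delta> - s) * norm (z - w) powr s" by (simp add: powr_add[symmetric])
    also have "\<dots> \<le> 2 powr \<delta> * norm (z - w) powr s"
    proof (rule mult_right_mono)
      have "norm (z - w) powr (\<delta> - s) \<le> 2 powr (\<delta> - s)"
        using s norm_circle_diff_le_2[OF zw] by (intro powr_mono2) auto
      also have "\<dots> \<le> 2 powr \<delta>" using s by (intro powr_mono) auto
      finally show "norm (z - w) powr (\<delta> - s) \<le> 2 powr \<delta>" .
    qed simp
    finally have "C * norm (z - w) powr \<delta> \<le> C * (2 powr \<delta> * norm (z - w) powr s)" using C(1) by (intro mult_left_mono) auto
    then show "norm (f z - f w) \<le> D * norm (z - w) powr s" using C(2)[OF zw] by (simp add: D_def)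
    have "C * norm (z - w) powr \<delta> \<le> D"
      unfolding D_def using C(1) s norm_circle_diff_le_2[OF zw] by (intro mult_left_mono powr_mono2) auto
    then show "norm (f z - f w) \<le> D" using C(2)[OF zw] by linarith
  qed
  have D: "0 \<le> D" using C(1) by (simp add: D_def)
  have "holder_le s (D + norm (f 1)) f"
  proof (rule holder_leI)
    show "norm (f z) \<le> D + norm (f 1)" if "z \<in> unit_circle" for z
      using le(2)[OF that, of 1] norm_triangle_ineq2[of "f z" "f 1"] by simp
    fix z w :: complex assume zw: "z \<in> unit_circle" "w \<in> unit_circle"
    have "D * norm (z - w) powr s \<le> (D + norm (f 1)) * norm (z - w) powr s" by (intro mult_right_mono) auto
    then show "norm (f z - f w) \<le> (D + norm (f 1)) * norm (z - w) powr s" using le(1)[OF zw] by linarith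
  qed (use D in auto)
  then show ?thesis ..
qed

lemma distr_of_fun_in_A_space:
  fixes p \<beta> s :: real
  assumes "0 < p" "p \<le> 2" "0 \<le> \<beta>" "0 < s" "\<beta> + 1 / p - 1 / 2 < s" and f: "holder_le s L f"
  shows "distr_of_fun f \<in> A_space p \<beta>"
proof -
  obtain X where "weighted_sum_le p \<beta> (circle_coeff f) X"
    using besov_weighted_sum_exists[OF assms(1-5) holder_imp_besov_le[OF assms(4) f]] ..
  from weighted_sum_le_summable[OF this] show ?thesis
    using circle_distribution_distr_of_fun[OF holder_le_continuous_on[OF assms(4) f]]
    by (simp add: A_space_def fourier_coeff_distr_of_fun)
qed

theorem theorem4p3:
  fixes p q \<beta> \<delta> :: real and f :: "complex \<Rightarrow> complex"
  assumes "1 < p" "p < 2" and "q = p / (p - 1)"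
    and "\<beta> > 0" "\<beta> * q < 1"
    and "\<delta> > \<beta> + 1 / p - 1 / 2" and "f \<in> Lip \<delta>"
    and "zero_set f \<in> null_sets arc_length"
    and "ext_integral arc_length (\<lambda>z. ext_ln (ext_dist z (zero_set f))) = -\<infinity>"
  shows "closed_shift_span p \<beta> (distr_of_fun f) UNIV = closed_shift_span p \<beta> (distr_of_fun f) {0..} \<and>
    (distr_of_fun f \<in> A_space 1 \<beta> \<and> hausdorff_dim (zero_set f) < ereal (2 / q * (1 - \<beta> * q)) \<longrightarrow>
      cyclic p \<beta> (distr_of_fun f))"
proof (intro conjI impI)
  define \<sigma> where "\<sigma> = \<beta> + 1 / p - 1 / 2"
  have p: "0 < p" "p \<le> 2" and \<beta>: "0 \<le> \<beta>" using assms by auto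
  have "1 / q = (p - 1) / p" unfolding assms(3) by simp
  also have "\<dots> = 1 - 1 / p" using assms(1) by (simp add: diff_divide_distrib)
  finally have q: "1 / q = 1 - 1 / p" "0 < q" using assms(1,3) by simp_all
  have "\<beta> < 1 / q" using assms(5) q(2) by (simp add: pos_less_divide_eq)
  \<comment> \<open>The upper bound 1/2 is \<open>\<beta> < 1 / q\<close> rewritten with
    \<open>1 / q = 1 - 1 / p\<close>; positivity comes from \<open>p < 2\<close> and
    \<open>\<beta> > 0\<close>.\<close>
  then have \<sigma>: "0 < \<sigma>" "\<sigma> < 1 / 2" "\<sigma> < \<delta>"
  proof -
    have "1 / 2 < 1 / p" using assms(1,2) by (intro divide_strict_left_mono) auto
    with \<open>\<beta> < 1 / q\<close> assms(4,6) show "0 < \<sigma>" "\<sigma> < 1 / 2" "\<sigma> < \<delta>"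
      unfolding \<sigma>_def q(1) by linarith+
  qed
  \<comment> \<open>Lowering a Hoelder order is free on the circle, and both span lemmas work below
    the cap 1/2.\<close>
  define \<delta>' where "\<delta>' = min \<delta> (1 / 2)"
  have \<delta>': "\<sigma> < \<delta>'" "\<delta>' \<le> 1 / 2" "\<delta>' \<le> \<delta>" "0 < \<delta>'" using \<sigma> by (auto simp: \<delta>'_def)
  obtain L where L: "holder_le \<delta>' L f" using Lip_imp_holder_le[OF assms(7), of \<delta>'] \<delta>' by auto
  have E: "closed (zero_set f)" using closed_zero_set[OF holder_le_continuous_on[OF \<delta>'(4) L]] .
  note mass = nbhd_mass_at_top[OF E assms(8,9)]
  define s1 where "s1 = (\<sigma> + \<delta>') / 2"
  have s1: "0 < s1" "\<beta> + 1 / p - 1 / 2 < s1" "s1 < \<delta>'" using \<sigma> \<delta>' by (auto simp: s1_def \<sigma>_def[symmetric])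
  show span: "closed_shift_span p \<beta> (distr_of_fun f) UNIV = closed_shift_span p \<beta> (distr_of_fun f) {0..}"
    by (rule closed_shift_span_analytic[OF p \<beta> s1 \<delta>'(2) L E mass(1) _ _ mass(2)]) (auto simp: zero_set_def)
  assume asm: "distr_of_fun f \<in> A_space 1 \<beta> \<and> hausdorff_dim (zero_set f) < ereal (2 / q * (1 - \<beta> * q))"
  \<comment> \<open>The dimension bound becomes the limit of the exponent \<open>1 - 2 s\<close> of
    the cutoff cost as \<open>s\<close> decreases to \<sigma>.\<close>
  have "2 / q * (1 - \<beta> * q) = 2 * (1 / q) - 2 * \<beta>" using q(2) by (simp add: field_simps)
  also have "\<dots> = 1 - 2 * \<sigma>" by (simp add: q(1) \<sigma>_def)
  finally have "hausdorff_dim (zero_set f) < ereal (1 - 2 * \<sigma>)" using asm by simp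
  then obtain s0 where s0: "0 < s0" "hausdorff_measure s0 (zero_set f) = 0" "s0 < 1 - 2 * \<sigma>"
    unfolding hausdorff_dim_def INF_less_iff by auto
  \<comment> \<open>Any \<open>s\<close> below \<nu> satisfies both \<open>s < \<delta>'\<close> and
    \<open>s0 \<le> 1 - 2 s\<close>, and \<nu> stays above \<sigma> because
    \<open>s0 < 1 - 2 \<sigma>\<close>.\<close>
  define \<nu> where "\<nu> = min \<delta>' ((1 - s0) / 2)"
  have \<nu>: "\<sigma> < \<nu>" "\<nu> \<le> \<delta>'" "\<nu> \<le> (1 - s0) / 2"
  proof -
    show "\<sigma> < \<nu>" using \<delta>' s0 by (simp add: \<nu>_def)
    show "\<nu> \<le> \<delta>'" "\<nu> \<le> (1 - s0) / 2" unfolding \<nu>_def by (rule min.cobounded1, rule min.cobounded2)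
  qed
  define s where "s = (\<sigma> + \<nu>) / 2"
  have s: "0 < s" "\<beta> + 1 / p - 1 / 2 < s" "s < \<delta>'" "s0 \<le> 1 - 2 * s"
  proof -
    have "\<sigma> < s" using \<nu> by (simp add: s_def)
    then show "0 < s" "\<beta> + 1 / p - 1 / 2 < s" using \<sigma>(1) by (auto simp: \<sigma>_def)
    have "s < \<nu>" using \<nu> by (simp add: s_def)
    then show "s < \<delta>'" "s0 \<le> 1 - 2 * s" using \<nu> by simp_all
  qed
  have "A_space p \<beta> \<subseteq> closed_shift_span p \<beta> (distr_of_fun f) UNIV"
    using closed_shift_span_full[OF p \<beta> s(1-3) \<delta>'(2) L s0(2,1) s(4)] by blast
  moreover have "closed_shift_span p \<beta> (distr_of_fun f) UNIV \<subseteq> A_space p \<beta>"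
    unfolding closed_shift_span_def by blast
  moreover have "distr_of_fun f \<in> A_space p \<beta>"
    using distr_of_fun_in_A_space[OF p \<beta> \<delta>'(4) _ L] \<delta>'(1) by (simp add: \<sigma>_def)
  ultimately show "cyclic p \<beta> (distr_of_fun f)" unfolding cyclic_def using span by blast
qed

end
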